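(* Let $X$ be a P-complex in $V$ with compact cells, let $p\ge1$, let $S=\bigwedge^*V$, and let $v\in\mathcal{U}(X)$ be a convenient point. Let $a_1,\dots,a_p$ be $0$-cochains of $X$ with values in $V$ such that $da_i\in\mathcal{R}^1(X,S)$ for all $i$. Then the product of cocycles $da_1\smile_v\cdots\smile_v da_p\in C^p(X,\bigwedge^*V)$ is completely determined by the $0$-cochain $\prod(a_1,\dots,a_p)=a_1\cdots a_p$ with values in the symmetric algebra of $V$. That is, if $b_1,\dots,b_p$ are also $0$-cochains with values in $V$ with $db_i\in\mathcal{R}^1(X,S)$ for all $i$ and $\prod(a_1,\dots,a_p)=\prod(b_1,\dots,b_p)$, then $da_1\smile_v\cdots\smile_v da_p=db_1\smile_v\cdots\smile_v db_p$.
   Context: $V$ is a real vector space of finite dimension $n$, $V^*$ its dual. P-complex: a finite set $X$ of closed convex polyhedra in $V$ (its cells) such that every face of a cell is a cell and every non-empty intersection of two cells is a common face of both. All cells are assumed compact. Cochains: $S$ is a supercommutative ring ($\mathbb{Z}/2$-graded, $ab=(-1)^{|a||b|}ba$ for homogeneous $a,b$); here $S=\bigwedge^*V$. $C^p(X,S)$ is the module of functions from oriented $p$-dimensional cells to $S$ that change sign when the orientation of the cell is reversed; $d\colon C^p(X,S)\to C^{p+1}(X,S)$ is the usual coboundary: $(dr)(\mu)$ is the sum of $r$ over the facets of $\mu$ with induced boundary orientation (outward normal first). A $0$-cochain with values in $V=\bigwedge^1V$ is identified with a function from vertices (positively oriented) to $V$, and $\prod(a_1,\dots,a_p)$ is the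 function $x\mapsto a_1(x)\cdots a_p(x)\in\mathrm{Sym}^pV$ on vertices. For a cell $\delta$, $V_\delta\subset V$ is the linear subspace generated by differences of points of $\delta$. For a cell $\gamma$, let $X_\gamma$ be the P-complex in $V_\gamma$ of faces of $\gamma$ ($\gamma$ translated into $V_\gamma$; the choice is immaterial). For a face $\delta$ of $\gamma$ the dual cone $\delta^*\subset (V_\gamma)^*$ consists of all $w\in(V_\gamma)^*$ for which the maximum of $w$ on $\gamma$ is attained at every point of $\delta$; $\dim\delta^*=\dim\gamma-\dim\delta$. These cones form the dual fan $X_\gamma^*$, with $j$-dimensional skeleton $(X_\gamma^* )^j$. Let $\pi_\gamma\colon V^*\to(V_\gamma)^*$ be the restriction map. Two P-complexes in a space are transversal if for any cells $\delta_1,\delta_2$ of them with $\delta_1\cap\delta_2\ne\emptyset$ one has $\operatorname{codim}(V_{\delta_1}\cap V_{\delta_2})=\operatorname{codim}V_{\delta_1}+\operatorname{codim}V_{\delta_2}$. A point $v\in V^*$ is $(p,q)$-convenient if $\pi_\gamma(v)+(X_\gamma^* )^q$ and $(X_\gamma^* )^p$ are transversal for every $\gamma\in X$ with $\dim\gamma=p+q$; $\mathcal{U}_{p,q}(X)$ is the set of such points, and $\mathcal{U}(X)=\bigcap_{p,q}\mathcal{U}_{p,q}(X)$ is the set of convenient points. Product: for $v\in\mathcal{U}_{p,q}(X)$ and an oriented cell $\gamma$ of dimension $p+q$, $(r_p\smile_v r_q)(\gamma)=\sum_{(\delta,\lambda)\in\mathcal{P}(p,q,\gamma,v)}r_p(\delta)r_q(\lambda)$,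 where $\mathcal{P}(p,q,\gamma,v)$ is the set of pairs $(\delta,\lambda)$ of faces of $\gamma$ of dimensions $p,q$ with $(\pi_\gamma(v)+\delta^* )\cap\lambda^*\neq\emptyset$, oriented so that $V_\gamma=V_\delta\oplus V_\lambda$ as oriented spaces. Iterated products may be read as bracketed from the left. $\mathcal{R}^p(X,S)$ is the set of cocycles $r_p\in C^p(X,S)$ such that $r_p(\delta)\in\bigwedge^pV_\delta$ for every $p$-cell $\delta$. *)

theory Defs
  imports
    "HOL-Analysis.Analysis"
    "HOL-Library.Poly_Mapping"
    "HOL-Library.Function_Algebras"
    "Jordan_Normal_Form.Determinant"
begin

section \<open>Exterior and symmetric algebra of a real vector space\<close>

text \<open>
  Words form a monoid under concatenation, so \<open>'a list \<Rightarrow>\<^sub>0 real\<close> with the convolution product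
  is the free associative unital real algebra on the set of all elements of \<open>'a\<close>.
  The tensor algebra, and from it the exterior and the symmetric algebra of \<open>'a\<close>, arise as
  quotients by two-sided ideals.
\<close>

instantiation list :: (type) monoid_add
begin

definition plus_list :: "'a list \<Rightarrow> 'a list \<Rightarrow> 'a list"
  where "xs + ys = xs @ ys"

definition zero_list :: "'a list"
  where "0 = []"

instance
  by standard (simp_all add: plus_list_def zero_list_def)

end

inductive_set two_sided_ideal :: "'r::ring_1 set \<Rightarrow> 'r set" for R where
  zero: "0 \<in> two_sided_ideal R"
| gen: "r \<in> R \<Longrightarrow> a * r * b \<in> two_sided_ideal R"
| add: "x \<in> two_sided_ideal R \<Longrightarrow> y \<in> two_sided_ideal R \<Longrightarrow> x + y \<in> two_sided_ideal R"

lemma two_sided_ideal_mult: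
  assumes "x \<in> two_sided_ideal R"
  shows "c * x * d \<in> two_sided_ideal R"
  using assms
proof induction
  case zero
  then show ?case by (simp add: two_sided_ideal.zero)
next
  case (gen r a b)
  then have "(c * a) * r * (b * d) \<in> two_sided_ideal R"
    by (rule two_sided_ideal.gen)
  then show ?case by (simp add: mult.assoc)
next
  case (add x y)
  then show ?case by (simp add: algebra_simps two_sided_ideal.add)
qed

lemma two_sided_ideal_mult_left: "x \<in> two_sided_ideal R \<Longrightarrow> c * x \<in> two_sided_ideal R"
  using two_sided_ideal_mult[of x R c 1] by simp

lemma two_sided_ideal_mult_right: "x \<in> two_sided_ideal R \<Longrightarrow> x * d \<in> two_sided_ideal R"
  using two_sided_ideal_mult[of x R 1 d] by simp

lemma two_sided_ideal_uminus: "x \<in> two_sided_ideal R \<Longrightarrow> - x \<in> two_sided_ideal R"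
  using two_sided_ideal_mult_left[of x R "-1"] by simp

lemma two_sided_ideal_diff:
  "x \<in> two_sided_ideal R \<Longrightarrow> y \<in> two_sided_ideal R \<Longrightarrow> x - y \<in> two_sided_ideal R"
  using two_sided_ideal.add[of x R "- y"] two_sided_ideal_uminus[of y R] by simp

definition ideal_cong :: "'r::ring_1 set \<Rightarrow> 'r \<Rightarrow> 'r \<Rightarrow> bool"
  where "ideal_cong R x y \<longleftrightarrow> x - y \<in> two_sided_ideal R"

lemma equivp_ideal_cong: "equivp (ideal_cong R)"
proof (rule equivpI)
  show "reflp (ideal_cong R)"
    by (rule reflpI) (simp add: ideal_cong_def two_sided_ideal.zero)
  show "symp (ideal_cong R)"
    by (rule sympI) (metis ideal_cong_def minus_diff_eq two_sided_ideal_uminus)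
  show "transp (ideal_cong R)"
  proof (rule transpI)
    fix x y z
    assume "ideal_cong R x y" "ideal_cong R y z"
    then have "(x - y) + (y - z) \<in> two_sided_ideal R"
      unfolding ideal_cong_def by (rule two_sided_ideal.add)
    then show "ideal_cong R x z" by (simp add: ideal_cong_def)
  qed
qed

lemma ideal_cong_refl: "ideal_cong R x x"
  by (simp add: ideal_cong_def two_sided_ideal.zero)

lemma ideal_cong_add:
  "ideal_cong R x x' \<Longrightarrow> ideal_cong R y y' \<Longrightarrow> ideal_cong R (x + y) (x' + y')"
  unfolding ideal_cong_def by (metis add_diff_add two_sided_ideal.add)

lemma ideal_cong_uminus: "ideal_cong R x x' \<Longrightarrow> ideal_cong R (- x) (- x')"
  unfolding ideal_cong_def by (metis minus_diff_minus two_sided_ideal_uminus)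

lemma ideal_cong_diff:
  "ideal_cong R x x' \<Longrightarrow> ideal_cong R y y' \<Longrightarrow> ideal_cong R (x - y) (x' - y')"
  using ideal_cong_add[of R x x' "- y" "- y'"] ideal_cong_uminus[of R y y'] by simp

lemma ideal_cong_mult:
  assumes "ideal_cong R x x'" "ideal_cong R y y'"
  shows "ideal_cong R (x * y) (x' * y')"
proof -
  have "(x - x') * y + x' * (y - y') \<in> two_sided_ideal R"
    using assms unfolding ideal_cong_def
    by (intro two_sided_ideal.add two_sided_ideal_mult_left two_sided_ideal_mult_right)
  then show ?thesis by (simp add: ideal_cong_def algebra_simps)
qed

abbreviation fgen :: "'a \<Rightarrow> 'a list \<Rightarrow>\<^sub>0 real"
  where "fgen x \<equiv> Poly_Mapping.single [x] 1"

abbreviation fscal :: "real \<Rightarrow> 'a list \<Rightarrow>\<^sub>0 real"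
  where "fscal c \<equiv> Poly_Mapping.single 0 c"

lemma poly_mapping_single_induct [case_names zero add]:
  fixes f :: "'k \<Rightarrow>\<^sub>0 'c::comm_monoid_add"
  assumes "P 0" and "\<And>f k v. P f \<Longrightarrow> P (f + Poly_Mapping.single k v)"
  shows "P f"
proof (induction f rule: update_induct)
  case const
  then show ?case by (simp add: assms(1))
next
  case (update f k v)
  have "Poly_Mapping.update k v f = f + Poly_Mapping.single k v"
    using update(1)
    by (intro poly_mapping_eqI)
       (auto simp: lookup_update lookup_add lookup_single when_def in_keys_iff)
  then show ?case using assms(2)[OF update(3)] by simp
qed

lemma fscal_central: "fscal c * f = f * fscal c"
proof (induction f rule: poly_mapping_single_induct)
  case zero
  then show ?case by simp
next
  case (add f k v)
  then show ?case by (simp add: algebra_simps mult_single)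
qed

lemma mult_fscal_left_commute: "f * (fscal c * g) = fscal c * (f * g)"
  using fscal_central[of c f] by (simp add: mult.assoc[symmetric])

definition tensor_relations :: "('a::real_vector list \<Rightarrow>\<^sub>0 real) set"
  where "tensor_relations =
    {fgen (x + y) - fgen x - fgen y | x y. True} \<union> {fgen (c *\<^sub>R x) - fscal c * fgen x | c x. True}"

definition exterior_relations :: "('a::real_vector list \<Rightarrow>\<^sub>0 real) set"
  where "exterior_relations = tensor_relations \<union> {fgen x * fgen x | x. True}"

definition symmetric_relations :: "('a::real_vector list \<Rightarrow>\<^sub>0 real) set"
  where "symmetric_relations = tensor_relations \<union> {fgen x * fgen y - fgen y * fgen x | x y. True}"

text \<open>The quotients are not the zero ring, since every relation has constant term \<open>0\<close>.\<close>

abbreviation const_term :: "('a list \<Rightarrow>\<^sub>0 'b::zero) \<Rightarrow> 'b"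
  where "const_term f \<equiv> Poly_Mapping.lookup f []"

lemma lookup_mult_Nil:
  "const_term (f * g) = const_term f * const_term (g :: 'a list \<Rightarrow>\<^sub>0 'b::semiring_0)"
proof (induction f rule: poly_mapping_single_induct)
  case zero
  then show ?case by simp
next
  case (add f k v)
  have "const_term (Poly_Mapping.single k v * g) = const_term (Poly_Mapping.single k v) * const_term g"
  proof (induction g rule: poly_mapping_single_induct)
    case zero
    then show ?case by simp
  next
    case (add g l w)
    then show ?case
      by (auto simp: algebra_simps mult_single lookup_add lookup_single when_def plus_list_def)
  qed
  with add show ?case by (simp add: algebra_simps lookup_add)
qed

lemma constant_term_ideal:
  fixes R :: "('a list \<Rightarrow>\<^sub>0 real) set"
  assumes "x \<in> two_sided_ideal R" and R: "\<And>r. r \<in> R \<Longrightarrow> const_term r = 0"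
  shows "const_term x = 0"
  using assms(1) by induction (simp_all add: R lookup_mult_Nil lookup_add)

lemma constant_term_tensor_relations: "r \<in> tensor_relations \<Longrightarrow> const_term r = 0"
  by (auto simp: tensor_relations_def lookup_mult_Nil lookup_minus lookup_single)

lemma one_not_cong_zero:
  fixes R :: "('a list \<Rightarrow>\<^sub>0 real) set"
  assumes "\<And>r. r \<in> R \<Longrightarrow> const_term r = 0"
  shows "\<not> ideal_cong R 0 1"
proof
  assume "ideal_cong R 0 1"
  then have "- 1 \<in> two_sided_ideal R" by (simp add: ideal_cong_def)
  then have "const_term (- 1 :: 'a list \<Rightarrow>\<^sub>0 real) = 0"
    by (rule constant_term_ideal) (rule assms)
  then show False by (simp add: lookup_one zero_list_def)
qed

subsection \<open>Exterior algebra\<close>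

quotient_type (overloaded) 'a ext = "'a::real_vector list \<Rightarrow>\<^sub>0 real" / "ideal_cong exterior_relations"
  by (rule equivp_ideal_cong)

instantiation ext :: (real_vector) real_algebra_1
begin

lift_definition zero_ext :: "'a ext" is 0 .
lift_definition one_ext :: "'a ext" is 1 .
lift_definition plus_ext :: "'a ext \<Rightarrow> 'a ext \<Rightarrow> 'a ext" is "(+)" by (rule ideal_cong_add)
lift_definition minus_ext :: "'a ext \<Rightarrow> 'a ext \<Rightarrow> 'a ext" is "(-)" by (rule ideal_cong_diff)
lift_definition uminus_ext :: "'a ext \<Rightarrow> 'a ext" is uminus by (rule ideal_cong_uminus)
lift_definition times_ext :: "'a ext \<Rightarrow> 'a ext \<Rightarrow> 'a ext" is "(*)" by (rule ideal_cong_mult)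
lift_definition scaleR_ext :: "real \<Rightarrow> 'a ext \<Rightarrow> 'a ext" is "\<lambda>c f. fscal c * f"
  by (intro ideal_cong_mult ideal_cong_refl)

instance
proof
  fix a b c :: "'a ext" and r s :: real
  show "a + b + c = a + (b + c)" by transfer (simp add: algebra_simps ideal_cong_refl)
  show "a + b = b + a" by transfer (simp add: algebra_simps ideal_cong_refl)
  show "0 + a = a" by transfer (simp add: ideal_cong_refl)
  show "- a + a = 0" by transfer (simp add: ideal_cong_refl)
  show "a - b = a + - b" by transfer (simp add: ideal_cong_refl)
  show "a * b * c = a * (b * c)" by transfer (simp add: algebra_simps ideal_cong_refl)
  show "(a + b) * c = a * c + b * c" by transfer (simp add: algebra_simps ideal_cong_refl)
  show "a * (b + c) = a * b + a * c" by transfer (simp add: algebra_simps ideal_cong_refl)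
  show "1 * a = a" by transfer (simp add: ideal_cong_refl)
  show "a * 1 = a" by transfer (simp add: ideal_cong_refl)
  show "(0::'a ext) \<noteq> 1"
    by transfer
       (rule one_not_cong_zero,
        auto simp: exterior_relations_def constant_term_tensor_relations lookup_mult_Nil lookup_single)
  show "r *\<^sub>R (a + b) = r *\<^sub>R a + r *\<^sub>R b" by transfer (simp add: algebra_simps ideal_cong_refl)
  show "(r + s) *\<^sub>R a = r *\<^sub>R a + s *\<^sub>R a"
    by transfer (simp add: algebra_simps single_add ideal_cong_refl)
  show "r *\<^sub>R s *\<^sub>R a = (r * s) *\<^sub>R a"
    by transfer (simp add: mult.assoc[symmetric] mult_single ideal_cong_refl)
  show "1 *\<^sub>R a = a" by transfer (simp add: ideal_cong_refl)
  show "r *\<^sub>R a * b = r *\<^sub>R (a * b)" by transfer (simp add: mult.assoc ideal_cong_refl)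
  show "a * r *\<^sub>R b = r *\<^sub>R (a * b)"
    by transfer (simp add: mult_fscal_left_commute ideal_cong_refl)
qed

end

lift_definition ext_incl :: "'a::real_vector \<Rightarrow> 'a ext" is fgen .

definition ext_power :: "nat \<Rightarrow> 'a::real_vector set \<Rightarrow> 'a ext set"
  where "ext_power p W = span {prod_list (map ext_incl ws) | ws. length ws = p \<and> set ws \<subseteq> W}"

subsection \<open>Symmetric algebra\<close>

lemma symmetric_relations_commute:
  fixes f g :: "'a::real_vector list \<Rightarrow>\<^sub>0 real"
  shows "ideal_cong symmetric_relations (f * g) (g * f)"
proof -
  let ?C = "ideal_cong symmetric_relations"
  have trans: "?C x z" if "?C x y" "?C y z" for x y z :: "'a list \<Rightarrow>\<^sub>0 real"
    using that by (rule equivp_transp[OF equivp_ideal_cong])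
  have gen: "?C (fgen x * fgen y) (fgen y * fgen x)" for x y :: 'a
  proof -
    have "1 * (fgen x * fgen y - fgen y * fgen x) * 1 \<in> two_sided_ideal symmetric_relations"
      by (rule two_sided_ideal.gen) (auto simp: symmetric_relations_def)
    then show ?thesis by (simp add: ideal_cong_def)
  qed
  have single_Cons: "Poly_Mapping.single (x # xs) v = fgen x * Poly_Mapping.single xs v" for x :: 'a and xs v
    by (simp add: mult_single plus_list_def)
  have ind: "?C (h * Poly_Mapping.single xs v) (Poly_Mapping.single xs v * h)"
    if h: "\<And>x. ?C (h * fgen x) (fgen x * h)" for h :: "'a list \<Rightarrow>\<^sub>0 real" and xs v
  proof (induction xs)
    case Nil
    show ?case using fscal_central[of v h] by (simp add: zero_list_def ideal_cong_refl)
  next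
    case (Cons x xs)
    let ?m = "Poly_Mapping.single xs v"
    have "?C ((h * fgen x) * ?m) ((fgen x * h) * ?m)"
      by (rule ideal_cong_mult[OF h ideal_cong_refl])
    then have "?C (h * (fgen x * ?m)) (fgen x * (h * ?m))"
      by (simp only: mult.assoc)
    moreover have "?C (fgen x * (h * ?m)) (fgen x * (?m * h))"
      by (rule ideal_cong_mult[OF ideal_cong_refl Cons])
    ultimately have "?C (h * (fgen x * ?m)) (fgen x * (?m * h))"
      by (rule trans)
    then show ?case
      by (simp only: single_Cons[of x xs v] mult.assoc)
  qed
  have ind': "?C (h * k) (k * h)" if h: "\<And>x. ?C (h * fgen x) (fgen x * h)" for h k :: "'a list \<Rightarrow>\<^sub>0 real"
  proof (induction k rule: poly_mapping_single_induct)
    case zero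
    then show ?case by (simp add: ideal_cong_refl)
  next
    case (add f k v)
    then show ?case by (simp add: algebra_simps ideal_cong_add ind[OF h])
  qed
  have sym: "?C x y" if "?C y x" for x y :: "'a list \<Rightarrow>\<^sub>0 real"
    using that by (rule equivp_symp[OF equivp_ideal_cong])
  have "?C (f * fgen x) (fgen x * f)" for x
    by (rule sym) (rule ind'[OF gen])
  then show ?thesis by (rule ind')
qed

quotient_type (overloaded) 'a sym = "'a::real_vector list \<Rightarrow>\<^sub>0 real" / "ideal_cong symmetric_relations"
  by (rule equivp_ideal_cong)

instantiation sym :: (real_vector) "{comm_ring_1, real_algebra_1}"
begin

lift_definition zero_sym :: "'a sym" is 0 .
lift_definition one_sym :: "'a sym" is 1 .
lift_definition plus_sym :: "'a sym \<Rightarrow> 'a sym \<Rightarrow> 'a sym" is "(+)" by (rule ideal_cong_add)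
lift_definition minus_sym :: "'a sym \<Rightarrow> 'a sym \<Rightarrow> 'a sym" is "(-)" by (rule ideal_cong_diff)
lift_definition uminus_sym :: "'a sym \<Rightarrow> 'a sym" is uminus by (rule ideal_cong_uminus)
lift_definition times_sym :: "'a sym \<Rightarrow> 'a sym \<Rightarrow> 'a sym" is "(*)" by (rule ideal_cong_mult)
lift_definition scaleR_sym :: "real \<Rightarrow> 'a sym \<Rightarrow> 'a sym" is "\<lambda>c f. fscal c * f"
  by (intro ideal_cong_mult ideal_cong_refl)

instance
proof
  fix a b c :: "'a sym" and r s :: real
  show "a + b + c = a + (b + c)" by transfer (simp add: algebra_simps ideal_cong_refl)
  show "a + b = b + a" by transfer (simp add: algebra_simps ideal_cong_refl)
  show "0 + a = a" by transfer (simp add: ideal_cong_refl)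
  show "- a + a = 0" by transfer (simp add: ideal_cong_refl)
  show "a - b = a + - b" by transfer (simp add: ideal_cong_refl)
  show "a * b * c = a * (b * c)" by transfer (simp add: algebra_simps ideal_cong_refl)
  show "a * b = b * a" by transfer (rule symmetric_relations_commute)
  show "(a + b) * c = a * c + b * c" by transfer (simp add: algebra_simps ideal_cong_refl)
  show "a * (b + c) = a * b + a * c" by transfer (simp add: algebra_simps ideal_cong_refl)
  show "1 * a = a" by transfer (simp add: ideal_cong_refl)
  show "a * 1 = a" by transfer (simp add: ideal_cong_refl)
  show "(0::'a sym) \<noteq> 1"
    by transfer
       (rule one_not_cong_zero,
        auto simp: symmetric_relations_def constant_term_tensor_relations lookup_mult_Nil
          lookup_single lookup_minus)
  show "r *\<^sub>R (a + b) = r *\<^sub>R a + r *\<^sub>R b" by transfer (simp add: algebra_simps ideal_cong_refl)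
  show "(r + s) *\<^sub>R a = r *\<^sub>R a + s *\<^sub>R a"
    by transfer (simp add: algebra_simps single_add ideal_cong_refl)
  show "r *\<^sub>R s *\<^sub>R a = (r * s) *\<^sub>R a"
    by transfer (simp add: mult.assoc[symmetric] mult_single ideal_cong_refl)
  show "1 *\<^sub>R a = a" by transfer (simp add: ideal_cong_refl)
  show "r *\<^sub>R a * b = r *\<^sub>R (a * b)" by transfer (simp add: mult.assoc ideal_cong_refl)
  show "a * r *\<^sub>R b = r *\<^sub>R (a * b)"
    by transfer (simp add: mult_fscal_left_commute ideal_cong_refl)
qed

end

lift_definition sym_incl :: "'a::real_vector \<Rightarrow> 'a sym" is fgen .

section \<open>P-complexes\<close>

text \<open>
  \<open>face_of\<close> admits the empty face; cells and faces of cells are understood to be nonempty.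
\<close>

definition p_complex :: "'a::euclidean_space set set \<Rightarrow> bool"
  where "p_complex X \<longleftrightarrow>
    finite X \<and>
    (\<forall>\<delta>\<in>X. polyhedron \<delta> \<and> \<delta> \<noteq> {}) \<and>
    (\<forall>\<gamma>\<in>X. \<forall>\<delta>. \<delta> face_of \<gamma> \<and> \<delta> \<noteq> {} \<longrightarrow> \<delta> \<in> X) \<and>
    (\<forall>\<gamma>\<in>X. \<forall>\<delta>\<in>X. \<gamma> \<inter> \<delta> \<noteq> {} \<longrightarrow> (\<gamma> \<inter> \<delta>) face_of \<gamma> \<and> (\<gamma> \<inter> \<delta>) face_of \<delta>)"

definition dirspace :: "'b::real_vector set \<Rightarrow> 'b set"
  where "dirspace \<delta> = span {x - y | x y. x \<in> \<delta> \<and> y \<in> \<delta>}"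

section \<open>Dual spaces, dual fans and convenient points\<close>

text \<open>Pointwise vector space structure, completing the additive one from \<open>Function_Algebras\<close>.\<close>

instantiation "fun" :: (type, real_vector) real_vector
begin

definition scaleR_fun :: "real \<Rightarrow> ('a \<Rightarrow> 'b) \<Rightarrow> 'a \<Rightarrow> 'b"
  where "c *\<^sub>R f = (\<lambda>x. c *\<^sub>R f x)"

instance
  by standard (simp_all add: scaleR_fun_def fun_eq_iff algebra_simps)

end

text \<open>
  The dual of a subspace \<open>W\<close>: linear functionals on \<open>W\<close>, set to \<open>0\<close> off \<open>W\<close> so that each functional
  on \<open>W\<close> is represented by exactly one function.
\<close>

definition dual_space :: "'a::real_vector set \<Rightarrow> ('a \<Rightarrow> real) set"
  where "dual_space W = {w.
    (\<forall>x\<in>W. \<forall>y\<in>W. w (x + y) = w x + w y) \<and>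
    (\<forall>c. \<forall>x\<in>W. w (c *\<^sub>R x) = c * w x) \<and>
    (\<forall>x. x \<notin> W \<longrightarrow> w x = 0)}"

definition restrict_functional :: "'a::real_vector set \<Rightarrow> ('a \<Rightarrow> real) \<Rightarrow> 'a \<Rightarrow> real"
  where "restrict_functional W v = (\<lambda>x. if x \<in> W then v x else 0)"

text \<open>
  The functional \<open>w\<close> is defined on \<open>dirspace \<gamma>\<close> only, hence \<open>w (y - x) \<le> 0\<close>: this says
  \<open>w (y - z) \<le> w (x - z)\<close> for every translation of \<open>\<gamma>\<close> into \<open>dirspace \<gamma>\<close> by some \<open>- z\<close>.
\<close>

definition dual_cone :: "'a::real_vector set \<Rightarrow> 'a set \<Rightarrow> ('a \<Rightarrow> real) set"
  where "dual_cone \<gamma> \<delta> = {w \<in> dual_space (dirspace \<gamma>). \<forall>x\<in>\<delta>. \<forall>y\<in>\<gamma>. w (y - x) \<le> 0}"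

definition dual_fan_skeleton :: "nat \<Rightarrow> 'a::real_vector set \<Rightarrow> ('a \<Rightarrow> real) set set"
  where "dual_fan_skeleton j \<gamma> =
    {dual_cone \<gamma> \<delta> | \<delta>. \<delta> face_of \<gamma> \<and> \<delta> \<noteq> {} \<and> dim (dirspace (dual_cone \<gamma> \<delta>)) \<le> j}"

definition codim_in :: "'b::real_vector set \<Rightarrow> 'b set \<Rightarrow> int"
  where "codim_in E U = int (dim E) - int (dim U)"

definition transversal_in :: "'b::real_vector set \<Rightarrow> 'b set set \<Rightarrow> 'b set set \<Rightarrow> bool"
  where "transversal_in E A B \<longleftrightarrow>
    (\<forall>\<delta>\<^sub>1\<in>A. \<forall>\<delta>\<^sub>2\<in>B. \<delta>\<^sub>1 \<inter> \<delta>\<^sub>2 \<noteq> {} \<longrightarrow>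
      codim_in E (dirspace \<delta>\<^sub>1 \<inter> dirspace \<delta>\<^sub>2) =
      codim_in E (dirspace \<delta>\<^sub>1) + codim_in E (dirspace \<delta>\<^sub>2))"

definition pq_convenient :: "nat \<Rightarrow> nat \<Rightarrow> 'a::euclidean_space set set \<Rightarrow> ('a \<Rightarrow> real) set"
  where "pq_convenient p q X = {v \<in> dual_space UNIV.
    \<forall>\<gamma>\<in>X. aff_dim \<gamma> = int (p + q) \<longrightarrow>
      transversal_in (dual_space (dirspace \<gamma>))
        ((\<lambda>K. (+) (restrict_functional (dirspace \<gamma>) v) ` K) ` dual_fan_skeleton q \<gamma>)
        (dual_fan_skeleton p \<gamma>)}"

definition convenient :: "'a::euclidean_space set set \<Rightarrow> ('a \<Rightarrow> real) set"
  where "convenient X = (\<Inter>p. \<Inter>q. pq_convenient p q X)"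

section \<open>Orientations and cochains\<close>

definition ordered_basis :: "'a::real_vector set \<Rightarrow> 'a list \<Rightarrow> bool"
  where "ordered_basis W b \<longleftrightarrow> distinct b \<and> independent (set b) \<and> span (set b) = W"

definition basis_change_det :: "'a::real_vector list \<Rightarrow> 'a list \<Rightarrow> real"
  where "basis_change_det b b' =
    Determinant.det (Matrix.mat (length b) (length b')
      (\<lambda>(i, j). representation (set b) (b' ! j) (b ! i)))"

text \<open>
  An orientation assigns a sign to each ordered basis, compatibly with the determinant of a change
  of basis. The space \<open>{0}\<close>, whose only ordered basis is \<open>[]\<close>, thus has two orientations as well;
  its positive orientation maps \<open>[]\<close> to \<open>1\<close>. The opposite orientation is \<open>- ori\<close>.
\<close>

definition orientation :: "'a::real_vector set \<Rightarrow> ('a list \<Rightarrow> real) \<Rightarrow> bool"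
  where "orientation W ori \<longleftrightarrow>
    (\<forall>b. ordered_basis W b \<longrightarrow> ori b \<in> {1, -1}) \<and>
    (\<forall>b b'. ordered_basis W b \<and> ordered_basis W b' \<longrightarrow>
      ori b' = sgn (basis_change_det b b') * ori b) \<and>
    (\<forall>b. \<not> ordered_basis W b \<longrightarrow> ori b = 0)"

definition oriented_cell ::
    "'a::euclidean_space set set \<Rightarrow> nat \<Rightarrow> 'a set \<Rightarrow> ('a list \<Rightarrow> real) \<Rightarrow> bool"
  where "oriented_cell X p \<delta> ori \<longleftrightarrow>
    \<delta> \<in> X \<and> aff_dim \<delta> = int p \<and> orientation (dirspace \<delta>) ori"

text \<open>Cochains are set to \<open>0\<close> off the oriented \<open>p\<close>-cells, so that \<open>=\<close> is equality of cochains.\<close>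

type_synonym ('a, 's) cochain = "'a set \<Rightarrow> ('a list \<Rightarrow> real) \<Rightarrow> 's"

definition cochains :: "'a::euclidean_space set set \<Rightarrow> nat \<Rightarrow> ('a, 's::ab_group_add) cochain set"
  where "cochains X p = {r.
    (\<forall>\<delta> ori. oriented_cell X p \<delta> ori \<longrightarrow> r \<delta> (- ori) = - r \<delta> ori) \<and>
    (\<forall>\<delta> ori. \<not> oriented_cell X p \<delta> ori \<longrightarrow> r \<delta> ori = 0)}"

text \<open>
  For the boundary orientation only the side of the facet \<open>\<tau>\<close> to which the normal points matters,
  so any vector \<open>y - z\<close> with \<open>y\<close> in \<open>\<tau>\<close> and \<open>z\<close> in the rest of \<open>\<mu>\<close> serves as outward normal.
\<close>

definition outward :: "'a::real_vector set \<Rightarrow> 'a set \<Rightarrow> 'a \<Rightarrow> bool"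
  where "outward \<mu> \<tau> n \<longleftrightarrow> (\<exists>y\<in>\<tau>. \<exists>z\<in>\<mu> - \<tau>. n = y - z)"

definition boundary_orientation ::
    "'a::real_vector set \<Rightarrow> 'a set \<Rightarrow> ('a list \<Rightarrow> real) \<Rightarrow> 'a list \<Rightarrow> real"
  where "boundary_orientation \<mu> \<tau> ori =
    (\<lambda>b. if ordered_basis (dirspace \<tau>) b then ori ((SOME n. outward \<mu> \<tau> n) # b) else 0)"

definition coboundary ::
    "'a::euclidean_space set set \<Rightarrow> nat \<Rightarrow> ('a, 's::ab_group_add) cochain \<Rightarrow> ('a, 's) cochain"
  where "coboundary X p r = (\<lambda>\<mu> ori.
    if oriented_cell X (p + 1) \<mu> ori
    then \<Sum>\<tau> | \<tau> facet_of \<mu>. r \<tau> (boundary_orientation \<mu> \<tau> ori)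
    else 0)"

text \<open>
  The \<open>0\<close>-cochain that takes the value \<open>a x \<in> V = \<Lambda>\<^sup>1 V\<close> on the positively oriented vertex \<open>x\<close>.
\<close>

definition vertex_cochain ::
    "'a::euclidean_space set set \<Rightarrow> ('a \<Rightarrow> 'a) \<Rightarrow> ('a, 'a ext) cochain"
  where "vertex_cochain X a = (\<lambda>\<delta> ori.
    if oriented_cell X 0 \<delta> ori then ori [] *\<^sub>R ext_incl (a (the_elem \<delta>)) else 0)"

text \<open>The set \<open>\<R>\<^sup>p(X, S)\<close> for \<open>S = \<Lambda>\<^sup>* V\<close>.\<close>

definition R_cocycles :: "'a::euclidean_space set set \<Rightarrow> nat \<Rightarrow> ('a, 'a ext) cochain set"
  where "R_cocycles X p = {r \<in> cochains X p.
    coboundary X p r = (\<lambda>\<delta> ori. 0) \<and>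
    (\<forall>\<delta> ori. oriented_cell X p \<delta> ori \<longrightarrow> r \<delta> ori \<in> ext_power p (dirspace \<delta>))}"

section \<open>The product of cochains\<close>

definition cup_pairs :: "nat \<Rightarrow> nat \<Rightarrow> 'a::euclidean_space set \<Rightarrow> ('a \<Rightarrow> real) \<Rightarrow> ('a set \<times> 'a set) set"
  where "cup_pairs p q \<gamma> v = {(\<delta>, \<tau>).
    \<delta> face_of \<gamma> \<and> aff_dim \<delta> = int p \<and> \<tau> face_of \<gamma> \<and> aff_dim \<tau> = int q \<and>
    (+) (restrict_functional (dirspace \<gamma>) v) ` dual_cone \<gamma> \<delta> \<inter> dual_cone \<gamma> \<tau> \<noteq> {}}"

text \<open>\<open>W = U \<oplus> U'\<close> as oriented spaces.\<close>

definition oriented_direct_sum ::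
    "'a::real_vector set \<Rightarrow> ('a list \<Rightarrow> real) \<Rightarrow> 'a set \<Rightarrow> ('a list \<Rightarrow> real) \<Rightarrow>
     'a set \<Rightarrow> ('a list \<Rightarrow> real) \<Rightarrow> bool"
  where "oriented_direct_sum W ori U ori\<^sub>1 U' ori\<^sub>2 \<longleftrightarrow>
    orientation W ori \<and> orientation U ori\<^sub>1 \<and> orientation U' ori\<^sub>2 \<and>
    (\<forall>b b'. ordered_basis U b \<and> ordered_basis U' b' \<longrightarrow>
      ordered_basis W (b @ b') \<and> ori (b @ b') = ori\<^sub>1 b * ori\<^sub>2 b')"

text \<open>
  The orientations of \<open>\<delta>\<close> and \<open>\<tau>\<close> are determined up to reversing both,
  which does not affect the summand.
\<close>

definition cup ::
    "'a::euclidean_space set set \<Rightarrow> ('a \<Rightarrow> real) \<Rightarrow> nat \<Rightarrow> nat \<Rightarrow>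
     ('a, 's::ring) cochain \<Rightarrow> ('a, 's) cochain \<Rightarrow> ('a, 's) cochain"
  where "cup X v p q r s = (\<lambda>\<gamma> ori.
    if oriented_cell X (p + q) \<gamma> ori
    then \<Sum>(\<delta>, \<tau>)\<in>cup_pairs p q \<gamma> v.
      (case (SOME (ori\<^sub>1, ori\<^sub>2).
          oriented_direct_sum (dirspace \<gamma>) ori (dirspace \<delta>) ori\<^sub>1 (dirspace \<tau>) ori\<^sub>2) of
        (ori\<^sub>1, ori\<^sub>2) \<Rightarrow> r \<delta> ori\<^sub>1 * s \<tau> ori\<^sub>2)
    else 0)"

text \<open>
  The left-bracketed product of the \<open>1\<close>-cochains \<open>r 1, \<dots>, r p\<close> for \<open>p \<ge> 1\<close>;
  the value for \<open>p = 0\<close> is a dummy.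
\<close>

fun iterated_cup ::
    "'a::euclidean_space set set \<Rightarrow> ('a \<Rightarrow> real) \<Rightarrow> (nat \<Rightarrow> ('a, 's::ring) cochain) \<Rightarrow> nat \<Rightarrow>
     ('a, 's) cochain"
  where
    "iterated_cup X v r 0 = (\<lambda>\<delta> ori. 0)"
  | "iterated_cup X v r (Suc 0) = r 1"
  | "iterated_cup X v r (Suc (Suc n)) =
      cup X v (Suc n) 1 (iterated_cup X v r (Suc n)) (r (Suc (Suc n)))"

end

theory Submission
  imports Defs
begin

text \<open>
  On a cell \<open>\<gamma>\<close> of dimension \<open>p\<close> the product takes its value in the line \<open>\<Lambda>\<^sup>p V\<^sub>\<gamma>\<close>, so it is a number
  times the unit multivector of the oriented cell. Up to a factor that number is the mixed volume of
  the virtual polytopes that the cochains \<open>a\<^sub>i\<close> define on \<open>\<gamma>\<close>, and the idea is to write it as a sum over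
  the vertices \<open>x\<close> of \<open>\<gamma>\<close> of a \<^emph>\<open>symmetric\<close> multilinear form in \<open>a\<^sub>1(x), \<dots>, a\<^sub>p(x)\<close>. Such a form
  factors through the symmetric power, so that the sum only depends on the products
  \<open>a\<^sub>1(x) \<cdots> a\<^sub>p(x)\<close>.

  To define the form, choose an inner product on \<open>V\<close>. In a flag \<open>{x} = \<gamma>\<^sub>0 \<subset> \<gamma>\<^sub>1 \<subset> \<dots> \<subset> \<gamma>\<^sub>p = \<gamma>\<close>, where
  every face is a facet of the next one, let \<open>u\<^sub>i \<in> V\<^bsub>\<gamma>\<^sub>i\<^esub>\<close> be the outer unit normal of \<open>\<gamma>\<^bsub>i-1\<^esub>\<close> in
  \<open>\<gamma>\<^sub>i\<close>. The form \<open>flag_form \<gamma> x\<close> is the sum of \<open>\<langle>w\<^sub>1, u\<^sub>1\<rangle> \<cdots> \<langle>w\<^sub>p, u\<^sub>p\<rangle>\<close> over all flags that start at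
  \<open>x\<close>. It is symmetric for each single \<open>x\<close>: between \<open>\<gamma>\<^bsub>i-1\<^esub>\<close> and \<open>\<gamma>\<^bsub>i+1\<^esub>\<close> there are exactly two faces
  \<open>\<gamma>\<^sub>i\<close>, and the two orthonormal pairs \<open>(u\<^bsub>i+1\<^esub>, u\<^sub>i)\<close> that they give are bases of the same plane with
  opposite orientations, so that their contributions to the antisymmetric part in two neighbouring
  arguments cancel (\<open>flag_pair_sum_symmetric\<close>, \<open>flag_form_swap\<close>).

  The product is computed by induction on the number of factors (\<open>cup_coboundary\<close>). Multiplying by
  \<open>da\<close> pairs each facet \<open>\<delta>\<close> of \<open>\<gamma>\<close> with the edges whose dual cone is met by the ray that starts at
  \<open>v\<close> in the direction of the outer normal \<open>u\<close> of \<open>\<delta>\<close>. A point moving along this ray selects the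
  vertices of \<open>\<gamma>\<close> at which it is maximal. As \<open>v\<close> is convenient, the selected face is always a vertex
  or an edge that is not orthogonal to \<open>u\<close> (\<open>transversal_maximizers\<close>), so the ray traces an edge path
  from the vertex that is maximal for \<open>v\<close> on \<open>\<gamma>\<close> to the one that is maximal for \<open>v\<close> on \<open>\<delta>\<close>. Hence
  the sum of \<open>da\<close> over the edges telescopes (\<open>sum_ray_edges\<close>) to the difference of \<open>a\<close> at these two
  vertices. The first vertex is the same for all \<open>\<delta>\<close>, and its contribution vanishes by the relation of
  Minkowski (\<open>minkowski_relation\<close>): by symmetry of the flag form the constant argument can be moved to
  the place of \<open>u\<^sub>1\<close>, where the two ends of each edge \<open>\<gamma>\<^sub>1\<close> cancel. In the contribution of the second
  vertex, \<open>\<langle>a(x), u\<rangle>\<close> is the same for all vertices \<open>x\<close> of \<open>\<delta>\<close>, because \<open>da\<close> is parallel to the edges and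
  the same edge paths connect the vertices of each cell (\<open>edge_constant_imp_vertex_constant\<close>). What
  remains is the expansion of the flag sum along the facets of \<open>\<gamma>\<close>.
\<close>

section \<open>Direction spaces and facet normals\<close>

lemma subspace_dirspace [simp]: "subspace (dirspace S)"
  by (simp add: dirspace_def)

lemma diff_in_dirspace: "x \<in> S \<Longrightarrow> y \<in> S \<Longrightarrow> x - y \<in> dirspace S"
  unfolding dirspace_def by (rule span_base) blast

lemma dirspace_subset:
  assumes "\<And>x y. x \<in> S \<Longrightarrow> y \<in> S \<Longrightarrow> x - y \<in> W" "subspace W"
  shows "dirspace S \<subseteq> W"
  unfolding dirspace_def by (rule span_minimal) (use assms in auto)

lemma dirspace_mono: "S \<subseteq> T \<Longrightarrow> dirspace S \<subseteq> dirspace T"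
  by (rule dirspace_subset) (auto intro: diff_in_dirspace)

lemma dirspace_eq_span_diffs:
  assumes "x \<in> S" shows "dirspace S = span ((\<lambda>y. y - x) ` S)"
proof
  show "dirspace S \<subseteq> span ((\<lambda>y. y - x) ` S)"
  proof (rule dirspace_subset)
    fix a b assume "a \<in> S" "b \<in> S"
    then have "(a - x) - (b - x) \<in> span ((\<lambda>y. y - x) ` S)"
      by (intro span_diff span_base) auto
    then show "a - b \<in> span ((\<lambda>y. y - x) ` S)" by simp
  qed simp
  show "span ((\<lambda>y. y - x) ` S) \<subseteq> dirspace S"
    by (rule span_minimal) (use assms in \<open>auto intro: diff_in_dirspace\<close>)
qed

lemma aff_dim_eq_dim_dirspace:
  fixes S :: "'a::euclidean_space set"
  assumes "S \<noteq> {}" shows "aff_dim S = int (dim (dirspace S))"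
proof -
  obtain x where x: "x \<in> S" using assms by blast
  then have "x \<in> affine hull S" by (simp add: hull_inc)
  then show ?thesis
    using aff_dim_eq_dim_subtract[of x S] dirspace_eq_span_diffs[OF x] by simp
qed

lemma orthogonal_dirspace:
  fixes S :: "'a::euclidean_space set"
  assumes "\<And>x y. x \<in> S \<Longrightarrow> y \<in> S \<Longrightarrow> inner u (x - y) = 0" and "w \<in> dirspace S"
  shows "inner u w = 0"
proof -
  have "dirspace S \<subseteq> {w. inner u w = 0}"
    by (rule dirspace_subset) (use assms(1) in \<open>auto simp: subspace_hyperplane\<close>)
  then show ?thesis using assms(2) by auto
qed

text \<open>
  The inequality and the equality case characterise \<open>\<delta>\<close> as the face of \<open>\<gamma>\<close> on which \<open>u\<close> is maximal,
  without a base point for \<open>\<gamma>\<close>.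
\<close>

definition is_facet_normal :: "'a::euclidean_space set \<Rightarrow> 'a set \<Rightarrow> 'a \<Rightarrow> bool"
  where "is_facet_normal \<gamma> \<delta> u \<longleftrightarrow>
    u \<in> dirspace \<gamma> \<and> norm u = 1 \<and>
    (\<forall>x\<in>\<delta>. \<forall>y\<in>\<gamma>. inner u (y - x) \<le> 0 \<and> (inner u (y - x) = 0 \<longrightarrow> y \<in> \<delta>))"

definition facet_normal :: "'a::euclidean_space set \<Rightarrow> 'a set \<Rightarrow> 'a"
  where "facet_normal \<gamma> \<delta> = (SOME u. is_facet_normal \<gamma> \<delta> u)"

text \<open>
  A facet is exposed by some linear functional; projecting its gradient to \<open>dirspace \<gamma>\<close> does not
  change the functional on differences of points of \<open>\<gamma>\<close>.
\<close>

lemma facet_normal_exists: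
  fixes \<gamma> :: "'a::euclidean_space set"
  assumes "polyhedron \<gamma>" "\<delta> facet_of \<gamma>"
  shows "\<exists>u. is_facet_normal \<gamma> \<delta> u"
proof -
  have "\<delta> exposed_face_of \<gamma>" "\<delta> \<noteq> {}" "\<delta> \<noteq> \<gamma>"
    using assms exposed_face_of_polyhedron facet_of_def by (auto simp: facet_of_imp_face_of)
  then obtain a b where ab: "\<gamma> \<subseteq> {x. inner a x \<le> b}" "\<delta> = \<gamma> \<inter> {x. inner a x = b}"
    unfolding exposed_face_of_def by auto
  obtain u z where u: "u \<in> span (dirspace \<gamma>)" "\<And>w. w \<in> span (dirspace \<gamma>) \<Longrightarrow> inner z w = 0" "a = u + z"
    using orthogonal_subspace_decomp_exists[of "dirspace \<gamma>" a]
    unfolding Linear_Algebra.orthogonal_def by blast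
  have u1: "u \<in> dirspace \<gamma>"
    using u(1) subspace_dirspace[of \<gamma>] by (metis span_eq_iff)
  have ua: "inner u w = inner a w" if "w \<in> dirspace \<gamma>" for w
    using u(2)[OF span_base[OF that]] u(3) by (simp add: inner_add_left)
  have face: "inner u (y - x) \<le> 0 \<and> (inner u (y - x) = 0 \<longrightarrow> y \<in> \<delta>)" if "x \<in> \<delta>" "y \<in> \<gamma>" for x y
    using ua[of "y - x"] diff_in_dirspace[of y \<gamma> x] that ab by (auto simp: inner_diff_right)
  have "u \<noteq> 0"
  proof
    assume "u = 0"
    then have "\<gamma> \<subseteq> \<delta>" using face \<open>\<delta> \<noteq> {}\<close> by fastforce
    then show False using \<open>\<delta> \<noteq> \<gamma>\<close> ab(2) by blast
  qed
  then have "is_facet_normal \<gamma> \<delta> (u /\<^sub>R norm u)"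
    unfolding is_facet_normal_def using face u1
    by (auto simp: subspace_scale mult_nonneg_nonpos)
  then show ?thesis by blast
qed

lemma is_facet_normal_facet_normal:
  "polyhedron \<gamma> \<Longrightarrow> \<delta> facet_of \<gamma> \<Longrightarrow> is_facet_normal \<gamma> \<delta> (facet_normal \<gamma> \<delta>)"
  unfolding facet_normal_def by (rule someI_ex) (rule facet_normal_exists)

lemma facet_normal_orthogonal:
  assumes "is_facet_normal \<gamma> \<delta> u" "\<delta> \<subseteq> \<gamma>" "w \<in> dirspace \<delta>"
  shows "inner u w = 0"
proof (rule orthogonal_dirspace[OF _ assms(3)])
  fix x y assume "x \<in> \<delta>" "y \<in> \<delta>"
  then have "inner u (x - y) \<le> 0" "inner u (y - x) \<le> 0"
    using assms(1,2) unfolding is_facet_normal_def by blast+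
  then show "inner u (x - y) = 0" by (simp add: inner_diff_right)
qed

text \<open>
  By a count of dimensions, \<open>dirspace \<delta>\<close> and \<open>u\<close> together span \<open>dirspace \<gamma>\<close>.
\<close>

lemma facet_normal_decomp:
  fixes \<gamma> :: "'a::euclidean_space set"
  assumes u: "is_facet_normal \<gamma> \<delta> u" and d: "\<delta> facet_of \<gamma>" and w: "w \<in> dirspace \<gamma>"
  shows "w - inner u w *\<^sub>R u \<in> dirspace \<delta>"
proof -
  have sub: "\<delta> \<subseteq> \<gamma>" and ne: "\<delta> \<noteq> {}" "\<gamma> \<noteq> {}" and ad: "aff_dim \<delta> = aff_dim \<gamma> - 1"
    using d facet_of_imp_subset[OF d] unfolding facet_of_def by auto
  have uu: "inner u u = 1" and uV: "u \<in> dirspace \<gamma>"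
    using u by (auto simp: is_facet_normal_def dot_square_norm)
  have orth: "inner u w = 0" if "w \<in> dirspace \<delta>" for w
    using facet_normal_orthogonal[OF u sub that] .
  then have "u \<notin> span (dirspace \<delta>)" using uu by (metis span_eq_iff subspace_dirspace zero_neq_one)
  then have "dim (insert u (dirspace \<delta>)) = dim (dirspace \<delta>) + 1"
    by (simp add: dim_insert)
  also have "\<dots> = dim (dirspace \<gamma>)"
    using ad ne by (simp add: aff_dim_eq_dim_dirspace)
  finally have "span (insert u (dirspace \<delta>)) = dirspace \<gamma>"
    using uV dirspace_mono[OF sub]
    by (metis dim_span dim_subset insert_subset order_refl span_minimal subspace_dim_equal subspace_dirspace subspace_span)
  then obtain k where k: "w - k *\<^sub>R u \<in> dirspace \<delta>"
    using w by (metis span_breakdown_eq span_eq_iff subspace_dirspace)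
  then have "inner u (w - k *\<^sub>R u) = 0" by (rule orth)
  then show ?thesis using k uu by (simp add: inner_diff_right)
qed

text \<open>
  The component of one normal orthogonal to the other lies in \<open>dirspace \<delta>\<close>, to which both are
  orthogonal, so the two are proportional; a point of \<open>\<gamma>\<close> off \<open>\<delta>\<close> excludes opposite signs.
\<close>

lemma facet_normal_unique:
  fixes \<gamma> :: "'a::euclidean_space set"
  assumes u: "is_facet_normal \<gamma> \<delta> u" and u': "is_facet_normal \<gamma> \<delta> u'" and d: "\<delta> facet_of \<gamma>"
  shows "u = u'"
proof -
  have sub: "\<delta> \<subseteq> \<gamma>" and "\<delta> \<noteq> {}" and "\<delta> \<noteq> \<gamma>"
    using d facet_of_imp_subset[OF d] by (auto simp: facet_of_def)
  then obtain x y where xy: "x \<in> \<delta>" "y \<in> \<gamma>" "y \<notin> \<delta>" by blast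
  let ?w = "u' - inner u u' *\<^sub>R u"
  have "?w \<in> dirspace \<delta>"
    by (rule facet_normal_decomp[OF u d]) (use u' in \<open>simp add: is_facet_normal_def\<close>)
  then have "inner u ?w = 0" "inner u' ?w = 0"
    by (auto intro: facet_normal_orthogonal[OF u sub] facet_normal_orthogonal[OF u' sub])
  then have "inner ?w ?w = 0" by (subst (1) inner_diff_left) simp
  then have eq: "u' = inner u u' *\<^sub>R u" by simp
  have "norm u = 1" "norm u' = 1" using u u' by (auto simp: is_facet_normal_def)
  then have "\<bar>inner u u'\<bar> = 1" using eq by (metis norm_scaleR mult.right_neutral)
  moreover have "inner u u' \<noteq> -1"
  proof
    assume "inner u u' = -1"
    then have "inner u' (y - x) = - inner u (y - x)" using eq by (metis inner_minus_left scaleR_minus1_left)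
    moreover have "inner u (y - x) < 0" "inner u' (y - x) < 0"
      using u u' xy unfolding is_facet_normal_def by (meson less_eq_real_def)+
    ultimately show False by simp
  qed
  ultimately show ?thesis using eq by (simp add: abs_if split: if_splits)
qed

lemma facet_normal_eqI:
  fixes \<gamma> :: "'a::euclidean_space set"
  assumes "\<delta> facet_of \<gamma>" "is_facet_normal \<gamma> \<delta> u"
  shows "facet_normal \<gamma> \<delta> = u"
  unfolding facet_normal_def
  by (rule some_equality) (use assms facet_normal_unique in blast)+

section \<open>The flag form of a polyhedron\<close>

lemma facet_facet_aff_dim:
  assumes "\<epsilon> facet_of \<delta>" "\<delta> facet_of \<gamma>"
  shows "aff_dim \<epsilon> = aff_dim \<gamma> - 2" "\<epsilon> face_of \<gamma>" "\<epsilon> \<noteq> {}"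
  using assms face_of_trans by (auto simp: facet_of_def)

lemma face_of_same_aff_dim:
  fixes A :: "'a::euclidean_space set"
  assumes "convex B" "A face_of B" "aff_dim A = aff_dim B"
  shows "A = B"
  using face_of_aff_dim_lt[OF assms(1,2)] assms(3) by fastforce

text \<open>
  The intersection is a proper face of \<open>\<delta>\<^sub>1\<close>, so its dimension is at most that of the facet \<open>\<epsilon>\<close>
  contained in it.
\<close>

lemma facet_of_facet_intersection:
  fixes \<gamma> :: "'a::euclidean_space set"
  assumes "polyhedron \<gamma>" "\<delta>\<^sub>1 facet_of \<gamma>" "\<epsilon> facet_of \<delta>\<^sub>1" "\<delta>\<^sub>2 facet_of \<gamma>" "\<epsilon> \<subseteq> \<delta>\<^sub>2" "\<delta>\<^sub>1 \<noteq> \<delta>\<^sub>2"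
  shows "\<epsilon> = \<delta>\<^sub>1 \<inter> \<delta>\<^sub>2"
proof -
  have cv: "convex \<gamma>" using assms(1) polyhedron_imp_convex by blast
  have f: "\<delta>\<^sub>1 face_of \<gamma>" "\<delta>\<^sub>2 face_of \<gamma>" "\<epsilon> face_of \<delta>\<^sub>1" "\<epsilon> face_of \<gamma>"
    using facet_facet_aff_dim(2)[OF assms(3,2)] assms(2-4) by (simp_all add: facet_of_def)
  have c1: "convex \<delta>\<^sub>1" "convex \<delta>\<^sub>2" using f face_of_imp_convex by auto
  have i: "(\<delta>\<^sub>1 \<inter> \<delta>\<^sub>2) face_of \<gamma>" using f face_of_Int by blast
  have i1: "(\<delta>\<^sub>1 \<inter> \<delta>\<^sub>2) face_of \<delta>\<^sub>1" "(\<delta>\<^sub>1 \<inter> \<delta>\<^sub>2) face_of \<delta>\<^sub>2"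
    using i f by (meson face_of_imp_subset face_of_subset inf_le1 inf_le2)+
  have "\<delta>\<^sub>1 \<inter> \<delta>\<^sub>2 \<noteq> \<delta>\<^sub>1"
  proof
    assume "\<delta>\<^sub>1 \<inter> \<delta>\<^sub>2 = \<delta>\<^sub>1"
    then have "\<delta>\<^sub>1 face_of \<delta>\<^sub>2" using i1 by simp
    then have "\<delta>\<^sub>1 = \<delta>\<^sub>2"
      using c1 face_of_same_aff_dim[of \<delta>\<^sub>2 \<delta>\<^sub>1] assms(2,4) by (simp add: facet_of_def)
    with assms(6) show False ..
  qed
  then have lt: "aff_dim (\<delta>\<^sub>1 \<inter> \<delta>\<^sub>2) < aff_dim \<delta>\<^sub>1"
    using face_of_aff_dim_lt[OF c1(1) i1(1)] by blast
  have sub: "\<epsilon> \<subseteq> \<delta>\<^sub>1 \<inter> \<delta>\<^sub>2" using f(3) assms(5) face_of_imp_subset by blast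
  then have e: "\<epsilon> face_of (\<delta>\<^sub>1 \<inter> \<delta>\<^sub>2)"
    using face_of_subset[OF f(4) sub] face_of_imp_subset[OF i] by blast
  have "aff_dim \<epsilon> = aff_dim \<delta>\<^sub>1 - 1" using assms(3) by (simp add: facet_of_def)
  then have "aff_dim \<epsilon> = aff_dim (\<delta>\<^sub>1 \<inter> \<delta>\<^sub>2)"
    using lt aff_dim_subset[OF sub] by linarith
  then show ?thesis
    using face_of_same_aff_dim[OF _ e] i face_of_imp_convex by blast
qed

text \<open>
  A proper face of a polyhedron is the intersection of the facets containing it, so a face of
  codimension 2 lies in more than one facet.
\<close>

lemma facet_of_facet_other:
  fixes \<gamma> :: "'a::euclidean_space set"
  assumes g: "polyhedron \<gamma>" and d1: "\<delta>\<^sub>1 facet_of \<gamma>" and e: "\<epsilon> facet_of \<delta>\<^sub>1"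
  obtains \<delta>\<^sub>2 where "\<delta>\<^sub>2 facet_of \<gamma>" "\<epsilon> facet_of \<delta>\<^sub>2" "\<delta>\<^sub>2 \<noteq> \<delta>\<^sub>1"
proof -
  note ad = facet_facet_aff_dim[OF e d1]
  have ne: "\<epsilon> \<noteq> \<gamma>" using ad(1) by auto
  have eq: "\<epsilon> = \<Inter> {F. F facet_of \<gamma> \<and> \<epsilon> \<subseteq> F}"
    by (rule face_of_polyhedron[OF g ad(2,3) ne])
  have "\<exists>F. F facet_of \<gamma> \<and> \<epsilon> \<subseteq> F \<and> F \<noteq> \<delta>\<^sub>1"
  proof (rule ccontr)
    assume "\<nexists>F. F facet_of \<gamma> \<and> \<epsilon> \<subseteq> F \<and> F \<noteq> \<delta>\<^sub>1"
    moreover have "\<epsilon> \<subseteq> \<delta>\<^sub>1" using e facet_of_imp_subset by blast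
    ultimately have "{F. F facet_of \<gamma> \<and> \<epsilon> \<subseteq> F} = {\<delta>\<^sub>1}" using d1 by blast
    then have "\<epsilon> = \<delta>\<^sub>1" using eq by simp
    then show False using e by simp
  qed
  then obtain F where F: "F facet_of \<gamma>" "\<epsilon> \<subseteq> F" "F \<noteq> \<delta>\<^sub>1" by blast
  have "\<epsilon> face_of F"
    using face_of_subset[OF ad(2) F(2)] F(1) facet_of_imp_subset by blast
  then have "\<epsilon> facet_of F" using ad F(1) by (simp add: facet_of_def)
  then show ?thesis using that F by blast
qed

text \<open>
  The normal of \<open>\<epsilon>\<close> in \<open>\<delta>\<^sub>1\<close> is the normalised component of \<open>n\<^sub>2\<close> orthogonal to \<open>n\<^sub>1\<close>, because on
  \<open>\<delta>\<^sub>1\<close> the functional \<open>n\<^sub>1\<close> is constant and \<open>n\<^sub>2\<close> is maximal exactly on \<open>\<delta>\<^sub>1 \<inter> \<delta>\<^sub>2 = \<epsilon>\<close>. The strict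
  inequality makes the normalising factor positive.
\<close>

lemma facet_of_facet_normal:
  fixes \<gamma> :: "'a::euclidean_space set"
  assumes g: "polyhedron \<gamma>" and d1: "\<delta>\<^sub>1 facet_of \<gamma>" and d2: "\<delta>\<^sub>2 facet_of \<gamma>"
    and e1: "\<epsilon> facet_of \<delta>\<^sub>1" and e2: "\<epsilon> facet_of \<delta>\<^sub>2" and ne: "\<delta>\<^sub>1 \<noteq> \<delta>\<^sub>2"
  defines "n\<^sub>1 \<equiv> facet_normal \<gamma> \<delta>\<^sub>1" and "n\<^sub>2 \<equiv> facet_normal \<gamma> \<delta>\<^sub>2"
  shows "\<bar>inner n\<^sub>1 n\<^sub>2\<bar> < 1"
    and "facet_normal \<delta>\<^sub>1 \<epsilon> = (n\<^sub>2 - inner n\<^sub>1 n\<^sub>2 *\<^sub>R n\<^sub>1) /\<^sub>R sqrt (1 - (inner n\<^sub>1 n\<^sub>2)\<^sup>2)"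
proof -
  have N1: "is_facet_normal \<gamma> \<delta>\<^sub>1 n\<^sub>1" and N2: "is_facet_normal \<gamma> \<delta>\<^sub>2 n\<^sub>2"
    using is_facet_normal_facet_normal g d1 d2 by (auto simp: n\<^sub>1_def n\<^sub>2_def)
  have u: "inner n\<^sub>1 n\<^sub>1 = 1" "inner n\<^sub>2 n\<^sub>2 = 1" "norm n\<^sub>1 = 1" "norm n\<^sub>2 = 1"
    using N1 N2 by (auto simp: is_facet_normal_def dot_square_norm)
  have sub: "\<delta>\<^sub>1 \<subseteq> \<gamma>" "\<delta>\<^sub>2 \<subseteq> \<gamma>" "\<epsilon> \<subseteq> \<delta>\<^sub>1" "\<epsilon> \<subseteq> \<delta>\<^sub>2" using d1 d2 e1 e2 facet_of_imp_subset by blast+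
  have int: "\<epsilon> = \<delta>\<^sub>1 \<inter> \<delta>\<^sub>2"
    by (rule facet_of_facet_intersection[OF g d1 e1 d2 sub(4) ne])
  obtain x where x: "x \<in> \<epsilon>" using e1 unfolding facet_of_def by blast
  have le1: "inner n\<^sub>1 (y - z) \<le> 0" and eq1: "inner n\<^sub>1 (y - z) = 0 \<Longrightarrow> y \<in> \<delta>\<^sub>1"
    if "y \<in> \<gamma>" "z \<in> \<delta>\<^sub>1" for y z using N1 that unfolding is_facet_normal_def by blast+
  have le2: "inner n\<^sub>2 (y - z) \<le> 0" and eq2: "inner n\<^sub>2 (y - z) = 0 \<Longrightarrow> y \<in> \<delta>\<^sub>2"
    if "y \<in> \<gamma>" "z \<in> \<delta>\<^sub>2" for y z using N2 that unfolding is_facet_normal_def by blast+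
  have "\<bar>inner n\<^sub>1 n\<^sub>2\<bar> \<le> 1" using Cauchy_Schwarz_ineq2[of n\<^sub>1 n\<^sub>2] u by simp
  moreover have "inner n\<^sub>1 n\<^sub>2 \<noteq> 1"
  proof
    assume "inner n\<^sub>1 n\<^sub>2 = 1"
    then have "inner (n\<^sub>1 - n\<^sub>2) (n\<^sub>1 - n\<^sub>2) = 0"
      using u by (simp add: inner_diff_left inner_diff_right inner_commute)
    then have eq: "n\<^sub>1 = n\<^sub>2" by simp
    have "y \<in> \<delta>\<^sub>1 \<longleftrightarrow> y \<in> \<delta>\<^sub>2" for y
    proof
      assume y: "y \<in> \<delta>\<^sub>1"
      have "inner n\<^sub>1 (y - x) = 0"
        using facet_normal_orthogonal[OF N1 sub(1)] diff_in_dirspace[of y \<delta>\<^sub>1 x] x y sub by blast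
      then show "y \<in> \<delta>\<^sub>2" using eq2[of y x] eq x y sub by auto
    next
      assume y: "y \<in> \<delta>\<^sub>2"
      have "inner n\<^sub>2 (y - x) = 0"
        using facet_normal_orthogonal[OF N2 sub(2)] diff_in_dirspace[of y \<delta>\<^sub>2 x] x y sub by blast
      then show "y \<in> \<delta>\<^sub>1" using eq1[of y x] eq x y sub by auto
    qed
    then show False using ne by blast
  qed
  moreover have "inner n\<^sub>1 n\<^sub>2 \<noteq> -1"
  proof
    assume "inner n\<^sub>1 n\<^sub>2 = -1"
    then have "inner (n\<^sub>1 + n\<^sub>2) (n\<^sub>1 + n\<^sub>2) = 0"
      using u by (simp add: inner_add_left inner_add_right inner_commute)
    then have eq: "n\<^sub>2 = - n\<^sub>1" by (simp add: eq_neg_iff_add_eq_0 add.commute)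
    have "y \<in> \<delta>\<^sub>1" if y: "y \<in> \<gamma>" for y
    proof -
      have "inner n\<^sub>1 (y - x) = 0"
        using le1[OF y, of x] le2[OF y, of x] x sub eq by (simp add: subset_iff)
      then show ?thesis using eq1[of y x] x y sub by auto
    qed
    then have "\<delta>\<^sub>1 = \<gamma>" using sub by blast
    then show False using d1 by simp
  qed
  ultimately show lt: "\<bar>inner n\<^sub>1 n\<^sub>2\<bar> < 1" by linarith
  define c where "c = inner n\<^sub>1 n\<^sub>2"
  define s where "s = sqrt (1 - c\<^sup>2)"
  have "c\<^sup>2 < 1" using lt by (simp add: c_def abs_square_less_1)
  then have s: "s > 0" "s\<^sup>2 = 1 - c\<^sup>2" by (auto simp: s_def)
  define m where "m = n\<^sub>2 - c *\<^sub>R n\<^sub>1"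
  have mm: "inner m m = s\<^sup>2"
    using u s(2) by (simp add: m_def inner_diff_left inner_diff_right c_def[symmetric] inner_commute power2_eq_square)
  have "is_facet_normal \<delta>\<^sub>1 \<epsilon> (m /\<^sub>R s)"
    unfolding is_facet_normal_def
  proof (intro conjI ballI)
    have "m \<in> dirspace \<gamma>"
      using N1 N2 by (simp add: m_def is_facet_normal_def subspace_diff subspace_scale)
    from facet_normal_decomp[OF N1 d1 this] have "m \<in> dirspace \<delta>\<^sub>1"
      using u by (simp add: m_def inner_diff_right c_def)
    then show "m /\<^sub>R s \<in> dirspace \<delta>\<^sub>1" by (simp add: subspace_scale)
    show "norm (m /\<^sub>R s) = 1" 
    proof -
      have "norm m = s" unfolding norm_eq_sqrt_inner mm using s(1) by simp
      then show ?thesis using s(1) by simp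
    qed
    fix z y assume z: "z \<in> \<epsilon>" and y: "y \<in> \<delta>\<^sub>1"
    have "inner n\<^sub>1 (y - z) = 0"
      using facet_normal_orthogonal[OF N1 sub(1)] diff_in_dirspace[of y \<delta>\<^sub>1 z] y z sub by blast
    then have m: "inner (m /\<^sub>R s) (y - z) = inner n\<^sub>2 (y - z) / s"
      by (simp add: m_def inner_diff_left field_simps)
    show "inner (m /\<^sub>R s) (y - z) \<le> 0"
      unfolding m using le2[of y z] y z sub s(1) by (simp add: subset_iff divide_le_0_iff)
    show "inner (m /\<^sub>R s) (y - z) = 0 \<longrightarrow> y \<in> \<epsilon>"
      unfolding m using eq2[of y z] y z sub s int by auto
  qed
  from facet_normal_eqI[OF e1 this]
  show "facet_normal \<delta>\<^sub>1 \<epsilon> = (n\<^sub>2 - inner n\<^sub>1 n\<^sub>2 *\<^sub>R n\<^sub>1) /\<^sub>R sqrt (1 - (inner n\<^sub>1 n\<^sub>2)\<^sup>2)"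
    by (simp add: m_def s_def c_def)
qed

text \<open>
  A third facet has normal \<open>n\<^sub>3 = \<alpha> n\<^sub>1 + \<beta> n\<^sub>2\<close>. Points of \<open>\<delta>\<^sub>1\<close> and \<open>\<delta>\<^sub>2\<close> off \<open>\<epsilon>\<close> show that \<open>\<alpha>\<close>
  and \<open>\<beta>\<close> are positive; then \<open>n\<^sub>3\<close> is negative at every point of \<open>\<delta>\<^sub>3\<close> off \<open>\<epsilon>\<close>, where it has to
  vanish.
\<close>

lemma facet_of_facet_at_most_two:
  fixes \<gamma> :: "'a::euclidean_space set"
  assumes g: "polyhedron \<gamma>" and d: "\<delta>\<^sub>1 facet_of \<gamma>" "\<delta>\<^sub>2 facet_of \<gamma>" "\<delta>\<^sub>3 facet_of \<gamma>"
    and e: "\<epsilon> facet_of \<delta>\<^sub>1" "\<epsilon> facet_of \<delta>\<^sub>2" "\<epsilon> facet_of \<delta>\<^sub>3"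
    and ne: "\<delta>\<^sub>1 \<noteq> \<delta>\<^sub>2" "\<delta>\<^sub>3 \<noteq> \<delta>\<^sub>1" "\<delta>\<^sub>3 \<noteq> \<delta>\<^sub>2"
  shows False
proof -
  define n\<^sub>1 n\<^sub>2 n\<^sub>3 where "n\<^sub>1 = facet_normal \<gamma> \<delta>\<^sub>1" and "n\<^sub>2 = facet_normal \<gamma> \<delta>\<^sub>2" and "n\<^sub>3 = facet_normal \<gamma> \<delta>\<^sub>3"
  have N: "is_facet_normal \<gamma> \<delta>\<^sub>1 n\<^sub>1" "is_facet_normal \<gamma> \<delta>\<^sub>2 n\<^sub>2" "is_facet_normal \<gamma> \<delta>\<^sub>3 n\<^sub>3"
    using is_facet_normal_facet_normal g d by (auto simp: n\<^sub>1_def n\<^sub>2_def n\<^sub>3_def)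
  have sub: "\<delta>\<^sub>1 \<subseteq> \<gamma>" "\<delta>\<^sub>2 \<subseteq> \<gamma>" "\<delta>\<^sub>3 \<subseteq> \<gamma>" "\<epsilon> \<subseteq> \<delta>\<^sub>1" "\<epsilon> \<subseteq> \<delta>\<^sub>2" "\<epsilon> \<subseteq> \<delta>\<^sub>3"
    using d e facet_of_imp_subset by blast+
  have int: "\<epsilon> = \<delta>\<^sub>1 \<inter> \<delta>\<^sub>2" "\<epsilon> = \<delta>\<^sub>1 \<inter> \<delta>\<^sub>3" "\<epsilon> = \<delta>\<^sub>2 \<inter> \<delta>\<^sub>3"
    using facet_of_facet_intersection[OF g d(1) e(1) d(2) sub(5) ne(1)]
      facet_of_facet_intersection[OF g d(1) e(1) d(3) sub(6)]
      facet_of_facet_intersection[OF g d(2) e(2) d(3) sub(6)] ne by auto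
  obtain x where x: "x \<in> \<epsilon>" using e unfolding facet_of_def by blast
  have neg: "inner u (y - x) < 0"
    if "is_facet_normal \<gamma> \<delta> u" "\<delta>' facet_of \<gamma>" "\<epsilon> = \<delta> \<inter> \<delta>'" "y \<in> \<delta>'" "y \<notin> \<epsilon>" for \<delta> \<delta>' u y
    using that x facet_of_imp_subset[OF that(2)] unfolding is_facet_normal_def
    by (metis IntD1 IntI less_eq_real_def subsetD)
  have zero: "inner u (y - x) = 0"
    if "is_facet_normal \<gamma> \<delta> u" "\<delta> \<subseteq> \<gamma>" "\<epsilon> \<subseteq> \<delta>" "y \<in> \<delta>" for \<delta> u y
    using facet_normal_orthogonal[OF that(1,2)] diff_in_dirspace[of y \<delta> x] that x by blast
  obtain y\<^sub>1 y\<^sub>2 y\<^sub>3 where y: "y\<^sub>1 \<in> \<delta>\<^sub>1" "y\<^sub>1 \<notin> \<epsilon>" "y\<^sub>2 \<in> \<delta>\<^sub>2" "y\<^sub>2 \<notin> \<epsilon>" "y\<^sub>3 \<in> \<delta>\<^sub>3" "y\<^sub>3 \<notin> \<epsilon>"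
  proof -
    have "\<epsilon> \<noteq> \<delta>\<^sub>1" "\<epsilon> \<noteq> \<delta>\<^sub>2" "\<epsilon> \<noteq> \<delta>\<^sub>3" using e by auto
    then show ?thesis using sub that by (meson subsetI subset_antisym)
  qed
  \<comment> \<open>modulo \<open>dirspace \<epsilon>\<close>, the space \<open>dirspace \<gamma>\<close> is the plane spanned by \<open>n\<^sub>1\<close> and \<open>n\<^sub>2\<close>\<close>
  obtain \<alpha> \<beta> where ab: "n\<^sub>3 = \<alpha> *\<^sub>R n\<^sub>1 + \<beta> *\<^sub>R n\<^sub>2"
  proof -
    define m where "m = facet_normal \<delta>\<^sub>1 \<epsilon>"
    have pd1: "polyhedron \<delta>\<^sub>1" using g d(1) face_of_polyhedron_polyhedron facet_of_imp_face_of by blast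
    have M: "is_facet_normal \<delta>\<^sub>1 \<epsilon> m"
      unfolding m_def by (rule is_facet_normal_facet_normal[OF pd1 e(1)])
    define s where "s = 1 / sqrt (1 - (inner n\<^sub>1 n\<^sub>2)\<^sup>2)"
    have m: "m = s *\<^sub>R (n\<^sub>2 - inner n\<^sub>1 n\<^sub>2 *\<^sub>R n\<^sub>1)"
      using facet_of_facet_normal(2)[OF g d(1,2) e(1,2) ne(1)]
      by (simp add: m_def s_def n\<^sub>1_def n\<^sub>2_def divide_inverse)
    define w where "w = n\<^sub>3 - inner n\<^sub>1 n\<^sub>3 *\<^sub>R n\<^sub>1"
    define z where "z = w - inner m w *\<^sub>R m"
    have "w \<in> dirspace \<delta>\<^sub>1" unfolding w_def
      by (rule facet_normal_decomp[OF N(1) d(1)]) (use N(3) in \<open>simp add: is_facet_normal_def\<close>)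
    then have z: "z \<in> dirspace \<epsilon>" unfolding z_def by (rule facet_normal_decomp[OF M e(1)])
    have "inner n\<^sub>3 z = 0" "inner n\<^sub>1 z = 0"
      using facet_normal_orthogonal[OF N(3) sub(3)] facet_normal_orthogonal[OF N(1) sub(1)]
        z dirspace_mono sub by blast+
    moreover have "inner m z = 0" using facet_normal_orthogonal[OF M sub(4) z] .
    ultimately have "inner z z = 0"
      by (subst (1) z_def) (simp add: w_def inner_diff_left)
    then have "n\<^sub>3 = inner n\<^sub>1 n\<^sub>3 *\<^sub>R n\<^sub>1 + inner m w *\<^sub>R m" by (simp add: z_def w_def)
    also have "\<dots> = (inner n\<^sub>1 n\<^sub>3 - inner m w * s * inner n\<^sub>1 n\<^sub>2) *\<^sub>R n\<^sub>1 + (inner m w * s) *\<^sub>R n\<^sub>2"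
      unfolding m by (simp add: algebra_simps)
    finally show ?thesis by (rule that)
  qed
  have i3: "inner n\<^sub>3 w = \<alpha> * inner n\<^sub>1 w + \<beta> * inner n\<^sub>2 w" for w
    unfolding ab by (simp add: inner_add_left)
  have "\<beta> * inner n\<^sub>2 (y\<^sub>1 - x) < 0" "inner n\<^sub>2 (y\<^sub>1 - x) < 0"
    using i3[of "y\<^sub>1 - x"] neg[OF N(3) d(1), of y\<^sub>1] neg[OF N(2) d(1), of y\<^sub>1]
      zero[OF N(1) sub(1,4), of y\<^sub>1] y int by (auto simp: Int_commute)
  then have b: "\<beta> > 0" by (simp add: mult_less_0_iff)
  have "\<alpha> * inner n\<^sub>1 (y\<^sub>2 - x) < 0" "inner n\<^sub>1 (y\<^sub>2 - x) < 0"
    using i3[of "y\<^sub>2 - x"] neg[OF N(3) d(2), of y\<^sub>2] neg[OF N(1) d(2), of y\<^sub>2]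
      zero[OF N(2) sub(2,5), of y\<^sub>2] y int by (auto simp: Int_commute)
  then have a: "\<alpha> > 0" by (simp add: mult_less_0_iff)
  have "inner n\<^sub>1 (y\<^sub>3 - x) < 0" "inner n\<^sub>2 (y\<^sub>3 - x) < 0" "inner n\<^sub>3 (y\<^sub>3 - x) = 0"
    using neg[OF N(1) d(3), of y\<^sub>3] neg[OF N(2) d(3), of y\<^sub>3] zero[OF N(3) sub(3,6), of y\<^sub>3] y int
    by auto
  moreover from this(1,2) have "\<alpha> * inner n\<^sub>1 (y\<^sub>3 - x) < 0" "\<beta> * inner n\<^sub>2 (y\<^sub>3 - x) < 0"
    using a b by (simp_all add: mult_pos_neg)
  ultimately show False using i3[of "y\<^sub>3 - x"] by linarith
qed

text \<open>
  The sums are empty or have exactly two summands. In the latter case, with \<open>m\<^sub>1, m\<^sub>2\<close> the normals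
  of \<open>\<epsilon>\<close> in \<open>\<delta>\<^sub>1, \<delta>\<^sub>2\<close> the formula above gives \<open>n\<^sub>1 \<and> m\<^sub>1 = s n\<^sub>1 \<and> n\<^sub>2\<close> and
  \<open>n\<^sub>2 \<and> m\<^sub>2 = s n\<^sub>2 \<and> n\<^sub>1\<close> with the same factor \<open>s\<close>, so that the antisymmetric part of the sum in
  \<open>w\<^sub>1, w\<^sub>2\<close> vanishes.
\<close>

lemma flag_pair_sum_symmetric:
  fixes \<gamma> :: "'a::euclidean_space set"
  assumes g: "polyhedron \<gamma>"
  shows "(\<Sum>\<delta> | \<delta> facet_of \<gamma> \<and> \<epsilon> facet_of \<delta>. inner w\<^sub>1 (facet_normal \<gamma> \<delta>) * inner w\<^sub>2 (facet_normal \<delta> \<epsilon>)) =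
    (\<Sum>\<delta> | \<delta> facet_of \<gamma> \<and> \<epsilon> facet_of \<delta>. inner w\<^sub>2 (facet_normal \<gamma> \<delta>) * inner w\<^sub>1 (facet_normal \<delta> \<epsilon>))"
proof (cases "\<exists>\<delta>. \<delta> facet_of \<gamma> \<and> \<epsilon> facet_of \<delta>")
  case False
  then have "{\<delta>. \<delta> facet_of \<gamma> \<and> \<epsilon> facet_of \<delta>} = {}" by blast
  then show ?thesis by (simp only: sum.empty)
next
  case True
  then obtain \<delta>\<^sub>1 where d1: "\<delta>\<^sub>1 facet_of \<gamma>" "\<epsilon> facet_of \<delta>\<^sub>1" by blast
  obtain \<delta>\<^sub>2 where d2: "\<delta>\<^sub>2 facet_of \<gamma>" "\<epsilon> facet_of \<delta>\<^sub>2" "\<delta>\<^sub>2 \<noteq> \<delta>\<^sub>1"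
    using facet_of_facet_other[OF g d1] .
  have set: "{\<delta>. \<delta> facet_of \<gamma> \<and> \<epsilon> facet_of \<delta>} = {\<delta>\<^sub>1, \<delta>\<^sub>2}"
    using facet_of_facet_at_most_two[OF g d1(1) d2(1) _ d1(2) d2(2)] d1 d2 by auto
  define n\<^sub>1 n\<^sub>2 where n: "n\<^sub>1 = facet_normal \<gamma> \<delta>\<^sub>1" "n\<^sub>2 = facet_normal \<gamma> \<delta>\<^sub>2"
  define s where "s = inverse (sqrt (1 - (inner n\<^sub>1 n\<^sub>2)\<^sup>2))"
  have m1: "facet_normal \<delta>\<^sub>1 \<epsilon> = s *\<^sub>R (n\<^sub>2 - inner n\<^sub>1 n\<^sub>2 *\<^sub>R n\<^sub>1)"
    using facet_of_facet_normal(2)[OF g d1(1) d2(1) d1(2) d2(2)] d2(3) by (simp add: n s_def)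
  have m2: "facet_normal \<delta>\<^sub>2 \<epsilon> = s *\<^sub>R (n\<^sub>1 - inner n\<^sub>1 n\<^sub>2 *\<^sub>R n\<^sub>2)"
    using facet_of_facet_normal(2)[OF g d2(1) d1(1) d2(2) d1(2)] d2(3) by (simp add: n s_def inner_commute)
  show ?thesis
    unfolding set using d2(3)
    by (simp add: m1 m2 n[symmetric] inner_diff_right) (simp add: algebra_simps)
qed

text \<open>
  The arguments are listed from the top of the flag downwards: the first one is paired with the
  normal of the largest proper face.
\<close>

fun flag_form :: "'a::euclidean_space set \<Rightarrow> 'a \<Rightarrow> 'a list \<Rightarrow> real" where
  "flag_form \<gamma> x [] = 1"
| "flag_form \<gamma> x (w # ws) =
    (\<Sum>\<delta> | \<delta> facet_of \<gamma> \<and> x \<in> \<delta>. inner w (facet_normal \<gamma> \<delta>) * flag_form \<delta> x ws)"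

lemma flag_form_add:
  "flag_form \<gamma> x (us @ (w + w') # ws) = flag_form \<gamma> x (us @ w # ws) + flag_form \<gamma> x (us @ w' # ws)"
  by (induction us arbitrary: \<gamma>) (simp_all add: inner_add_left algebra_simps sum.distrib)

lemma flag_form_scaleR:
  "flag_form \<gamma> x (us @ (c *\<^sub>R w) # ws) = c * flag_form \<gamma> x (us @ w # ws)"
  by (induction us arbitrary: \<gamma>) (simp_all add: sum_distrib_left algebra_simps)

text \<open>
  Summation over the pairs \<open>\<epsilon> \<subset> \<delta>\<close> is rearranged so that \<open>\<delta>\<close> runs over the facets between \<open>\<epsilon>\<close> and
  \<open>\<gamma>\<close>.
\<close>

lemma flag_form_swap_Cons:
  fixes \<gamma> :: "'a::euclidean_space set"
  assumes g: "polyhedron \<gamma>"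
  shows "flag_form \<gamma> x (w\<^sub>1 # w\<^sub>2 # ws) = flag_form \<gamma> x (w\<^sub>2 # w\<^sub>1 # ws)"
proof -
  let ?A = "{\<delta>. \<delta> facet_of \<gamma> \<and> x \<in> \<delta>}" and ?B = "{\<epsilon>. \<epsilon> face_of \<gamma> \<and> x \<in> \<epsilon>}"
  have fin: "finite ?A" "finite ?B"
    using finite_polyhedron_faces[OF g]
    by (auto intro: rev_finite_subset simp: facet_of_def)
  have eq: "flag_form \<gamma> x (a # b # ws) =
      (\<Sum>\<epsilon>\<in>?B. (\<Sum>\<delta> | \<delta> facet_of \<gamma> \<and> \<epsilon> facet_of \<delta>.
        inner a (facet_normal \<gamma> \<delta>) * inner b (facet_normal \<delta> \<epsilon>)) * flag_form \<epsilon> x ws)" for a b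
  proof -
    have "flag_form \<gamma> x (a # b # ws) =
      (\<Sum>\<delta>\<in>?A. \<Sum>\<epsilon> | \<epsilon> \<in> ?B \<and> \<epsilon> facet_of \<delta>.
        inner a (facet_normal \<gamma> \<delta>) * inner b (facet_normal \<delta> \<epsilon>) * flag_form \<epsilon> x ws)"
      unfolding flag_form.simps sum_distrib_left
      by (intro sum.cong) (auto simp: mult.assoc dest: facet_facet_aff_dim(2))
    also have "\<dots> = (\<Sum>\<epsilon>\<in>?B. \<Sum>\<delta> | \<delta> \<in> ?A \<and> \<epsilon> facet_of \<delta>.
        inner a (facet_normal \<gamma> \<delta>) * inner b (facet_normal \<delta> \<epsilon>) * flag_form \<epsilon> x ws)"
      by (rule sum.swap_restrict[OF fin])
    also have "\<dots> = (\<Sum>\<epsilon>\<in>?B. \<Sum>\<delta> | \<delta> facet_of \<gamma> \<and> \<epsilon> facet_of \<delta>.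
        inner a (facet_normal \<gamma> \<delta>) * inner b (facet_normal \<delta> \<epsilon>) * flag_form \<epsilon> x ws)"
      by (intro sum.cong) (auto dest: facet_of_imp_subset)
    finally show ?thesis by (simp add: sum_distrib_right)
  qed
  show ?thesis
    unfolding eq using flag_pair_sum_symmetric[OF g, where w\<^sub>1=w\<^sub>1 and w\<^sub>2=w\<^sub>2] by simp
qed

lemma flag_form_swap:
  fixes \<gamma> :: "'a::euclidean_space set"
  assumes "polyhedron \<gamma>"
  shows "flag_form \<gamma> x (us @ w\<^sub>1 # w\<^sub>2 # ws) = flag_form \<gamma> x (us @ w\<^sub>2 # w\<^sub>1 # ws)"
  using assms
proof (induction us arbitrary: \<gamma>)
  case Nil
  show ?case using flag_form_swap_Cons[OF Nil] by simp
next
  case (Cons u us)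
  have "polyhedron \<delta>" if "\<delta> facet_of \<gamma>" for \<delta>
    using Cons.prems that face_of_polyhedron_polyhedron facet_of_imp_face_of by blast
  then show ?case using Cons.IH by simp
qed

lemma flag_form_move_to_end:
  fixes \<gamma> :: "'a::euclidean_space set"
  assumes "polyhedron \<gamma>"
  shows "flag_form \<gamma> x (us @ w # ws) = flag_form \<gamma> x (us @ ws @ [w])"
proof (induction ws arbitrary: us)
  case Nil
  then show ?case by simp
next
  case (Cons v ws)
  then show ?case
    using flag_form_swap[OF assms, of x us w v ws] Cons[of "us @ [v]"] by simp
qed

section \<open>Exterior products and determinants\<close>

lemma exterior_relation_zero:
  "r \<in> exterior_relations \<Longrightarrow> ideal_cong exterior_relations r 0"
  using two_sided_ideal.gen[of r exterior_relations 1 1] by (simp add: ideal_cong_def)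

lemma ext_incl_add: "ext_incl (x + y) = ext_incl x + ext_incl y"
proof transfer
  fix x y :: 'a
  have "ideal_cong exterior_relations (fgen (x + y) - fgen x - fgen y) 0"
    by (rule exterior_relation_zero) (auto simp: exterior_relations_def tensor_relations_def)
  then show "ideal_cong exterior_relations (fgen (x + y)) (fgen x + fgen y)"
    by (simp add: ideal_cong_def algebra_simps)
qed

lemma ext_incl_scaleR: "ext_incl (c *\<^sub>R x) = c *\<^sub>R ext_incl x"
proof transfer
  fix x :: 'a and c
  have "ideal_cong exterior_relations (fgen (c *\<^sub>R x) - fscal c * fgen x) 0"
    by (rule exterior_relation_zero) (auto simp: exterior_relations_def tensor_relations_def)
  then show "ideal_cong exterior_relations (fgen (c *\<^sub>R x)) (fscal c * fgen x)"
    by (simp add: ideal_cong_def)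
qed

lemma linear_ext_incl: "linear ext_incl"
  by (rule linearI) (simp_all add: ext_incl_add ext_incl_scaleR)

lemma ext_incl_square: "ext_incl x * ext_incl x = 0"
  by transfer (rule exterior_relation_zero, auto simp: exterior_relations_def)

lemma ext_incl_anticommute: "ext_incl x * ext_incl y = - (ext_incl y * ext_incl x)"
  using ext_incl_square[of "x + y"]
  by (simp add: ext_incl_add distrib_left distrib_right ext_incl_square eq_neg_iff_add_eq_0 add.commute)

definition wedge :: "'a::real_vector list \<Rightarrow> 'a ext"
  where "wedge ws = prod_list (map ext_incl ws)"

lemma wedge_simps [simp]:
  "wedge [] = 1" "wedge (w # ws) = ext_incl w * wedge ws" "wedge (us @ ws) = wedge us * wedge ws"
  by (simp_all add: wedge_def)

text \<open>
  The second \<open>x\<close> can be moved next to the first one by anticommutation.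
\<close>

lemma ext_incl_wedge_ext_incl: "ext_incl x * (wedge vs * ext_incl x) = 0"
proof (induction vs)
  case Nil
  then show ?case by (simp add: ext_incl_square)
next
  case (Cons v vs)
  have "ext_incl x * (wedge (v # vs) * ext_incl x) = (ext_incl x * ext_incl v) * (wedge vs * ext_incl x)"
    by (simp add: mult.assoc)
  also have "\<dots> = - (ext_incl v * (ext_incl x * (wedge vs * ext_incl x)))"
    by (subst ext_incl_anticommute) (simp add: mult.assoc)
  finally show ?case using Cons by simp
qed

lemma wedge_repeated: "wedge (us @ x # vs @ x # ws) = 0"
proof -
  have "wedge (us @ x # vs @ x # ws) = wedge us * (ext_incl x * (wedge vs * ext_incl x)) * wedge ws"
    by (simp add: mult.assoc)
  then show ?thesis by (simp add: ext_incl_wedge_ext_incl)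
qed

text \<open>
  Polarisation of \<open>wedge_repeated\<close> at \<open>x + y\<close>.
\<close>

lemma wedge_swap: "wedge (us @ y # vs @ x # ws) = - wedge (us @ x # vs @ y # ws)"
  using wedge_repeated[of us "x + y" vs ws] wedge_repeated[of us x vs ws] wedge_repeated[of us y vs ws]
  by (simp add: ext_incl_add algebra_simps eq_neg_iff_add_eq_0)

lemma upt_split2:
  assumes "a < b" "b < n"
  shows "[0..<n] = [0..<a] @ a # [Suc a..<b] @ b # [Suc b..<n]"
proof -
  have "[0..<n] = [0..<a] @ [a..<b] @ [b..<n]"
    using assms upt_add_eq_append[of 0 a "n - a"] upt_add_eq_append[of a b "n - b"] by simp
  then show ?thesis using assms by (simp add: upt_conv_Cons)
qed

lemma wedge_map_transpose:
  assumes "a < b" "b < n"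
  shows "wedge (map (e \<circ> Transposition.transpose a b) [0..<n]) = - wedge (map e [0..<n])"
proof -
  have m: "map (e \<circ> Transposition.transpose a b) xs = map e xs" if "a \<notin> set xs" "b \<notin> set xs" for xs
    using that by (auto simp: Transposition.transpose_def)
  have "map (e \<circ> Transposition.transpose a b) [0..<n] =
      map e [0..<a] @ e b # map e [Suc a..<b] @ e a # map e [Suc b..<n]"
  proof -
    have "map (e \<circ> Transposition.transpose a b) [0..<a] = map e [0..<a]"
      "map (e \<circ> Transposition.transpose a b) [Suc a..<b] = map e [Suc a..<b]"
      "map (e \<circ> Transposition.transpose a b) [Suc b..<n] = map e [Suc b..<n]"
      using assms by (auto intro!: m)
    then show ?thesis
      unfolding upt_split2[OF assms] map_append list.map by simp
  qed
  then show ?thesis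
    unfolding upt_split2[OF assms] by (simp only: map_append list.map wedge_swap[of _ "e b"])
qed

lemma wedge_map_permutes:
  assumes "p permutes {..<n}"
  shows "wedge (map (\<lambda>j. e (p j)) [0..<n]) = of_int (sign p) *\<^sub>R wedge (map e [0..<n])"
  using assms finite_lessThan[of n]
proof (induction p arbitrary: e rule: permutes_induct)
  case id
  then show ?case by (simp add: id_def)
next
  case (swap a b p)
  note pp = \<open>p permutes {..<n}\<close>
  have tr: "wedge (map (e \<circ> Transposition.transpose a b) [0..<n]) = - wedge (map e [0..<n])"
    using wedge_map_transpose[of a b n e] wedge_map_transpose[of b a n e] swap.hyps
    by (cases "a < b") (auto simp: transpose_commute)
  have "sign (Transposition.transpose a b \<circ> p) = - sign p"
  proof -
    have "permutation p" unfolding permutation_permutes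
      by (intro exI[of _ "{..<n}"] conjI finite_lessThan pp)
    then show ?thesis
      using sign_compose[OF permutation_swap_id, of p a b] swap.hyps(3)
      by (simp only: sign_swap_id if_False mult_minus1)
  qed
  with swap.IH[of "e \<circ> Transposition.transpose a b"] show ?case
    unfolding tr by (simp only: comp_def of_int_minus scaleR_minus_left scaleR_minus_right)
qed

lemma wedge_map_not_inj:
  assumes "\<not> inj_on f {..<n}"
  shows "wedge (map (\<lambda>j. e (f j)) [0..<n]) = 0"
proof -
  obtain a b where "a < b" "b < n" and eq: "f a = f b"
    using assms unfolding inj_on_def by (metis lessThan_iff linorder_neq_iff)
  then show ?thesis
    unfolding upt_split2[OF \<open>a < b\<close> \<open>b < n\<close>] map_append list.map eq by (intro wedge_repeated)
qed

lemma wedge_sums_expand: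
  fixes e :: "nat \<Rightarrow> 'a::real_vector"
  shows "wedge (map (\<lambda>j. \<Sum>i<n. c i j *\<^sub>R e i) [0..<m]) =
    (\<Sum>f\<in>{..<m} \<rightarrow>\<^sub>E {..<n}. (\<Prod>j<m. c (f j) j) *\<^sub>R wedge (map (\<lambda>j. e (f j)) [0..<m]))"
proof (induction m)
  case 0
  then show ?case by simp
next
  case (Suc m)
  have inj: "inj_on (\<lambda>(i, f). f(m := i)) ({..<n} \<times> ({..<m} \<rightarrow>\<^sub>E {..<n}))"
    using inj_combinator[of m "{..<m}" "\<lambda>_. {..<n}"] by simp
  have set: "{..<Suc m} \<rightarrow>\<^sub>E {..<n} = (\<lambda>(i, f). f(m := i)) ` ({..<n} \<times> ({..<m} \<rightarrow>\<^sub>E {..<n}))"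
    unfolding lessThan_Suc by (rule PiE_insert_eq)
  have mp: "map (\<lambda>j. e ((f(m := i)) j)) [0..<m] = map (\<lambda>j. e (f j)) [0..<m]" for f i by simp
  have pr: "(\<Prod>j<m. c ((f(m := i)) j) j) = (\<Prod>j<m. c (f j) j)" for f i
    by (rule prod.cong) auto
  have "wedge (map (\<lambda>j. \<Sum>i<n. c i j *\<^sub>R e i) [0..<Suc m]) =
      (\<Sum>f\<in>{..<m} \<rightarrow>\<^sub>E {..<n}. (\<Prod>j<m. c (f j) j) *\<^sub>R wedge (map (\<lambda>j. e (f j)) [0..<m])) *
      (\<Sum>i<n. c i m *\<^sub>R ext_incl (e i))"
    using Suc by (simp add: linear_sum[OF linear_ext_incl] ext_incl_scaleR)
  also have "\<dots> = (\<Sum>f\<in>{..<m} \<rightarrow>\<^sub>E {..<n}. \<Sum>i<n. ((\<Prod>j<m. c (f j) j) * c i m) *\<^sub>R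
      (wedge (map (\<lambda>j. e (f j)) [0..<m]) * ext_incl (e i)))"
    by (simp add: sum_product mult.commute)
  also have "\<dots> = (\<Sum>i<n. \<Sum>f\<in>{..<m} \<rightarrow>\<^sub>E {..<n}. ((\<Prod>j<m. c (f j) j) * c i m) *\<^sub>R
      (wedge (map (\<lambda>j. e (f j)) [0..<m]) * ext_incl (e i)))"
    by (rule sum.swap)
  also have "\<dots> = (\<Sum>f\<in>{..<Suc m} \<rightarrow>\<^sub>E {..<n}. (\<Prod>j<Suc m. c (f j) j) *\<^sub>R wedge (map (\<lambda>j. e (f j)) [0..<Suc m]))"
  proof -
    have "(\<Prod>j<Suc m. c ((f(m := i)) j) j) = (\<Prod>j<m. c (f j) j) * c i m" for f i
      using pr[of f i] by simp
    moreover have "wedge (map (\<lambda>j. e ((f(m := i)) j)) [0..<Suc m]) =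
        wedge (map (\<lambda>j. e (f j)) [0..<m]) * ext_incl (e i)" for f i
    proof -
      have "map (\<lambda>j. e ((f(m := i)) j)) [0..<Suc m] = map (\<lambda>j. e (f j)) [0..<m] @ [e i]"
        using mp[of f i] by simp
      then show ?thesis by (simp only: wedge_simps mult_1_right)
    qed
    ultimately show ?thesis
      unfolding set sum.reindex[OF inj] sum.cartesian_product
      by (simp only: comp_def split_def)
  qed
  finally show ?case .
qed

text \<open>
  The expansion over all index functions reduces to the injective ones, which are the permutations;
  this is the Leibniz formula of the transposed matrix.
\<close>

lemma wedge_linear_combination:
  fixes e :: "nat \<Rightarrow> 'a::real_vector"
  shows "wedge (map (\<lambda>j. \<Sum>i<n. c i j *\<^sub>R e i) [0..<n]) =
    Determinant.det (Matrix.mat n n (\<lambda>(i, j). c i j)) *\<^sub>R wedge (map e [0..<n])"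
proof -
  let ?P = "{p. p permutes {..<n}}" and ?F = "{..<n} \<rightarrow>\<^sub>E {..<n}"
  let ?g = "\<lambda>f. (\<Prod>j<n. c (f j) j) *\<^sub>R wedge (map (\<lambda>j. e (f j)) [0..<n])"
  have res: "?g (restrict p {..<n}) = ?g p" for p
    by (intro arg_cong2[where f=scaleR] prod.cong arg_cong[where f=wedge] map_cong) auto
  have inj: "inj_on (\<lambda>p. restrict p {..<n}) ?P"
  proof (rule inj_onI)
    fix p q assume "p \<in> ?P" "q \<in> ?P" "restrict p {..<n} = restrict q {..<n}"
    then show "p = q"
      by (intro ext) (metis mem_Collect_eq permutes_not_in restrict_apply')
  qed
  have "(\<Sum>f\<in>?F. ?g f) = (\<Sum>f\<in>(\<lambda>p. restrict p {..<n}) ` ?P. ?g f)"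
  proof (rule sum.mono_neutral_right)
    show "finite ?F" by (simp add: finite_PiE)
    show "(\<lambda>p. restrict p {..<n}) ` ?P \<subseteq> ?F"
    proof (rule image_subsetI)
      fix p assume "p \<in> ?P"
      then have "p j < n" if "j < n" for j using permutes_in_image[of p "{..<n}" j] that by simp
      then show "restrict p {..<n} \<in> ?F" by (intro restrict_PiE_iff[THEN iffD2]) auto
    qed
    show "\<forall>f\<in>?F - (\<lambda>p. restrict p {..<n}) ` ?P. ?g f = 0"
    proof
      fix f assume f: "f \<in> ?F - (\<lambda>p. restrict p {..<n}) ` ?P"
      have "\<not> inj_on f {..<n}"
      proof
        assume i: "inj_on f {..<n}"
        define p where "p = (\<lambda>x. if x \<in> {..<n} then f x else x)"
        have "inj_on p {..<n}" using i by (simp add: inj_on_def p_def)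
        moreover have "p ` {..<n} \<subseteq> {..<n}" using f by (auto simp: p_def)
        ultimately have "bij_betw p {..<n} {..<n}"
          by (simp add: bij_betw_def endo_inj_surj)
        then have "p permutes {..<n}" by (rule bij_imp_permutes) (simp add: p_def)
        moreover have "f = restrict p {..<n}"
          using f by (auto simp: p_def restrict_def fun_eq_iff PiE_def extensional_def)
        ultimately show False using f by blast
      qed
      then show "?g f = 0" by (simp add: wedge_map_not_inj)
    qed
  qed
  also have "\<dots> = (\<Sum>p\<in>?P. ?g p)" unfolding sum.reindex[OF inj] by (simp only: comp_def res)
  also have "\<dots> = (\<Sum>p\<in>?P. (of_int (sign p) * (\<Prod>j<n. c (p j) j)) *\<^sub>R wedge (map e [0..<n]))"
    by (intro sum.cong) (auto simp: wedge_map_permutes mult.commute)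
  also have "\<dots> = Determinant.det (Matrix.mat n n (\<lambda>(j, i). c i j)) *\<^sub>R wedge (map e [0..<n])"
    
  proof -
    have "p j < n" if "p permutes {..<n}" "j < n" for p j
      using permutes_in_image[OF that(1), of j] that(2) by simp
    then show ?thesis
      by (subst det_def'[of _ n]) (auto simp: scaleR_left.sum atLeast0LessThan intro!: sum.cong prod.cong)
  qed
  also have "Matrix.mat n n (\<lambda>(j, i). c i j) = transpose_mat (Matrix.mat n n (\<lambda>(i, j). c i j))"
    by (rule eq_matI) auto
  also have "Determinant.det \<dots> = Determinant.det (Matrix.mat n n (\<lambda>(i, j). c i j))"
    by (rule det_transpose[of _ n]) simp
  finally show ?thesis unfolding wedge_sums_expand .
qed

section \<open>Orientations\<close>

lemma ordered_basisD:
  assumes "ordered_basis W b"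
  shows "distinct b" "independent (set b)" "span (set b) = W" "subspace W" "set b \<subseteq> W"
  using assms span_superset by (auto simp: ordered_basis_def)

lemma length_ordered_basis: "ordered_basis W b \<Longrightarrow> length b = dim W"
  unfolding ordered_basis_def by (metis distinct_card dim_span dim_eq_card_independent)

abbreviation basis_coeff :: "'a::real_vector list \<Rightarrow> 'a \<Rightarrow> nat \<Rightarrow> real"
  where "basis_coeff b w i \<equiv> representation (set b) w (b ! i)"

lemma sum_basis_coeff:
  assumes b: "ordered_basis W b" and w: "w \<in> W"
  shows "(\<Sum>i<length b. basis_coeff b w i *\<^sub>R b ! i) = w"
proof -
  note b = ordered_basisD[OF b]
  have "(\<Sum>i<length b. basis_coeff b w i *\<^sub>R b ! i) = (\<Sum>x\<in>set b. representation (set b) w x *\<^sub>R x)"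
    by (rule sum.reindex_bij_betw[OF bij_betw_nth[OF b(1)]]) auto
  also have "\<dots> = w"
    by (rule real_vector.sum_representation_eq) (use b w in auto)
  finally show ?thesis .
qed

text \<open>
  This relates the determinants that define orientations to products in the exterior algebra.
\<close>

lemma wedge_basis_change:
  assumes b: "ordered_basis W b" and "set b' \<subseteq> W" "length b' = length b"
  shows "wedge b' = basis_change_det b b' *\<^sub>R wedge b"
proof -
  have "b' = map (\<lambda>j. \<Sum>i<length b. basis_coeff b (b' ! j) i *\<^sub>R b ! i) [0..<length b]"
    using assms by (intro nth_equalityI) (auto simp: sum_basis_coeff subset_iff)
  then have "wedge b' = wedge (map (\<lambda>j. \<Sum>i<length b. basis_coeff b (b' ! j) i *\<^sub>R b ! i) [0..<length b])"
    by simp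
  also have "\<dots> = basis_change_det b b' *\<^sub>R wedge (map ((!) b) [0..<length b])"
    unfolding basis_change_det_def assms(3) by (rule wedge_linear_combination)
  finally show ?thesis by (simp add: map_nth)
qed

lemma basis_change_det_trans:
  assumes b: "ordered_basis W b" and b': "ordered_basis W b'" and b'': "ordered_basis W b''"
  shows "basis_change_det b b'' = basis_change_det b b' * basis_change_det b' b''"
proof -
  define n where "n = dim W"
  have l: "length b = n" "length b' = n" "length b'' = n"
    using assms by (simp_all add: length_ordered_basis n_def)
  let ?M = "\<lambda>b b'. Matrix.mat n n (\<lambda>(i, j). basis_coeff b (b' ! j) i)"
  have "?M b b'' = ?M b b' * ?M b' b''"
  proof (rule eq_matI)
    fix i j assume "i < dim_row (?M b b' * ?M b' b'')" "j < dim_col (?M b b' * ?M b' b'')"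
    then have ij: "i < n" "j < n" by auto
    then have W: "b'' ! j \<in> W" using ordered_basisD(5)[OF b''] l by (auto simp: subset_iff)
    have W': "b' ! k \<in> span (set b)" if "k < n" for k
      using ordered_basisD(5)[OF b'] ordered_basisD(3)[OF b] that l by (auto simp: subset_iff)
    have "basis_coeff b (b'' ! j) i = representation (set b) (\<Sum>k<n. basis_coeff b' (b'' ! j) k *\<^sub>R b' ! k) (b ! i)"
      using sum_basis_coeff[OF b' W] l by simp
    also have "\<dots> = (\<Sum>k<n. basis_coeff b' (b'' ! j) k * basis_coeff b (b' ! k) i)"
      using ordered_basisD[OF b] W'
      by (subst real_vector.representation_sum) (auto simp: span_scale real_vector.representation_scale)
    finally show "?M b b'' $$ (i, j) = (?M b b' * ?M b' b'') $$ (i, j)"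
      using ij by (simp add: scalar_prod_def mult.commute atLeast0LessThan)
  qed auto
  then show ?thesis
    using det_mult[of "?M b b'" n "?M b' b''"] by (simp add: basis_change_det_def l)
qed

lemma basis_coeff_nth:
  assumes "ordered_basis W b" "i < length b" "j < length b"
  shows "basis_coeff b (b ! j) i = (if i = j then 1 else 0)"
  using assms ordered_basisD[OF assms(1)]
  by (auto simp: real_vector.representation_basis nth_eq_iff_index_eq)

lemma basis_change_det_self:
  assumes "ordered_basis W b"
  shows "basis_change_det b b = 1"
proof -
  have "Matrix.mat (length b) (length b) (\<lambda>(i, j). basis_coeff b (b ! j) i) = 1\<^sub>m (length b)"
    by (rule eq_matI) (use basis_coeff_nth[OF assms] in auto)
  then show ?thesis by (simp add: basis_change_det_def)
qed

lemma basis_change_det_nonzero: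
  assumes "ordered_basis W b" "ordered_basis W b'"
  shows "basis_change_det b b' \<noteq> 0"
  using basis_change_det_trans[OF assms(1,2,1)] basis_change_det_self[OF assms(1)] by auto

lemma orientation_from_basis:
  assumes b0: "ordered_basis W b\<^sub>0" and s: "s \<in> {1, -1 :: real}"
  shows "orientation W (\<lambda>b. if ordered_basis W b then s * sgn (basis_change_det b\<^sub>0 b) else 0)"
  unfolding orientation_def
proof (intro conjI allI impI)
  fix b assume b: "ordered_basis W b"
  show "(if ordered_basis W b then s * sgn (basis_change_det b\<^sub>0 b) else 0) \<in> {1, -1}"
    using s b basis_change_det_nonzero[OF b0 b] by (auto simp: sgn_real_def)
next
  fix b b' assume "ordered_basis W b \<and> ordered_basis W b'"
  then show "(if ordered_basis W b' then s * sgn (basis_change_det b\<^sub>0 b') else 0) =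
      sgn (basis_change_det b b') * (if ordered_basis W b then s * sgn (basis_change_det b\<^sub>0 b) else 0)"
    using basis_change_det_trans[OF b0, of b b'] by (simp add: sgn_mult)
qed simp

lemma ordered_basis_snoc:
  fixes b :: "'a::euclidean_space list"
  assumes b: "ordered_basis U b" and W: "subspace W" "U \<subseteq> W" "c \<in> W" "c \<notin> U" "dim W = Suc (dim U)"
  shows "ordered_basis W (b @ [c])"
proof -
  note b' = ordered_basisD[OF b]
  have "c \<notin> set b" using b' W by auto
  moreover have ind: "independent (insert c (set b))" using b' W by (simp add: independent_insertI)
  moreover have "span (insert c (set b)) = W"
  proof (rule subspace_dim_equal)
    show "span (insert c (set b)) \<subseteq> W" using b' W by (intro span_minimal) auto
    have "dim (insert c (set b)) = Suc (card (set b))"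
      using dim_eq_card_independent[OF ind] \<open>c \<notin> set b\<close> by simp
    then show "dim (span (insert c (set b))) \<ge> dim W"
      using W(5) length_ordered_basis[OF b] b'(1) by (simp add: distinct_card)
  qed (use W in auto)
  ultimately show ?thesis using b' by (simp add: ordered_basis_def)
qed

text \<open>
  The matrix is block triangular, because the vectors of \<open>b\<close> have no component along \<open>c\<^sub>0\<close>.
\<close>

lemma basis_change_det_snoc:
  assumes b0: "ordered_basis U b\<^sub>0" and b: "ordered_basis U b" and W: "ordered_basis W (b\<^sub>0 @ [c\<^sub>0])"
  shows "basis_change_det (b\<^sub>0 @ [c\<^sub>0]) (b @ [c]) =
    basis_change_det b\<^sub>0 b * representation (set (b\<^sub>0 @ [c\<^sub>0])) c c\<^sub>0"
proof -
  define n where "n = dim U"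
  have l: "length b\<^sub>0 = n" "length b = n"
    using assms by (simp_all add: length_ordered_basis n_def)
  let ?B = "b\<^sub>0 @ [c\<^sub>0]"
  let ?A1 = "Matrix.mat n n (\<lambda>(i, j). basis_coeff b\<^sub>0 (b ! j) i)"
  let ?A2 = "Matrix.mat n 1 (\<lambda>(i, j). basis_coeff ?B c i)"
  let ?A4 = "Matrix.mat 1 1 (\<lambda>(i, j). representation (set ?B) c c\<^sub>0)"
  have ext: "representation (set ?B) (b ! j) = representation (set b\<^sub>0) (b ! j)" if "j < n" for j
    using ordered_basisD[OF W] ordered_basisD[OF b0] ordered_basisD[OF b] that l
    by (intro real_vector.representation_extend) (auto simp: subset_iff)
  have zero: "representation (set b\<^sub>0) w c\<^sub>0 = 0" for w
    using ordered_basisD(1)[OF W] real_vector.representation_ne_zero[of "set b\<^sub>0" w c\<^sub>0] by auto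
  have "Matrix.mat (n + 1) (n + 1) (\<lambda>(i, j). basis_coeff ?B ((b @ [c]) ! j) i) =
      four_block_mat ?A1 ?A2 (0\<^sub>m 1 n) ?A4"
    by (rule eq_matI) (auto simp: nth_append l ext[simplified] zero less_Suc_eq)
  then have "basis_change_det ?B (b @ [c]) = Determinant.det (four_block_mat ?A1 ?A2 (0\<^sub>m 1 n) ?A4)"
    by (simp add: basis_change_det_def l)
  also have "\<dots> = Determinant.det ?A1 * Determinant.det ?A4"
    by (rule det_four_block_mat_lower_left_zero) auto
  also have "Determinant.det ?A4 = representation (set ?B) c c\<^sub>0"
    by (subst det_single) auto
  finally show ?thesis by (simp add: basis_change_det_def l)
qed

text \<open>
  The product of cochains chooses such a pair of orientations, and the choice is only meaningful if
  a pair exists. One fixes the signs of one basis of each summand; the determinant of a change of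
  bases of \<open>U\<close> and of \<open>U'\<close> is the product of the two determinants.
\<close>

lemma oriented_direct_sum_line_exists:
  fixes W :: "'a::euclidean_space set"
  assumes ori: "orientation W ori" and b0: "ordered_basis U b\<^sub>0" and c0: "ordered_basis U' [c\<^sub>0]"
    and W: "ordered_basis W (b\<^sub>0 @ [c\<^sub>0])"
  shows "\<exists>ori\<^sub>1 ori\<^sub>2. oriented_direct_sum W ori U ori\<^sub>1 U' ori\<^sub>2"
proof -
  let ?s = "ori (b\<^sub>0 @ [c\<^sub>0])"
  let ?o1 = "\<lambda>b. if ordered_basis U b then 1 * sgn (basis_change_det b\<^sub>0 b) else 0"
  let ?o2 = "\<lambda>b. if ordered_basis U' b then ?s * sgn (basis_change_det [c\<^sub>0] b) else 0"
  have s: "?s \<in> {1, -1}" using ori W unfolding orientation_def by blast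
  have o12: "orientation U ?o1" "orientation U' ?o2"
    by (rule orientation_from_basis[OF b0], simp, rule orientation_from_basis[OF c0 s])
  have dims: "dim U' = 1" "dim W = Suc (dim U)"
    using length_ordered_basis[OF c0] length_ordered_basis[OF b0] length_ordered_basis[OF W] by auto
  have c0': "c\<^sub>0 \<notin> U" "c\<^sub>0 \<noteq> 0"
  proof -
    show "c\<^sub>0 \<noteq> 0" using ordered_basisD(2)[OF c0] dependent_zero by auto
    have "c\<^sub>0 \<notin> set b\<^sub>0" "independent (insert c\<^sub>0 (set b\<^sub>0))" using ordered_basisD[OF W] by auto
    then have "c\<^sub>0 \<notin> span (set b\<^sub>0)" by (simp add: independent_insert split: if_splits)
    then show "c\<^sub>0 \<notin> U" using ordered_basisD[OF b0] by simp
  qed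
  have sub: "U \<subseteq> W" "U' \<subseteq> W"
  proof -
    have "span (set b\<^sub>0) \<subseteq> span (set (b\<^sub>0 @ [c\<^sub>0]))" "span (set [c\<^sub>0]) \<subseteq> span (set (b\<^sub>0 @ [c\<^sub>0]))"
      by (auto intro!: span_mono)
    then show "U \<subseteq> W" "U' \<subseteq> W"
      using ordered_basisD(3)[OF b0] ordered_basisD(3)[OF c0] ordered_basisD(3)[OF W] by auto
  qed
  have "ordered_basis W (b @ b') \<and> ori (b @ b') = ?o1 b * ?o2 b'"
    if b: "ordered_basis U b" and b': "ordered_basis U' b'" for b b'
  proof -
    have "length b' = 1" using length_ordered_basis[OF b'] dims by simp
    then obtain c where c: "b' = [c]" by (auto simp: length_Suc_conv)
    have cU': "c \<in> U'" "c \<noteq> 0"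
      using ordered_basisD[OF b'] dependent_zero by (auto simp: c)
    then obtain k where k: "c = k *\<^sub>R c\<^sub>0"
      using ordered_basisD(3)[OF c0] by (auto simp: span_singleton)
    have "c \<notin> U"
    proof
      assume "c \<in> U"
      then have "inverse k *\<^sub>R c \<in> U" using ordered_basisD(4)[OF b0] by (simp add: subspace_scale)
      then show False using k cU' c0' by simp
    qed
    then have ob: "ordered_basis W (b @ [c])"
      using sub cU' dims ordered_basisD(4)[OF W] by (intro ordered_basis_snoc[OF b]) auto
    have rep: "representation (set (b\<^sub>0 @ [c\<^sub>0])) c = representation (set [c\<^sub>0]) c"
      using ordered_basisD[OF W] ordered_basisD[OF c0] cU'
      by (intro real_vector.representation_extend) auto
    have one: "basis_change_det [c\<^sub>0] [c] = representation (set [c\<^sub>0]) c c\<^sub>0"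
      unfolding basis_change_det_def by (subst det_single) auto
    have "ori (b @ [c]) = sgn (basis_change_det (b\<^sub>0 @ [c\<^sub>0]) (b @ [c])) * ?s"
      using ori W ob unfolding orientation_def by blast
    also have "\<dots> = sgn (basis_change_det b\<^sub>0 b) * sgn (basis_change_det [c\<^sub>0] [c]) * ?s"
      unfolding basis_change_det_snoc[OF b0 b W] rep one by (simp add: sgn_mult)
    finally show ?thesis using ob b b' by (simp add: c)
  qed
  then have "oriented_direct_sum W ori U ?o1 U' ?o2"
    unfolding oriented_direct_sum_def using ori o12 by blast
  then show ?thesis by blast
qed

subsection \<open>Orthonormal bases and the unit multivector\<close>

definition orthonormal_basis :: "'a::euclidean_space set \<Rightarrow> 'a list \<Rightarrow> bool"
  where "orthonormal_basis W b \<longleftrightarrow> ordered_basis W b \<and>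
    (\<forall>i<length b. \<forall>j<length b. inner (b ! i) (b ! j) = (if i = j then 1 else 0))"

lemma orthonormal_basis_exists:
  fixes W :: "'a::euclidean_space set"
  assumes "subspace W"
  shows "\<exists>b. orthonormal_basis W b"
proof -
  obtain B where B: "B \<subseteq> W" "pairwise Linear_Algebra.orthogonal B" "\<And>x. x \<in> B \<Longrightarrow> norm x = 1"
      "independent B" "card B = dim W" "span B = W"
    using orthonormal_basis_subspace[OF assms] by metis
  obtain b where b: "set b = B" "distinct b"
    using finite_distinct_list independent_imp_finite[OF B(4)] by blast
  have "inner (b ! i) (b ! j) = (if i = j then 1 else 0)" if "i < length b" "j < length b" for i j
  proof (cases "i = j")
    case True
    then show ?thesis using B(3)[of "b ! i"] b(1) that nth_mem[of i b] by (simp add: dot_square_norm)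
  next
    case False
    then have "b ! i \<noteq> b ! j" using b that by (simp add: nth_eq_iff_index_eq)
    then show ?thesis using B(2) b that False
      by (auto simp: pairwise_def Linear_Algebra.orthogonal_def)
  qed
  then show ?thesis using B b by (auto simp: orthonormal_basis_def ordered_basis_def)
qed

lemma orthonormal_basis_coeff:
  assumes b: "orthonormal_basis W b" and w: "w \<in> W" and i: "i < length b"
  shows "basis_coeff b w i = inner (b ! i) w"
proof -
  have "inner (b ! i) w = inner (b ! i) (\<Sum>k<length b. basis_coeff b w k *\<^sub>R b ! k)"
    using sum_basis_coeff[of W b w] b w by (simp add: orthonormal_basis_def)
  also have "\<dots> = (\<Sum>k<length b. basis_coeff b w k * (if i = k then 1 else 0))"
    using b i by (simp add: orthonormal_basis_def inner_sum_right)
  also have "\<dots> = basis_coeff b w i" using i by (simp add: if_distrib cong: if_cong)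
  finally show ?thesis ..
qed

text \<open>
  The inverse of the matrix is its transpose.
\<close>

lemma orthonormal_basis_change_det:
  assumes b: "orthonormal_basis W b" and b': "orthonormal_basis W b'"
  shows "\<bar>basis_change_det b b'\<bar> = 1"
proof -
  have ob: "ordered_basis W b" "ordered_basis W b'" using assms by (auto simp: orthonormal_basis_def)
  define n where "n = dim W"
  have l: "length b = n" "length b' = n" using ob by (simp_all add: length_ordered_basis n_def)
  have mem: "b ! i \<in> W" "b' ! i \<in> W" if "i < n" for i
    using ordered_basisD(5)[OF ob(1)] ordered_basisD(5)[OF ob(2)] that l by (auto simp: subset_iff)
  let ?M = "Matrix.mat n n (\<lambda>(i, j). basis_coeff b (b' ! j) i)"
  let ?M' = "Matrix.mat n n (\<lambda>(i, j). basis_coeff b' (b ! j) i)"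
  have "?M' = transpose_mat ?M"
    by (rule eq_matI)
      (auto simp: orthonormal_basis_coeff[OF b] orthonormal_basis_coeff[OF b'] l mem inner_commute)
  then have "basis_change_det b' b = basis_change_det b b'"
    using det_transpose[of ?M n] by (simp add: basis_change_det_def l)
  then have "basis_change_det b b' * basis_change_det b b' = 1"
    using basis_change_det_trans[OF ob(1,2,1)] basis_change_det_self[OF ob(1)] by simp
  then show ?thesis by (simp add: abs_square_eq_1[symmetric] power2_eq_square)
qed

text \<open>
  A change of basis multiplies the sign by the sign of the determinant and the multivector by the
  determinant itself, which is \<open>1\<close> or \<open>-1\<close>.
\<close>

lemma oriented_unit_multivector_unique:
  assumes ori: "orientation W ori" and b: "orthonormal_basis W b" and b': "orthonormal_basis W b'"
  shows "ori b' *\<^sub>R wedge b' = ori b *\<^sub>R wedge b"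
proof -
  have ob: "ordered_basis W b" "ordered_basis W b'" using b b' by (auto simp: orthonormal_basis_def)
  have "wedge b' = basis_change_det b b' *\<^sub>R wedge b"
    using ob ordered_basisD(5)[OF ob(2)] by (intro wedge_basis_change) (auto simp: length_ordered_basis)
  moreover have "ori b' = sgn (basis_change_det b b') * ori b"
    using ori ob unfolding orientation_def by blast
  moreover have "sgn (basis_change_det b b') * basis_change_det b b' = 1"
    using orthonormal_basis_change_det[OF b b'] by (metis abs_sgn mult.commute)
  ultimately have "ori b' * basis_change_det b b' = ori b" by (metis mult.assoc mult.commute mult_1)
  then show ?thesis unfolding \<open>wedge b' = _\<close> by simp
qed

section \<open>Functionals on the tensor algebra and its quotients\<close>

text \<open>
  The linear extension of \<open>N\<close> from words to the free algebra.
\<close>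

definition word_functional :: "('a list \<Rightarrow> real) \<Rightarrow> ('a list \<Rightarrow>\<^sub>0 real) \<Rightarrow> real"
  where "word_functional N f = (\<Sum>ws\<in>Poly_Mapping.keys f. Poly_Mapping.lookup f ws * N ws)"

lemma word_functional_superset:
  assumes "finite A" "Poly_Mapping.keys f \<subseteq> A"
  shows "word_functional N f = (\<Sum>ws\<in>A. Poly_Mapping.lookup f ws * N ws)"
  unfolding word_functional_def
  by (rule sum.mono_neutral_left) (use assms in \<open>auto simp: in_keys_iff\<close>)

lemma word_functional_add: "word_functional N (f + g) = word_functional N f + word_functional N g"
proof -
  let ?A = "Poly_Mapping.keys f \<union> Poly_Mapping.keys g"
  have "word_functional N h = (\<Sum>ws\<in>?A. Poly_Mapping.lookup h ws * N ws)" if "h \<in> {f, g, f + g}" for h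
    using that by (intro word_functional_superset) (auto simp: in_keys_iff lookup_add)
  then show ?thesis by (simp add: lookup_add algebra_simps sum.distrib)
qed

lemma word_functional_single: "word_functional N (Poly_Mapping.single ws c) = c * N ws"
  by (simp add: word_functional_superset[of "{ws}"])

lemma word_functional_0 [simp]: "word_functional N 0 = 0"
  by (simp add: word_functional_def)

lemma word_functional_diff: "word_functional N (f - g) = word_functional N f - word_functional N g"
  using word_functional_add[of N "f - g" g] by simp

text \<open>
  As the ideal is spanned by the products \<open>u * r * w\<close> with words \<open>u, w\<close> and relations \<open>r\<close>, it
  suffices to test these.
\<close>

lemma word_functional_ideal:
  assumes R: "\<And>r u c w d. r \<in> R \<Longrightarrow>
      word_functional N (Poly_Mapping.single u c * r * Poly_Mapping.single w d) = 0"
    and "f \<in> two_sided_ideal R"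
  shows "word_functional N f = 0"
  using assms(2)
proof induction
  case zero
  then show ?case by simp
next
  case (gen r a b)
  have "word_functional N (Poly_Mapping.single u c * r * b) = 0" for u c
    by (induction b rule: poly_mapping_single_induct)
      (simp_all add: distrib_left word_functional_add R[OF gen])
  then show ?case
    by (induction a rule: poly_mapping_single_induct)
      (simp_all add: distrib_right word_functional_add)
next
  case (add x y)
  then show ?case by (simp add: word_functional_add)
qed

lemma word_functional_tensor_relations:
  fixes N :: "'a::real_vector list \<Rightarrow> real"
  assumes add: "\<And>u x y w. N (u @ (x + y) # w) = N (u @ x # w) + N (u @ y # w)"
    and scale: "\<And>u k x w. N (u @ (k *\<^sub>R x) # w) = k * N (u @ x # w)"
    and r: "r \<in> tensor_relations"
  shows "word_functional N (Poly_Mapping.single u c * r * Poly_Mapping.single w d) = 0"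
proof -
  consider x y where "r = fgen (x + y) - fgen x - fgen y" | k x where "r = fgen (k *\<^sub>R x) - fscal k * fgen x"
    using r unfolding tensor_relations_def by blast
  then show ?thesis
  proof cases
    case 1
    then show ?thesis
      by (simp add: right_diff_distrib left_diff_distrib mult_single plus_list_def
          word_functional_diff word_functional_single add) (simp add: algebra_simps)
  next
    case 2
    then show ?thesis
      by (simp add: right_diff_distrib left_diff_distrib mult_single plus_list_def zero_list_def
          word_functional_diff word_functional_single scale)
  qed
qed

text \<open>
  Multilinearity and symmetry say that the functional on the free algebra kills the relations of the
  symmetric algebra, so it descends to the quotient.
\<close>

lemma symmetric_multilinear_determined:
  fixes N :: "'a::real_vector list \<Rightarrow> real"
  assumes add: "\<And>u x y w. N (u @ (x + y) # w) = N (u @ x # w) + N (u @ y # w)"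
    and scale: "\<And>u k x w. N (u @ (k *\<^sub>R x) # w) = k * N (u @ x # w)"
    and swap: "\<And>u x y w. N (u @ x # y # w) = N (u @ y # x # w)"
    and eq: "(\<Prod>i=1..p. sym_incl (a i)) = (\<Prod>i=1..p. sym_incl (b i))"
  shows "N (map a [1..<Suc p]) = N (map b [1..<Suc p])"
proof -
  have prod: "(\<Prod>i=1..p. sym_incl (a i)) = abs_sym (Poly_Mapping.single (map a [1..<Suc p]) 1)" for a :: "nat \<Rightarrow> 'a"
  proof (induction p)
    case 0
    have "(1 :: 'a list \<Rightarrow>\<^sub>0 real) = Poly_Mapping.single [] 1"
      by (simp add: zero_list_def[symmetric])
    then show ?case by (simp add: one_sym_def)
  next
    case (Suc p)
    have "(\<Prod>i=1..Suc p. sym_incl (a i)) = (\<Prod>i=1..p. sym_incl (a i)) * sym_incl (a (Suc p))"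
      by (simp add: mult.commute)
    also have "\<dots> = abs_sym (Poly_Mapping.single (map a [1..<Suc p]) 1 * fgen (a (Suc p)))"
      unfolding Suc by (simp add: sym_incl.abs_eq times_sym.abs_eq)
    also have "Poly_Mapping.single (map a [1..<Suc p]) 1 * fgen (a (Suc p)) =
        Poly_Mapping.single (map a [1..<Suc (Suc p)]) (1::real)"
      by (simp add: mult_single plus_list_def)
    finally show ?case .
  qed
  have "ideal_cong symmetric_relations (Poly_Mapping.single (map a [1..<Suc p]) 1)
      (Poly_Mapping.single (map b [1..<Suc p]) (1::real))"
    using eq unfolding prod by (simp add: sym.abs_eq_iff)
  then have mem: "Poly_Mapping.single (map a [1..<Suc p]) 1 - Poly_Mapping.single (map b [1..<Suc p]) (1::real)
      \<in> two_sided_ideal symmetric_relations"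
    by (simp add: ideal_cong_def)
  have rel: "word_functional N (Poly_Mapping.single u c * r * Poly_Mapping.single w d) = 0"
    if r: "r \<in> symmetric_relations" for r u c w d
  proof (cases "r \<in> tensor_relations")
    case True
    then show ?thesis using word_functional_tensor_relations[OF add scale] by blast
  next
    case False
    then obtain x y where "r = fgen x * fgen y - fgen y * fgen x"
      using r by (auto simp: symmetric_relations_def)
    then show ?thesis
      using swap[of u x y w]
      by (simp add: right_diff_distrib left_diff_distrib mult_single plus_list_def
          word_functional_diff word_functional_single)
  qed
  show ?thesis
    using word_functional_ideal[OF rel mem] by (simp add: word_functional_diff word_functional_single)
qed

text \<open>
  The functional that reads off \<open>\<langle>x, w\<rangle>\<close> from words \<open>[w]\<close> of length one and vanishes on all other
  words kills the relations of the exterior algebra.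
\<close>

lemma ext_incl_eq_0D:
  fixes x :: "'a::real_inner"
  assumes "ext_incl x = 0" shows "x = 0"
proof -
  define N where "N ws = (if length ws = 1 then inner x (hd ws) else 0)" for ws
  have add: "N (u @ (x + y) # w) = N (u @ x # w) + N (u @ y # w)" for u x y w
    by (cases u) (auto simp: N_def inner_add_right)
  have scale: "N (u @ (k *\<^sub>R x) # w) = k * N (u @ x # w)" for u k x w
    by (cases u) (auto simp: N_def)
  have square: "N (u @ x # x # w) = 0" for u x w
    by (simp add: N_def)
  have "ideal_cong exterior_relations (fgen x) 0"
    using assms by (simp add: ext_incl.abs_eq zero_ext_def ext.abs_eq_iff)
  then have mem: "fgen x \<in> two_sided_ideal exterior_relations" by (simp add: ideal_cong_def)
  have rel: "word_functional N (Poly_Mapping.single u c * r * Poly_Mapping.single w d) = 0"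
    if r: "r \<in> exterior_relations" for r u c w d
  proof (cases "r \<in> tensor_relations")
    case True
    then show ?thesis using word_functional_tensor_relations[OF add scale] by blast
  next
    case False
    then obtain x where "r = fgen x * fgen x"
      using r by (auto simp: exterior_relations_def)
    then show ?thesis
      by (simp add: mult_single plus_list_def word_functional_single square)
  qed
  have "N [x] = 0"
    using word_functional_ideal[OF rel mem] by (simp add: word_functional_single)
  then show ?thesis by (simp add: N_def)
qed

lemma ext_power_1:
  assumes "subspace W"
  shows "ext_power 1 W = ext_incl ` W"
proof -
  have "{prod_list (map ext_incl ws) | ws. length ws = 1 \<and> set ws \<subseteq> W} = ext_incl ` W"
    by (auto simp: length_Suc_conv intro!: exI[of _ "[_]"])
  then show ?thesis
    using linear_subspace_image[OF linear_ext_incl assms] by (simp add: ext_power_def)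
qed

text \<open>
  This recovers, from the condition on the values of a cocycle in the exterior algebra, that the
  difference of the values of the \<open>0\<close>-cochain is parallel to the edge.
\<close>

lemma ext_incl_in_ext_power_1:
  fixes x :: "'a::real_inner"
  assumes "subspace W" "ext_incl x \<in> ext_power 1 W"
  shows "x \<in> W"
proof -
  obtain y where y: "y \<in> W" "ext_incl x = ext_incl y" using assms ext_power_1 by blast
  then have "ext_incl (x - y) = 0" by (simp add: linear_diff[OF linear_ext_incl])
  then show ?thesis using ext_incl_eq_0D[of "x - y"] y by simp
qed

section \<open>Telescoping along a ray of linear functionals\<close>

definition maximizers :: "'b set \<Rightarrow> ('b \<Rightarrow> real) \<Rightarrow> 'b set"
  where "maximizers V \<phi> = {x \<in> V. \<forall>y\<in>V. \<phi> y \<le> \<phi> x}"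

lemma maximizers_nonempty:
  assumes "finite V" "V \<noteq> {}"
  shows "maximizers V \<phi> \<noteq> {}"
proof -
  have "Max (\<phi> ` V) \<in> \<phi> ` V" using assms by (intro Max_in) auto
  then obtain x where "x \<in> V" "\<phi> x = Max (\<phi> ` V)" by (metis imageE)
  then have "x \<in> maximizers V \<phi>" using assms by (auto simp: maximizers_def)
  then show ?thesis by blast
qed

text \<open>
  The edges crossed by the ray \<open>\<alpha> + t \<beta>\<close>, each directed from its smaller to its larger value of \<open>\<beta>\<close>,
  which is the direction of increasing \<open>t\<close>.
\<close>

definition ray_edges :: "'b set \<Rightarrow> ('b \<Rightarrow> real) \<Rightarrow> ('b \<Rightarrow> real) \<Rightarrow> ('b \<times> 'b) set"
  where "ray_edges V \<alpha> \<beta> =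
    {(x, y). x \<in> V \<and> y \<in> V \<and> \<beta> x < \<beta> y \<and> (\<exists>t\<ge>0. maximizers V (\<lambda>z. \<alpha> z + t * \<beta> z) = {x, y})}"

text \<open>
  Let \<open>S\<close> be the set of points that are maximal at some time \<open>t \<ge> 0\<close>. A point of \<open>S\<close> is maximal
  during an interval of times; it is the upper end of exactly one edge, at the beginning of that
  interval, unless it is \<open>x\<^sub>0\<close>, and the lower end of exactly one edge, at the end of the interval,
  unless it is \<open>x\<^sub>1\<close>. Hence the sum over the edges is the sum of \<open>f\<close> over \<open>S - {x\<^sub>0}\<close> minus the sum
  over \<open>S - {x\<^sub>1}\<close>.
\<close>

lemma sum_ray_edges:
  fixes \<alpha> \<beta> :: "'b \<Rightarrow> real" and f :: "'b \<Rightarrow> 'c::ab_group_add"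
  assumes V: "finite V"
    and inj: "\<And>t. t \<ge> 0 \<Longrightarrow> inj_on \<beta> (maximizers V (\<lambda>z. \<alpha> z + t * \<beta> z))"
    and card: "\<And>t. t \<ge> 0 \<Longrightarrow> card (maximizers V (\<lambda>z. \<alpha> z + t * \<beta> z)) \<le> 2"
    and x0: "maximizers V \<alpha> = {x\<^sub>0}"
    and x1: "x\<^sub>1 \<in> maximizers (maximizers V \<beta>) \<alpha>"
  shows "(\<Sum>(x, y)\<in>ray_edges V \<alpha> \<beta>. f y - f x) = f x\<^sub>1 - f x\<^sub>0"
proof -
  define M where "M t = maximizers V (\<lambda>z. \<alpha> z + t * \<beta> z)" for t
  have M: "x \<in> M t \<longleftrightarrow> x \<in> V \<and> (\<forall>z\<in>V. \<alpha> z + t * \<beta> z \<le> \<alpha> x + t * \<beta> x)" for x t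
    by (auto simp: M_def maximizers_def)
  have M0: "x \<in> V \<Longrightarrow> (\<And>z. z \<in> V \<Longrightarrow> \<alpha> z \<le> \<alpha> x) \<Longrightarrow> x = x\<^sub>0" for x
    using x0 by (auto simp: maximizers_def)
  have x0V: "x\<^sub>0 \<in> V" "\<And>z. z \<in> V \<Longrightarrow> \<alpha> z \<le> \<alpha> x\<^sub>0" using x0 by (auto simp: maximizers_def)
  have x1V: "x\<^sub>1 \<in> V" "\<And>z. z \<in> V \<Longrightarrow> \<beta> z \<le> \<beta> x\<^sub>1" "\<And>z. z \<in> V \<Longrightarrow> \<beta> z = \<beta> x\<^sub>1 \<Longrightarrow> \<alpha> z \<le> \<alpha> x\<^sub>1"
    using x1 by (auto simp: maximizers_def)
  have finM: "finite (M t)" for t using V by (auto simp: M_def maximizers_def)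
  have pair: "M t = {x, y}" if "x \<in> M t" "y \<in> M t" "x \<noteq> y" "t \<ge> 0" for x y t
    using that card[OF that(4)] card_mono[OF finM, of "{x, y}" t]
    by (intro card_subset_eq[symmetric] finM) (auto simp: M_def)
  define E where "E = ray_edges V \<alpha> \<beta>"
  have E: "(x, y) \<in> E \<longleftrightarrow> \<beta> x < \<beta> y \<and> (\<exists>t\<ge>0. M t = {x, y})" for x y
    unfolding E_def ray_edges_def using M by (auto simp: M_def[symmetric])
  define S where "S = (\<Union>t\<in>{0..}. M t)"
  have SV: "S \<subseteq> V" by (auto simp: S_def M)
  then have finS: "finite S" using V finite_subset by blast
  have x0S: "x\<^sub>0 \<in> S" unfolding S_def using x0V by (intro UN_I[of 0]) (auto simp: M)
  have x1S: "x\<^sub>1 \<in> S"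
  proof -
    define r where "r z = (if \<beta> z < \<beta> x\<^sub>1 then (\<alpha> z - \<alpha> x\<^sub>1) / (\<beta> x\<^sub>1 - \<beta> z) else 0)" for z
    define t where "t = Max (insert 0 (r ` V))"
    have t: "t \<ge> 0" "\<And>z. z \<in> V \<Longrightarrow> r z \<le> t" using V by (auto simp: t_def)
    have "x\<^sub>1 \<in> M t" unfolding M
    proof (intro conjI ballI x1V(1))
      fix z assume z: "z \<in> V"
      show "\<alpha> z + t * \<beta> z \<le> \<alpha> x\<^sub>1 + t * \<beta> x\<^sub>1"
      proof (cases "\<beta> z < \<beta> x\<^sub>1")
        case True
        then have "(\<alpha> z - \<alpha> x\<^sub>1) / (\<beta> x\<^sub>1 - \<beta> z) \<le> t" using t(2)[OF z] by (simp add: r_def)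
        then show ?thesis using True by (simp add: pos_divide_le_eq algebra_simps)
      next
        case False
        then have "\<beta> z = \<beta> x\<^sub>1" using x1V(2)[OF z] by simp
        then show ?thesis using x1V(3)[OF z] by simp
      qed
    qed
    then show ?thesis using t(1) by (auto simp: S_def)
  qed
  have cross: "\<alpha> y + t' * \<beta> y < \<alpha> x + t' * \<beta> x"
    if "x \<in> M t" "\<alpha> y + t * \<beta> y \<le> \<alpha> x + t * \<beta> x" "(t' - t) * (\<beta> x - \<beta> y) > 0" for x y t t'
    using that by (simp add: algebra_simps)
  \<comment> \<open>once \<open>y\<close> is maximal, the points of smaller slope are strictly below it at all later times\<close>
  have inj_snd: "inj_on snd E"
  proof (rule inj_onI, clarify)
    fix x y x' y' assume e: "(x, y) \<in> E" "(x', y') \<in> E" and "snd (x, y) = snd (x', y')"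
    then have [simp]: "y' = y" by simp
    from e obtain t t' where t: "t \<ge> 0" "M t = {x, y}" "t' \<ge> 0" "M t' = {x', y}" and b: "\<beta> x < \<beta> y" "\<beta> x' < \<beta> y"
      by (auto simp: E)
    have v: "x \<in> V" "x' \<in> V" "y \<in> V" using t M by blast+
    have "\<not> t < t'"
    proof
      assume "t < t'"
      then have "\<alpha> x' + t' * \<beta> x' < \<alpha> y + t' * \<beta> y"
        using t v b by (intro cross[of _ t]) (auto simp: M)
      moreover have "x' \<in> M t'" using t by simp
      ultimately show False using v unfolding M by force
    qed
    moreover have "\<not> t' < t"
    proof
      assume "t' < t"
      then have "\<alpha> x + t * \<beta> x < \<alpha> y + t * \<beta> y"
        using t v b by (intro cross[of _ t']) (auto simp: M)
      moreover have "x \<in> M t" using t by simp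
      ultimately show False using v unfolding M by force
    qed
    ultimately have "{x, y} = {x', y}" using t by simp
    then show "x = x' \<and> y = y'" using b by auto
  qed
  have inj_fst: "inj_on fst E"
  proof (rule inj_onI, clarify)
    fix x y x' y' assume e: "(x, y) \<in> E" "(x', y') \<in> E" and "fst (x, y) = fst (x', y')"
    then have [simp]: "x' = x" by simp
    from e obtain t t' where t: "t \<ge> 0" "M t = {x, y}" "t' \<ge> 0" "M t' = {x, y'}" and b: "\<beta> x < \<beta> y" "\<beta> x < \<beta> y'"
      by (auto simp: E)
    have v: "x \<in> V" "y \<in> V" "y' \<in> V" using t M by blast+
    have "\<not> t < t'"
    proof
      assume "t < t'"
      then have "\<alpha> x + t' * \<beta> x < \<alpha> y + t' * \<beta> y"
        using t v b by (intro cross[of _ t]) (auto simp: M)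
      moreover have "x \<in> M t'" using t by simp
      ultimately show False using v unfolding M by force
    qed
    moreover have "\<not> t' < t"
    proof
      assume "t' < t"
      then have "\<alpha> x + t * \<beta> x < \<alpha> y' + t * \<beta> y'"
        using t v b by (intro cross[of _ t']) (auto simp: M)
      moreover have "x \<in> M t" using t by simp
      ultimately show False using v unfolding M by force
    qed
    ultimately have "{x, y} = {x, y'}" using t by simp
    then show "x = x' \<and> y = y'" using b by auto
  qed
  \<comment> \<open>the edge below \<open>y\<close> is crossed at the largest time \<open>r x\<close> at which a point of smaller slope ties with \<open>y\<close>\<close>
  have img_snd: "snd ` E = S - {x\<^sub>0}"
  proof (intro equalityI subsetI)
    fix y assume "y \<in> snd ` E"
    then obtain x t where t: "t \<ge> 0" "M t = {x, y}" "\<beta> x < \<beta> y" by (auto simp: E)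
    then have v: "x \<in> V" "y \<in> V" and "x \<in> M t" "y \<in> M t" using M by blast+
    then have eq: "\<alpha> x + t * \<beta> x = \<alpha> y + t * \<beta> y" by (auto simp: M intro: antisym)
    have "y \<noteq> x\<^sub>0"
    proof
      assume y: "y = x\<^sub>0"
      have "\<alpha> y \<le> \<alpha> x" using eq t mult_left_mono[of "\<beta> x" "\<beta> y" t] by simp
      then have "x = x\<^sub>0" using x0V y by (intro M0[OF v(1)]) force
      then show False using y t(3) by simp
    qed
    then show "y \<in> S - {x\<^sub>0}" using \<open>y \<in> M t\<close> t(1) by (auto simp: S_def)
  next
    fix y assume y: "y \<in> S - {x\<^sub>0}"
    then obtain t\<^sub>0 where t0: "t\<^sub>0 \<ge> 0" "y \<in> M t\<^sub>0" and yV: "y \<in> V" using SV by (auto simp: S_def)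
    have t0le: "\<alpha> z - \<alpha> y \<le> t\<^sub>0 * (\<beta> y - \<beta> z)" if "z \<in> V" for z
      using t0(2) that unfolding M by (force simp: algebra_simps)
    define L where "L = {z \<in> V. \<beta> z < \<beta> y}"
    define r where "r z = (\<alpha> z - \<alpha> y) / (\<beta> y - \<beta> z)" for z
    have up: "\<alpha> z - \<alpha> y \<le> t * (\<beta> y - \<beta> z)" if "z \<in> V" "z \<notin> L" "t \<le> t\<^sub>0" for z t
    proof -
      have "t\<^sub>0 * (\<beta> y - \<beta> z) \<le> t * (\<beta> y - \<beta> z)"
        using that by (intro mult_right_mono_neg) (auto simp: L_def)
      then show ?thesis using t0le[OF that(1)] by linarith
    qed
    have low: "\<alpha> z - \<alpha> y \<le> t * (\<beta> y - \<beta> z) \<longleftrightarrow> r z \<le> t" if "z \<in> L" for z t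
      using that by (simp add: r_def L_def pos_divide_le_eq)
    have "\<exists>z\<in>L. r z > 0"
    proof (rule ccontr)
      assume "\<not> (\<exists>z\<in>L. r z > 0)"
      then have "\<alpha> z \<le> \<alpha> y" if "z \<in> V" for z
        using up[of z 0] low[of z 0] that t0(1) by (cases "z \<in> L") (auto simp: not_less)
      then have "y = x\<^sub>0" by (intro M0[OF yV])
      then show False using y by simp
    qed
    then obtain z\<^sub>0 where z0: "z\<^sub>0 \<in> L" "r z\<^sub>0 > 0" by blast
    have finL: "finite L" using V by (simp add: L_def)
    obtain x where x: "x \<in> L" "\<And>z. z \<in> L \<Longrightarrow> r z \<le> r x"
      using maximizers_nonempty[OF finL, of r] z0(1) by (auto simp: maximizers_def)
    define t where "t = r x"
    have t: "t \<ge> 0" using x(2)[OF z0(1)] z0(2) by (simp add: t_def)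
    have "t \<le> t\<^sub>0" using low[OF x(1), of t\<^sub>0] t0le[of x] x(1) by (simp add: t_def L_def)
    have le: "\<alpha> z + t * \<beta> z \<le> \<alpha> y + t * \<beta> y" if "z \<in> V" for z
      using up[OF that _ \<open>t \<le> t\<^sub>0\<close>] low[of z t] x(2)[of z] by (cases "z \<in> L") (auto simp: t_def algebra_simps)
    then have yM: "y \<in> M t" using yV by (simp add: M)
    have "\<alpha> x + t * \<beta> x = \<alpha> y + t * \<beta> y"
      using x(1) by (simp add: t_def r_def L_def field_simps)
    then have "x \<in> M t" using le x(1) by (simp add: M L_def)
    then have "(x, y) \<in> E" using pair[OF _ yM _ t] x(1) t by (auto simp: E L_def)
    then show "y \<in> snd ` E" by force
  qed
  \<comment> \<open>symmetrically, the next edge is crossed at the smallest time at which a point of larger slope ties\<close>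
  have img_fst: "fst ` E = S - {x\<^sub>1}"
  proof (intro equalityI subsetI)
    fix x assume "x \<in> fst ` E"
    then obtain y t where t: "t \<ge> 0" "M t = {x, y}" "\<beta> x < \<beta> y" by (auto simp: E)
    then have v: "x \<in> V" "y \<in> V" and "x \<in> M t" using M by blast+
    have "x \<noteq> x\<^sub>1" using x1V(2)[OF v(2)] t(3) by auto
    then show "x \<in> S - {x\<^sub>1}" using \<open>x \<in> M t\<close> t(1) by (auto simp: S_def)
  next
    fix y assume y: "y \<in> S - {x\<^sub>1}"
    then obtain t\<^sub>0 where t0: "t\<^sub>0 \<ge> 0" "y \<in> M t\<^sub>0" and yV: "y \<in> V" using SV by (auto simp: S_def)
    have t0le: "\<alpha> z - \<alpha> y \<le> t\<^sub>0 * (\<beta> y - \<beta> z)" if "z \<in> V" for z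
      using t0(2) that unfolding M by (force simp: algebra_simps)
    define U where "U = {z \<in> V. \<beta> y < \<beta> z}"
    define r where "r z = (\<alpha> y - \<alpha> z) / (\<beta> z - \<beta> y)" for z
    have low: "\<alpha> z - \<alpha> y \<le> t * (\<beta> y - \<beta> z)" if "z \<in> V" "z \<notin> U" "t\<^sub>0 \<le> t" for z t
    proof -
      have "t\<^sub>0 * (\<beta> y - \<beta> z) \<le> t * (\<beta> y - \<beta> z)"
        using that by (intro mult_right_mono) (auto simp: U_def)
      then show ?thesis using t0le[OF that(1)] by linarith
    qed
    have up: "\<alpha> z - \<alpha> y \<le> t * (\<beta> y - \<beta> z) \<longleftrightarrow> t \<le> r z" if "z \<in> U" for z t
      using that by (simp add: r_def U_def pos_le_divide_eq) (simp add: algebra_simps)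
    have "x\<^sub>1 \<in> U"
    proof (rule ccontr)
      assume "x\<^sub>1 \<notin> U"
      then have b: "\<beta> y = \<beta> x\<^sub>1" using x1V(1) x1V(2)[OF yV] by (simp add: U_def)
      then have "\<alpha> x\<^sub>1 = \<alpha> y" using x1V(3)[OF yV] t0le[OF x1V(1)] by simp
      then have "x\<^sub>1 \<in> M t\<^sub>0" using t0(2) x1V(1) b by (simp add: M)
      then have "y = x\<^sub>1" using inj[OF t0(1)] t0(2) b by (auto simp: M_def inj_on_def)
      then show False using y by simp
    qed
    have finU: "finite U" using V by (simp add: U_def)
    obtain x where x: "x \<in> U" "\<And>z. z \<in> U \<Longrightarrow> r x \<le> r z"
      using maximizers_nonempty[OF finU, of "\<lambda>z. - r z"] \<open>x\<^sub>1 \<in> U\<close> by (auto simp: maximizers_def)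
    define t where "t = r x"
    have "t\<^sub>0 \<le> t" using up[OF x(1), of t\<^sub>0] t0le[of x] x(1) by (simp add: t_def U_def)
    then have t: "t \<ge> 0" using t0(1) by simp
    have le: "\<alpha> z + t * \<beta> z \<le> \<alpha> y + t * \<beta> y" if "z \<in> V" for z
      using low[OF that _ \<open>t\<^sub>0 \<le> t\<close>] up[of z t] x(2)[of z] by (cases "z \<in> U") (auto simp: t_def algebra_simps)
    then have yM: "y \<in> M t" using yV by (simp add: M)
    have "\<alpha> x + t * \<beta> x = \<alpha> y + t * \<beta> y"
      using x(1) by (simp add: t_def r_def U_def field_simps)
    then have "x \<in> M t" using le x(1) by (simp add: M U_def)
    then have "(y, x) \<in> E" using pair[OF yM _ _ t] x(1) t by (auto simp: E U_def)
    then show "y \<in> fst ` E" by force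
  qed
  have "(\<Sum>(x, y)\<in>E. f y - f x) = (\<Sum>e\<in>E. f (snd e)) - (\<Sum>e\<in>E. f (fst e))"
    by (simp add: split_def sum_subtractf)
  also have "\<dots> = (\<Sum>x\<in>S - {x\<^sub>0}. f x) - (\<Sum>x\<in>S - {x\<^sub>1}. f x)"
    unfolding img_snd[symmetric] img_fst[symmetric]
    by (simp add: sum.reindex[OF inj_snd] sum.reindex[OF inj_fst])
  also have "\<dots> = f x\<^sub>1 - f x\<^sub>0"
    using finS x0S x1S by (simp add: sum_diff1)
  finally show ?thesis by (simp add: E_def)
qed

section \<open>Dual cones and convenient points\<close>

text \<open>
  Identifies \<open>W\<close> with its dual, so that dimensions of subspaces of the dual space can be computed in
  \<open>W\<close>.
\<close>

definition functional_on :: "'a::euclidean_space set \<Rightarrow> 'a \<Rightarrow> 'a \<Rightarrow> real"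
  where "functional_on W z = restrict_functional W (inner z)"

lemma functional_on_apply: "functional_on W z x = (if x \<in> W then inner z x else 0)"
  by (simp add: functional_on_def restrict_functional_def)

lemma linear_functional_on: "linear (functional_on W)"
  by (rule linearI)
    (auto simp: functional_on_apply fun_eq_iff plus_fun_def scaleR_fun_def inner_add_left)

lemma inj_on_functional_on: "subspace W \<Longrightarrow> inj_on (functional_on W) W"
proof (rule inj_onI)
  fix z z' assume W: "subspace W" "z \<in> W" "z' \<in> W" and eq: "functional_on W z = functional_on W z'"
  have "z - z' \<in> W" using W by (simp add: subspace_diff)
  then have "inner z (z - z') = inner z' (z - z')"
    using fun_cong[OF eq, of "z - z'"] by (simp add: functional_on_apply)
  then have "inner (z - z') (z - z') = 0" by (simp add: inner_diff_left)
  then show "z = z'" by simp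
qed

lemma linear_functional_inner:
  fixes \<phi> :: "'a::euclidean_space \<Rightarrow> real"
  assumes "linear \<phi>"
  obtains g where "\<phi> = inner g"
proof
  show "\<phi> = inner (adjoint \<phi> 1)"
    using adjoint_works[OF assms, of _ 1] by (auto simp: inner_commute)
qed

text \<open>
  Riesz representation on a subspace: extend the functional by the orthogonal projection, represent
  it on the whole space, and project the representing vector to \<open>W\<close>.
\<close>

lemma dual_space_eq_functional_on:
  fixes W :: "'a::euclidean_space set"
  assumes W: "subspace W"
  shows "dual_space W = functional_on W ` W"
proof (intro equalityI subsetI)
  fix \<psi> assume psi: "\<psi> \<in> dual_space W"
  obtain b where b: "orthonormal_basis W b" using orthonormal_basis_exists[OF W] by blast
  then have ob: "ordered_basis W b" by (simp add: orthonormal_basis_def)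
  define P where "P x = (\<Sum>i<length b. inner (b ! i) x *\<^sub>R b ! i)" for x
  have PW: "P x \<in> W" for x
    unfolding P_def using W ordered_basisD(5)[OF ob]
    by (intro subspace_sum subspace_scale) (auto simp: subset_iff)
  have Pid: "P x = x" if "x \<in> W" for x
    unfolding P_def using sum_basis_coeff[OF ob that] by (simp add: orthonormal_basis_coeff[OF b that])
  have "linear (\<lambda>x. \<psi> (P x))"
  proof (rule linearI)
    fix x y
    have "P (x + y) = P x + P y" by (simp add: P_def inner_add_right scaleR_add_left sum.distrib)
    then show "\<psi> (P (x + y)) = \<psi> (P x) + \<psi> (P y)" using psi PW by (simp add: dual_space_def)
  next
    fix c x
    have "P (c *\<^sub>R x) = c *\<^sub>R P x" by (simp add: P_def scaleR_sum_right)
    then show "\<psi> (P (c *\<^sub>R x)) = c *\<^sub>R \<psi> (P x)" using psi PW by (simp add: dual_space_def)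
  qed
  then obtain a where a: "(\<lambda>x. \<psi> (P x)) = inner a" by (rule linear_functional_inner)
  obtain z y where z: "z \<in> span W" "\<And>w. w \<in> span W \<Longrightarrow> inner y w = 0" "a = z + y"
    using orthogonal_subspace_decomp_exists[of W a] unfolding Linear_Algebra.orthogonal_def by blast
  have "\<psi> x = functional_on W z x" for x
  proof (cases "x \<in> W")
    case True
    then have "\<psi> x = inner a x" using fun_cong[OF a, of x] by (simp add: Pid)
    also have "\<dots> = inner z x" using z True by (simp add: inner_add_left span_base)
    finally show ?thesis using True by (simp add: functional_on_apply)
  next
    case False
    then show ?thesis using psi by (simp add: functional_on_apply dual_space_def)
  qed
  then show "\<psi> \<in> functional_on W ` W" using z(1) W by (metis ext image_eqI span_eq_iff)
next
  fix \<psi> assume "\<psi> \<in> functional_on W ` W"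
  then show "\<psi> \<in> dual_space W"
    using W by (auto simp: dual_space_def functional_on_apply inner_add_right subspace_add subspace_scale)
qed

lemma dim_functional_on_image:
  fixes W :: "'a::euclidean_space set"
  assumes "subspace W" "S \<subseteq> W"
  shows "dim (functional_on W ` S) = dim S"
proof (rule eucl.dim_image_eq[OF linear_functional_on])
  have "span S \<subseteq> W" using assms by (simp add: span_minimal)
  then show "inj_on (functional_on W) (span S)"
    using inj_on_functional_on[OF assms(1)] inj_on_subset by blast
qed

lemma dirspace_translate:
  fixes K :: "'b::real_vector set"
  shows "dirspace ((+) a ` K) = dirspace K"
proof -
  have "{x - y |x y. x \<in> (+) a ` K \<and> y \<in> (+) a ` K} = {x - y |x y. x \<in> K \<and> y \<in> K}" (is "?L = ?R")
  proof (intro equalityI subsetI)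
    fix d assume "d \<in> ?L"
    then obtain x y where "x \<in> K" "y \<in> K" "d = (a + x) - (a + y)" by blast
    then have "d = x - y" by simp
    then show "d \<in> ?R" using \<open>x \<in> K\<close> \<open>y \<in> K\<close> by blast
  next
    fix d assume "d \<in> ?R"
    then obtain x y where "x \<in> K" "y \<in> K" "d = x - y" by blast
    then have "a + x \<in> (+) a ` K" "a + y \<in> (+) a ` K" "d = (a + x) - (a + y)" by auto
    then show "d \<in> ?L" by blast
  qed
  then show ?thesis by (simp add: dirspace_def)
qed

lemma maximizers_face:
  fixes \<gamma> :: "'a::euclidean_space set"
  assumes "compact \<gamma>" "convex \<gamma>" "\<gamma> \<noteq> {}"
  shows "maximizers \<gamma> (inner h) face_of \<gamma>" "maximizers \<gamma> (inner h) \<noteq> {}"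
proof -
  have "continuous_on \<gamma> (inner h)" by (intro continuous_intros)
  then obtain x where x: "x \<in> \<gamma>" "\<And>y. y \<in> \<gamma> \<Longrightarrow> inner h y \<le> inner h x"
    using continuous_attains_sup[OF assms(1,3)] by blast
  then have eq: "maximizers \<gamma> (inner h) = \<gamma> \<inter> {y. inner h y = inner h x}"
    by (auto simp: maximizers_def intro: antisym)
  then show "maximizers \<gamma> (inner h) face_of \<gamma>"
    using face_of_Int_supporting_hyperplane_le[OF assms(2), of h "inner h x"] x by simp
  show "maximizers \<gamma> (inner h) \<noteq> {}" using eq x by auto
qed

lemma dual_cone_vanishes:
  assumes "c \<in> dirspace (dual_cone \<gamma> \<delta>)" "\<delta> \<subseteq> \<gamma>" "x \<in> \<delta>" "y \<in> \<delta>"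
  shows "c (x - y) = 0"
proof -
  have "dirspace (dual_cone \<gamma> \<delta>) \<subseteq> {c. c (x - y) = 0}"
  proof (rule dirspace_subset)
    have z: "c (x - y) = 0" if "c \<in> dual_cone \<gamma> \<delta>" for c
    proof -
      have lin: "c \<in> dual_space (dirspace \<gamma>)" using that by (simp add: dual_cone_def)
      have d: "x - y \<in> dirspace \<gamma>" using assms by (intro diff_in_dirspace) auto
      have "c ((-1) *\<^sub>R (x - y)) = (-1) * c (x - y)"
        using lin d unfolding dual_space_def by blast
      moreover have "(-1) *\<^sub>R (x - y) = y - x" by simp
      moreover have "c (x - y) \<le> 0" "c (y - x) \<le> 0" using that assms by (auto simp: dual_cone_def)
      ultimately show ?thesis by simp
    qed
    fix c c' assume "c \<in> dual_cone \<gamma> \<delta>" "c' \<in> dual_cone \<gamma> \<delta>"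
    then show "c - c' \<in> {c. c (x - y) = 0}" using z[of c] z[of c'] by simp
  qed (auto simp: subspace_def scaleR_fun_def zero_fun_def)
  then show ?thesis using assms(1) by auto
qed

text \<open>
  Let \<open>F\<close> be the face of \<open>\<gamma>\<close> selected by \<open>v + z\<close>, where \<open>z\<close> is in the cone \<open>\<delta>\<^sup>*\<close> of dimension at
  most one. If \<open>F\<close> contains two points \<open>x \<noteq> y\<close>, then \<open>F\<^sup>*\<close> is contained in the hyperplane \<open>A\<close> of
  functionals vanishing at \<open>x - y\<close>, and it meets \<open>v + \<delta>\<^sup>*\<close>. The codimensions of the two cones add up
  to at least the dimension \<open>n + 1\<close> of the dual space, so transversality forces \<open>F\<^sup>*\<close> to span \<open>A\<close>
  and \<open>\<delta>\<^sup>*\<close> to span a line transversal to \<open>A\<close>. As \<open>u\<close> spans that line, \<open>\<langle>u, x - y\<rangle> \<noteq> 0\<close>; and since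
  the span of \<open>F\<^sup>*\<close> vanishes on all of \<open>F\<close>, while it contains every functional vanishing at \<open>x - y\<close>,
  the face \<open>F\<close> lies in a line. For \<open>\<delta> = \<gamma>\<close> one may take \<open>u = 0\<close>, and the conclusion is absurd: hence
  \<open>v\<close> itself selects a single vertex.
\<close>

lemma transversal_maximizers:
  fixes \<gamma> :: "'a::euclidean_space set"
  assumes g: "compact \<gamma>" "convex \<gamma>" "\<gamma> \<noteq> {}" "aff_dim \<gamma> = int (n + 1)"
    and T: "transversal_in (dual_space (dirspace \<gamma>))
        ((\<lambda>K. (+) (restrict_functional (dirspace \<gamma>) (inner v)) ` K) ` dual_fan_skeleton 1 \<gamma>)
        (dual_fan_skeleton n \<gamma>)"
    and d: "\<delta> face_of \<gamma>" "\<delta> \<noteq> {}"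
    and u: "u \<in> dirspace \<gamma>" "dirspace (dual_cone \<gamma> \<delta>) \<subseteq> functional_on (dirspace \<gamma>) ` span {u}"
    and z: "functional_on (dirspace \<gamma>) z \<in> dual_cone \<gamma> \<delta>"
    and xy: "x \<in> maximizers \<gamma> (inner (v + z))" "y \<in> maximizers \<gamma> (inner (v + z))" "x \<noteq> y"
  shows "inner u (x - y) \<noteq> 0" "aff_dim (maximizers \<gamma> (inner (v + z))) \<le> 1"
proof -
  define V where "V = dirspace \<gamma>"
  define F where "F = maximizers \<gamma> (inner (v + z))"
  let ?K = "dual_cone \<gamma> \<delta>" and ?C = "dual_cone \<gamma> F" and ?\<Phi> = "functional_on V"
  have V: "subspace V" by (simp add: V_def)
  have dimV: "dim V = n + 1" using aff_dim_eq_dim_dirspace[OF g(3)] g(4) by (simp add: V_def)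
  have F: "F face_of \<gamma>" "F \<noteq> {}" using maximizers_face[OF g(1-3)] by (auto simp: F_def)
  have Fs: "F \<subseteq> \<gamma>" using F face_of_imp_subset by blast
  have FV: "dirspace F \<subseteq> V" using dirspace_mono[OF Fs] by (simp add: V_def)
  have xyF: "x \<in> F" "y \<in> F" and xyV: "x - y \<in> V" using xy Fs diff_in_dirspace[of x \<gamma> y] by (auto simp: F_def V_def)
  have dual: "dual_space V = ?\<Phi> ` V" by (rule dual_space_eq_functional_on[OF V])
  have subdual: "dirspace B \<subseteq> dual_space V" if "B \<subseteq> dual_space V" for B
  proof (rule dirspace_subset)
    show s: "subspace (dual_space V)"
      unfolding dual by (rule linear_subspace_image[OF linear_functional_on V])
    show "c - c' \<in> dual_space V" if "c \<in> B" "c' \<in> B" for c c'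
      using s subspace_diff that \<open>B \<subseteq> _\<close> by blast
  qed
  define pre where "pre B = {w \<in> V. ?\<Phi> w \<in> B}" for B
  have pre_img: "?\<Phi> ` pre B = B" if "B \<subseteq> dual_space V" for B
    using that unfolding dual by (auto simp: pre_def)
  have pre_sub: "subspace (pre B)" if "subspace B" for B
    using that V linear_functional_on[of V]
    by (auto simp: pre_def subspace_def linear_0 linear_add linear_scale)
  have dim_pre: "dim B = dim (pre B)" if "B \<subseteq> dual_space V" for B
    using dim_functional_on_image[OF V, of "pre B"] pre_img[OF that] by (simp add: pre_def)
  \<comment> \<open>preimages under \<open>functional_on\<close> move the count of dimensions into \<open>V\<close>\<close>
  define K' C' where "K' = dirspace ?K" and "C' = dirspace ?C"
  have KC: "K' \<subseteq> dual_space V" "C' \<subseteq> dual_space V"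
    unfolding K'_def C'_def by (rule subdual, force simp: dual_cone_def V_def)+
  have k: "dim K' \<le> 1"
  proof -
    have "pre K' \<subseteq> span {u}"
    proof
      fix w assume w: "w \<in> pre K'"
      then obtain w' where w': "w' \<in> span {u}" "?\<Phi> w = ?\<Phi> w'"
        using u(2) by (auto simp: pre_def K'_def V_def)
      moreover have "w' \<in> V" using w'(1) u(1) V by (auto simp: span_singleton V_def subspace_scale)
      ultimately have "w = w'" using w inj_on_functional_on[OF V] by (auto simp: pre_def inj_on_def)
      then show "w \<in> span {u}" using w' by simp
    qed
    then have "dim (pre K') \<le> dim {u}" by (metis dim_span dim_subset)
    also have "\<dots> \<le> 1" using dim_le_card'[of "{u}"] by simp
    finally show ?thesis using dim_pre[OF KC(1)] by simp
  qed
  let ?A = "{w \<in> V. inner w (x - y) = 0}"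
  have subA: "subspace ?A"
    using V by (auto simp: subspace_def inner_add_left)
  have "x - y \<notin> ?A" using xy(3) by simp
  then have "?A \<subset> V" using xyV by blast
  then have dimA: "dim ?A < dim V"
    using subspace_dim_equal[OF subA V] by (auto simp: not_le[symmetric])
  have CA: "pre C' \<subseteq> ?A"
  proof
    fix w assume w: "w \<in> pre C'"
    then have "?\<Phi> w (x - y) = 0"
      using dual_cone_vanishes[of "?\<Phi> w" \<gamma> F x y] Fs xyF by (auto simp: pre_def C'_def)
    then show "w \<in> ?A" using w xyV by (simp add: pre_def functional_on_apply)
  qed
  have c: "dim C' \<le> n" using dim_subset[OF CA] dimA dimV dim_pre[OF KC(2)] by simp
  have "?K \<in> dual_fan_skeleton 1 \<gamma>" "?C \<in> dual_fan_skeleton n \<gamma>"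
    using d F k c unfolding dual_fan_skeleton_def K'_def C'_def by blast+
  moreover have "(+) (restrict_functional V (inner v)) ` ?K \<inter> ?C \<noteq> {}"
  proof -
    have eq: "restrict_functional V (inner v) + ?\<Phi> z = ?\<Phi> (v + z)"
      by (auto simp: fun_eq_iff functional_on_apply restrict_functional_def inner_add_left)
    have "?\<Phi> (v + z) \<in> dual_space V"
      using V by (auto simp: dual_space_def functional_on_apply inner_add_right subspace_add subspace_scale)
    moreover have "?\<Phi> (v + z) (b - a) \<le> 0" if "a \<in> F" "b \<in> \<gamma>" for a b
      using that Fs by (auto simp: functional_on_apply F_def maximizers_def inner_diff_right)
    ultimately have "?\<Phi> (v + z) \<in> ?C" by (simp add: dual_cone_def V_def)
    then show ?thesis using eq z by (force simp: V_def)
  qed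
  ultimately have "codim_in (dual_space V) (K' \<inter> C') = codim_in (dual_space V) K' + codim_in (dual_space V) C'"
    using T unfolding transversal_in_def V_def[symmetric] K'_def C'_def
    by (metis (no_types, lifting) dirspace_translate imageI)
  moreover have "dim (dual_space V) = n + 1"
    using dim_functional_on_image[OF V subset_refl] dual dimV by simp
  ultimately have dims: "dim (K' \<inter> C') = 0" "dim K' = 1" "dim C' = n"
    using k c by (auto simp: codim_in_def)
  have CA': "pre C' = ?A"
    by (rule subspace_dim_equal)
      (use CA subA pre_sub[of C'] dimA dimV dim_pre[OF KC(2)] dims in \<open>auto simp: C'_def\<close>)
  show "inner u (x - y) \<noteq> 0"
  proof
    assume 0: "inner u (x - y) = 0"
    have "K' \<subseteq> C'"
    proof
      fix \<psi> assume psi: "\<psi> \<in> K'"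
      then obtain w where w: "w \<in> span {u}" "\<psi> = ?\<Phi> w" using u(2) by (auto simp: K'_def V_def)
      then have "w \<in> ?A" using 0 u(1) V by (auto simp: span_singleton V_def subspace_scale)
      then show "\<psi> \<in> C'" using CA' w by (auto simp: pre_def)
    qed
    then have "K' \<inter> C' = K'" by blast
    then show False using dims by simp
  qed
  \<comment> \<open>a direction of \<open>F\<close> orthogonal to \<open>x - y\<close> lies in \<open>A\<close>, hence in the span of \<open>F\<^sup>*\<close>, which vanishes on \<open>F\<close>\<close>
  have "dirspace F \<subseteq> span {x - y}"
  proof
    fix e assume e: "e \<in> dirspace F"
    define k where "k = inner e (x - y) / inner (x - y) (x - y)"
    define f where "f = e - k *\<^sub>R (x - y)"
    have fF: "f \<in> dirspace F"
      using e xyF diff_in_dirspace[of x F y] by (simp add: f_def subspace_diff subspace_scale)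
    have "inner f (x - y) = inner e (x - y) - k * inner (x - y) (x - y)"
      by (simp only: f_def inner_diff_left[of e] inner_scaleR_left)
    also have "\<dots> = 0" using xy(3) by (simp add: k_def)
    finally have "inner f (x - y) = 0" .
    then have "f \<in> pre C'" unfolding CA' using fF FV by auto
    then have "?\<Phi> f (a - b) = 0" if "a \<in> F" "b \<in> F" for a b
      using dual_cone_vanishes[of _ \<gamma> F a b] Fs that by (auto simp: pre_def C'_def)
    then have "inner f (a - b) = 0" if "a \<in> F" "b \<in> F" for a b
      using that diff_in_dirspace[of a F b] FV by (force simp: functional_on_apply)
    then have "inner f f = 0" using orthogonal_dirspace fF by blast
    then show "e \<in> span {x - y}" by (auto simp: f_def span_singleton)
  qed
  then have "dim (dirspace F) \<le> 1"
    using dim_subset[of "dirspace F" "span {x - y}"] dim_le_card'[of "{x - y}"] by simp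
  then show "aff_dim (maximizers \<gamma> (inner (v + z))) \<le> 1"
    using aff_dim_eq_dim_dirspace[OF F(2)] by (simp add: F_def)
qed

section \<open>Rays in the dual fans of a complex\<close>

definition vertices :: "'a::euclidean_space set \<Rightarrow> 'a set"
  where "vertices \<gamma> = {x. x extreme_point_of \<gamma>}"

lemma vertices_face: "\<delta> face_of \<gamma> \<Longrightarrow> vertices \<delta> = vertices \<gamma> \<inter> \<delta>"
  by (auto simp: vertices_def extreme_point_of_face)

lemma vertices_subset: "vertices \<gamma> \<subseteq> \<gamma>"
  by (auto simp: vertices_def extreme_point_of_def)

lemma vertices_closed_segment: "vertices (closed_segment x y) = {x, y}"
  by (auto simp: vertices_def extreme_point_of_segment)

lemma maximizers_vertices:
  fixes \<gamma> :: "'a::euclidean_space set"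
  assumes "compact \<gamma>" "convex \<gamma>" "\<gamma> \<noteq> {}"
  shows "maximizers (vertices \<gamma>) (inner h) = vertices (maximizers \<gamma> (inner h))"
proof -
  let ?F = "maximizers \<gamma> (inner h)"
  note F = maximizers_face[OF assms, of h]
  have "compact ?F" "convex ?F"
    using F(1) assms face_of_imp_compact face_of_imp_convex by blast+
  then obtain y where "y extreme_point_of ?F" using extreme_point_exists_convex F(2) by blast
  then have y: "y \<in> vertices \<gamma>" "y \<in> ?F"
    using extreme_point_of_face[OF F(1), of y] by (auto simp: vertices_def)
  have "x \<in> ?F" if "x \<in> maximizers (vertices \<gamma>) (inner h)" for x
    using that y vertices_subset[of \<gamma>] unfolding maximizers_def by (force intro: order_trans)
  moreover have "x \<in> maximizers (vertices \<gamma>) (inner h)" if "x \<in> vertices \<gamma>" "x \<in> ?F" for x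
    using that vertices_subset[of \<gamma>] by (auto simp: maximizers_def)
  ultimately show ?thesis
    unfolding vertices_face[OF F(1)] by (auto simp: maximizers_def)
qed

lemma aff_dim_le_1_segment:
  fixes F :: "'a::euclidean_space set"
  assumes "compact F" "convex F" "F \<noteq> {}" "aff_dim F \<le> 1"
  obtains a b where "F = closed_segment a b" "vertices F = {a, b}" "aff_dim F = 1 \<longleftrightarrow> a \<noteq> b"
proof -
  obtain a b where ab: "F = closed_segment a b"
    using compact_convex_collinear_segment[of F] assms by (auto simp: collinear_aff_dim)
  have "aff_dim F = aff_dim {a, b}" unfolding ab segment_convex_hull by (rule aff_dim_convex_hull)
  then show ?thesis using that[OF ab] by (simp add: ab vertices_closed_segment aff_dim_2)
qed

text \<open>
  A functional in the cone is constant on \<open>\<delta>\<close>, hence a multiple of the normal.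
\<close>

lemma dual_cone_facet:
  fixes \<gamma> :: "'a::euclidean_space set"
  assumes d: "\<delta> facet_of \<gamma>" and u: "is_facet_normal \<gamma> \<delta> u"
  shows "dual_cone \<gamma> \<delta> = (\<lambda>c. functional_on (dirspace \<gamma>) (c *\<^sub>R u)) ` {0..}"
proof (intro equalityI subsetI)
  have sub: "\<delta> \<subseteq> \<gamma>" "\<delta> \<noteq> {}" "\<delta> \<noteq> \<gamma>" using d facet_of_imp_subset[OF d] by (auto simp: facet_of_def)
  fix w assume w: "w \<in> dual_cone \<gamma> \<delta>"
  then obtain z where z: "z \<in> dirspace \<gamma>" "w = functional_on (dirspace \<gamma>) z"
    using dual_space_eq_functional_on[of "dirspace \<gamma>"] by (auto simp: dual_cone_def)
  have le: "inner z (y - x) \<le> 0" if "x \<in> \<delta>" "y \<in> \<gamma>" for x y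
    using w that sub diff_in_dirspace[of y \<gamma> x] by (force simp: dual_cone_def z functional_on_apply)
  have orth: "inner z e = 0" if "e \<in> dirspace \<delta>" for e
  proof (rule orthogonal_dirspace[OF _ that])
    fix x y assume xy: "x \<in> \<delta>" "y \<in> \<delta>"
    then have "x \<in> \<gamma>" "y \<in> \<gamma>" using sub(1) by auto
    then show "inner z (x - y) = 0" using le[of x y] le[of y x] xy by (simp add: inner_diff_right)
  qed
  define e where "e = z - inner u z *\<^sub>R u"
  have e: "e \<in> dirspace \<delta>" unfolding e_def by (rule facet_normal_decomp[OF u d z(1)])
  then have "inner e e = 0"
    using orth[OF e] facet_normal_orthogonal[OF u sub(1) e] by (subst (1) e_def) (simp add: inner_diff_left)
  then have zu: "z = inner u z *\<^sub>R u" by (simp add: e_def)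
  obtain x y where xy: "x \<in> \<delta>" "y \<in> \<gamma>" "y \<notin> \<delta>" using sub by blast
  then have "inner u (y - x) < 0" using u unfolding is_facet_normal_def by (metis less_eq_real_def)
  moreover have "inner u z * inner u (y - x) \<le> 0" using le[OF xy(1,2)] by (subst (asm) zu) simp
  ultimately have "inner u z \<ge> 0" by (simp add: mult_le_0_iff)
  then show "w \<in> (\<lambda>c. functional_on (dirspace \<gamma>) (c *\<^sub>R u)) ` {0..}" using z(2) zu by (metis atLeast_iff image_eqI)
next
  fix w assume "w \<in> (\<lambda>c. functional_on (dirspace \<gamma>) (c *\<^sub>R u)) ` {0..}"
  then obtain c where c: "c \<ge> 0" "w = functional_on (dirspace \<gamma>) (c *\<^sub>R u)" by auto
  have "w \<in> dual_space (dirspace \<gamma>)"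
    using c u dual_space_eq_functional_on[of "dirspace \<gamma>"]
    by (auto simp: is_facet_normal_def subspace_scale)
  then show "w \<in> dual_cone \<gamma> \<delta>"
    using u c unfolding is_facet_normal_def
    by (auto simp: dual_cone_def functional_on_apply mult_nonneg_nonpos)
qed

lemma dual_cone_self:
  fixes \<gamma> :: "'a::euclidean_space set"
  assumes "\<gamma> \<noteq> {}"
  shows "dual_cone \<gamma> \<gamma> = {0}"
proof (intro equalityI subsetI)
  fix w assume w: "w \<in> dual_cone \<gamma> \<gamma>"
  then obtain z where z: "z \<in> dirspace \<gamma>" "w = functional_on (dirspace \<gamma>) z"
    using dual_space_eq_functional_on[of "dirspace \<gamma>"] by (auto simp: dual_cone_def)
  have "inner z z = 0"
  proof (rule orthogonal_dirspace[OF _ z(1)])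
    fix x y assume xy: "x \<in> \<gamma>" "y \<in> \<gamma>"
    then have "w (x - y) \<le> 0" "w (y - x) \<le> 0" using w by (auto simp: dual_cone_def)
    then show "inner z (x - y) = 0"
      using xy diff_in_dirspace[of x \<gamma> y] diff_in_dirspace[of y \<gamma> x]
      by (auto simp: z functional_on_apply inner_diff_right)
  qed
  then show "w \<in> {0}" using z by (simp add: functional_on_apply fun_eq_iff zero_fun_def)
next
  fix w :: "'a \<Rightarrow> real" assume "w \<in> {0}"
  then show "w \<in> dual_cone \<gamma> \<gamma>" by (simp add: dual_cone_def dual_space_def)
qed

text \<open>
  The convenient point is given by the vector that represents it in the inner product.
\<close>

locale convenient_complex =
  fixes X :: "'a::euclidean_space set set" and g :: 'a
  assumes complex: "p_complex X"
    and compact_cell: "\<gamma> \<in> X \<Longrightarrow> compact \<gamma>"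
    and convenient_g: "inner g \<in> convenient X"
begin

lemma cellD:
  assumes "\<gamma> \<in> X" shows "polyhedron \<gamma>" "convex \<gamma>" "\<gamma> \<noteq> {}" "compact \<gamma>"
proof -
  show "polyhedron \<gamma>" "\<gamma> \<noteq> {}" using assms complex unfolding p_complex_def by blast+
  then show "convex \<gamma>" by (simp add: polyhedron_imp_convex)
qed (rule compact_cell[OF assms])

lemma face_cell: "\<gamma> \<in> X \<Longrightarrow> \<delta> face_of \<gamma> \<Longrightarrow> \<delta> \<noteq> {} \<Longrightarrow> \<delta> \<in> X"
  using complex unfolding p_complex_def by blast

lemma facet_cell: "\<gamma> \<in> X \<Longrightarrow> \<delta> facet_of \<gamma> \<Longrightarrow> \<delta> \<in> X"
  using face_cell by (auto simp: facet_of_def)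

lemma normal_facet: "\<gamma> \<in> X \<Longrightarrow> \<delta> facet_of \<gamma> \<Longrightarrow> is_facet_normal \<gamma> \<delta> (facet_normal \<gamma> \<delta>)"
  using is_facet_normal_facet_normal cellD by blast

lemma finite_vertices: "\<gamma> \<in> X \<Longrightarrow> finite (vertices \<gamma>)"
  using finite_polyhedron_extreme_points cellD by (auto simp: vertices_def)

lemma finite_facets: "\<gamma> \<in> X \<Longrightarrow> finite {\<delta>. \<delta> facet_of \<gamma>}"
  using finite_polyhedron_facets cellD by blast

lemma cell_transversal:
  assumes "\<gamma> \<in> X" "aff_dim \<gamma> = int (n + 1)"
  shows "transversal_in (dual_space (dirspace \<gamma>))
    ((\<lambda>K. (+) (restrict_functional (dirspace \<gamma>) (inner g)) ` K) ` dual_fan_skeleton 1 \<gamma>)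
    (dual_fan_skeleton n \<gamma>)"
proof -
  have "inner g \<in> pq_convenient n 1 X" using convenient_g by (auto simp: convenient_def)
  then show ?thesis using assms by (auto simp: pq_convenient_def)
qed

lemma ray_maximizers:
  fixes t :: real
  assumes gX: "\<gamma> \<in> X" and n: "aff_dim \<gamma> = int (n + 1)" and d: "\<delta> facet_of \<gamma>" and t: "t \<ge> 0"
    and xy: "x \<in> maximizers \<gamma> (inner (g + t *\<^sub>R facet_normal \<gamma> \<delta>))"
      "y \<in> maximizers \<gamma> (inner (g + t *\<^sub>R facet_normal \<gamma> \<delta>))" "x \<noteq> y"
  shows "inner (facet_normal \<gamma> \<delta>) (x - y) \<noteq> 0"
    and "aff_dim (maximizers \<gamma> (inner (g + t *\<^sub>R facet_normal \<gamma> \<delta>))) \<le> 1"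
proof -
  let ?u = "facet_normal \<gamma> \<delta>"
  note u = normal_facet[OF gX d]
  note K = dual_cone_facet[OF d u]
  have "subspace (functional_on (dirspace \<gamma>) ` span {?u})"
    by (rule linear_subspace_image[OF linear_functional_on]) simp
  moreover have "dual_cone \<gamma> \<delta> \<subseteq> functional_on (dirspace \<gamma>) ` span {?u}"
    unfolding K by (auto simp: span_singleton)
  ultimately have sub: "dirspace (dual_cone \<gamma> \<delta>) \<subseteq> functional_on (dirspace \<gamma>) ` span {?u}"
    by (intro dirspace_subset) (auto intro: subspace_diff)
  have z: "functional_on (dirspace \<gamma>) (t *\<^sub>R ?u) \<in> dual_cone \<gamma> \<delta>" using t K by auto
  have "\<delta> face_of \<gamma>" "\<delta> \<noteq> {}" "?u \<in> dirspace \<gamma>"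
    using d u by (auto simp: facet_of_def is_facet_normal_def)
  from transversal_maximizers[OF cellD(4,2,3)[OF gX] n cell_transversal[OF gX n] this(1,2,3) sub z xy]
  show "inner ?u (x - y) \<noteq> 0" "aff_dim (maximizers \<gamma> (inner (g + t *\<^sub>R ?u))) \<le> 1" by auto
qed

lemma unique_maximizer:
  assumes gX: "\<gamma> \<in> X"
  shows "\<exists>x. maximizers \<gamma> (inner g) = {x}"
proof -
  have "maximizers \<gamma> (inner g) \<noteq> {}" using maximizers_face cellD[OF gX] by blast
  moreover have "x = y" if xy: "x \<in> maximizers \<gamma> (inner g)" "y \<in> maximizers \<gamma> (inner g)" for x y
  proof (rule ccontr)
    assume ne: "x \<noteq> y"
    have "x \<in> \<gamma>" "y \<in> \<gamma>" using xy by (auto simp: maximizers_def)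
    then have "x - y \<in> dirspace \<gamma>" "x - y \<noteq> 0" using ne diff_in_dirspace by auto
    then have "dim (dirspace \<gamma>) \<noteq> 0" by auto
    then obtain n where "dim (dirspace \<gamma>) = Suc n" using not0_implies_Suc by blast
    then have n: "aff_dim \<gamma> = int (n + 1)" using aff_dim_eq_dim_dirspace[OF cellD(3)[OF gX]] by simp
    \<comment> \<open>transversality for the whole cell, whose dual cone is \<open>{0}\<close>\<close>
    have "dirspace (dual_cone \<gamma> \<gamma>) \<subseteq> functional_on (dirspace \<gamma>) ` span {0}"
    proof -
      have "functional_on (dirspace \<gamma>) 0 = 0" by (simp add: linear_0[OF linear_functional_on])
      moreover have "dirspace {0 :: 'a \<Rightarrow> real} \<subseteq> {0}" by (rule dirspace_subset) (auto simp: subspace_0)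
      ultimately show ?thesis by (simp add: dual_cone_self[OF cellD(3)[OF gX]])
    qed
    moreover have "functional_on (dirspace \<gamma>) 0 \<in> dual_cone \<gamma> \<gamma>"
      by (simp add: dual_cone_self[OF cellD(3)[OF gX]] linear_0[OF linear_functional_on])
    ultimately have "inner 0 (x - y) \<noteq> 0"
      using transversal_maximizers(1)[OF cellD(4,2,3)[OF gX] n cell_transversal[OF gX n], of \<gamma> 0 0 x y]
        xy ne face_of_refl[OF cellD(2)[OF gX]] cellD(3)[OF gX] by (simp add: subspace_0)
    then show False by simp
  qed
  ultimately show ?thesis by blast
qed

text \<open>
  The vertex of \<open>\<gamma>\<close> at which the convenient point is maximal.
\<close>

definition top_vertex :: "'a set \<Rightarrow> 'a"
  where "top_vertex \<gamma> = the_elem (maximizers \<gamma> (inner g))"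

lemma maximizers_top_vertex:
  assumes "\<gamma> \<in> X" shows "maximizers \<gamma> (inner g) = {top_vertex \<gamma>}"
proof -
  obtain x where x: "maximizers \<gamma> (inner g) = {x}" using unique_maximizer[OF assms] by blast
  show ?thesis unfolding top_vertex_def x by simp
qed

lemma top_vertex_in_vertices:
  assumes "\<gamma> \<in> X" shows "top_vertex \<gamma> \<in> vertices \<gamma>"
proof -
  have "{top_vertex \<gamma>} face_of \<gamma>"
    using maximizers_face(1)[of \<gamma> g] cellD[OF assms] maximizers_top_vertex[OF assms] by simp
  then show ?thesis by (simp add: vertices_def face_of_singleton)
qed

abbreviation cell_ray_edges :: "'a set \<Rightarrow> 'a set \<Rightarrow> ('a \<times> 'a) set"
  where "cell_ray_edges \<gamma> \<delta> \<equiv> ray_edges (vertices \<gamma>) (inner g) (inner (facet_normal \<gamma> \<delta>))"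

lemma ray_functional: "(\<lambda>z. inner g z + t * inner u z) = inner (g + t *\<^sub>R u)"
  by (simp add: fun_eq_iff inner_add_left)

lemma ray_maximizers_segment:
  fixes t :: real
  assumes gX: "\<gamma> \<in> X" and n: "aff_dim \<gamma> = int (n + 1)" and d: "\<delta> facet_of \<gamma>" and t: "t \<ge> 0"
  obtains a b where "maximizers \<gamma> (inner (g + t *\<^sub>R facet_normal \<gamma> \<delta>)) = closed_segment a b"
    "maximizers (vertices \<gamma>) (inner (g + t *\<^sub>R facet_normal \<gamma> \<delta>)) = {a, b}"
    "aff_dim (closed_segment a b) = 1 \<longleftrightarrow> a \<noteq> b"
    "a = b \<or> inner (facet_normal \<gamma> \<delta>) a \<noteq> inner (facet_normal \<gamma> \<delta>) b"
proof -
  let ?F = "maximizers \<gamma> (inner (g + t *\<^sub>R facet_normal \<gamma> \<delta>))"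
  note F = maximizers_face[OF cellD(4,2,3)[OF gX], of "g + t *\<^sub>R facet_normal \<gamma> \<delta>"]
  have F': "compact ?F" "convex ?F"
    using F(1) cellD[OF gX] face_of_imp_compact face_of_imp_convex by blast+
  have "aff_dim ?F \<le> 1"
  proof (cases "\<exists>x y. x \<in> ?F \<and> y \<in> ?F \<and> x \<noteq> y")
    case True
    then show ?thesis using ray_maximizers(2)[OF gX n d t] by blast
  next
    case False
    then obtain x where "?F = {x}" using F(2) by blast
    then show ?thesis by simp
  qed
  then obtain a b where ab: "?F = closed_segment a b" "vertices ?F = {a, b}" "aff_dim ?F = 1 \<longleftrightarrow> a \<noteq> b"
    using aff_dim_le_1_segment[OF F' F(2)] by blast
  have "a \<in> ?F" "b \<in> ?F" using ab(1) by auto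
  then have "a = b \<or> inner (facet_normal \<gamma> \<delta>) a \<noteq> inner (facet_normal \<gamma> \<delta>) b"
    using ray_maximizers(1)[OF gX n d t, of a b] by (auto simp: inner_diff_right)
  then show ?thesis
    using that[OF ab(1)] ab maximizers_vertices[OF cellD(4,2,3)[OF gX]] by simp
qed

lemma sum_cell_ray_edges:
  fixes f :: "'a \<Rightarrow> 'c::ab_group_add"
  assumes gX: "\<gamma> \<in> X" and n: "aff_dim \<gamma> = int (n + 1)" and d: "\<delta> facet_of \<gamma>"
  shows "(\<Sum>(x, y)\<in>cell_ray_edges \<gamma> \<delta>. f y - f x) = f (top_vertex \<delta>) - f (top_vertex \<gamma>)"
proof (rule sum_ray_edges)
  let ?u = "facet_normal \<gamma> \<delta>"
  show "finite (vertices \<gamma>)" by (rule finite_vertices[OF gX])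
  fix t :: real assume "t \<ge> 0"
  from ray_maximizers_segment[OF gX n d this]
  obtain a b where ab: "maximizers (vertices \<gamma>) (inner (g + t *\<^sub>R ?u)) = {a, b}"
    "a = b \<or> inner ?u a \<noteq> inner ?u b" by metis
  show "inj_on (inner ?u) (maximizers (vertices \<gamma>) (\<lambda>z. inner g z + t * inner ?u z))"
    unfolding ray_functional ab(1) using ab(2) by (auto simp: inj_on_def)
  show "card (maximizers (vertices \<gamma>) (\<lambda>z. inner g z + t * inner ?u z)) \<le> 2"
    unfolding ray_functional ab(1) by (simp add: card_insert_if)
next
  let ?u = "facet_normal \<gamma> \<delta>"
  note u = normal_facet[OF gX d]
  have dX: "\<delta> \<in> X" by (rule facet_cell[OF gX d])
  have df: "\<delta> face_of \<gamma>" using d by (simp add: facet_of_def)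
  have single: "vertices {x} = {x}" for x :: 'a
    using vertices_closed_segment[of x x] by simp
  show "maximizers (vertices \<gamma>) (inner g) = {top_vertex \<gamma>}"
    using maximizers_vertices[OF cellD(4,2,3)[OF gX]] maximizers_top_vertex[OF gX] single by simp
  have "maximizers \<gamma> (inner ?u) = \<delta>"
  proof -
    obtain x where x: "x \<in> \<delta>" using d by (auto simp: facet_of_def)
    have le: "inner ?u y \<le> inner ?u x" "inner ?u y = inner ?u x \<longleftrightarrow> y \<in> \<delta>" if "y \<in> \<gamma>" for y
    proof -
      show "inner ?u y \<le> inner ?u x"
        using u x that unfolding is_facet_normal_def by (metis diff_le_0_iff_le inner_diff_right)
      show "inner ?u y = inner ?u x \<longleftrightarrow> y \<in> \<delta>"
      proof
        assume "inner ?u y = inner ?u x"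
        then show "y \<in> \<delta>" using u x that unfolding is_facet_normal_def
          by (metis diff_self inner_diff_right)
      next
        assume "y \<in> \<delta>"
        then have "inner ?u (y - x) = 0"
          using facet_normal_orthogonal[OF u face_of_imp_subset[OF df]] diff_in_dirspace x by blast
        then show "inner ?u y = inner ?u x" by (simp add: inner_diff_right)
      qed
    qed
    have xg: "x \<in> \<gamma>" using x face_of_imp_subset[OF df] by blast
    show ?thesis
    proof (intro equalityI subsetI)
      fix y assume "y \<in> maximizers \<gamma> (inner ?u)"
      then have "y \<in> \<gamma>" "inner ?u x \<le> inner ?u y" using xg by (auto simp: maximizers_def)
      then show "y \<in> \<delta>" using le[of y] by simp
    next
      fix y assume "y \<in> \<delta>"
      then have "y \<in> \<gamma>" "inner ?u y = inner ?u x" using le(2)[of y] face_of_imp_subset[OF df] by auto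
      then show "y \<in> maximizers \<gamma> (inner ?u)" using le(1) by (simp add: maximizers_def)
    qed
  qed
  then have "maximizers (vertices \<gamma>) (inner ?u) = vertices \<delta>"
    using maximizers_vertices[OF cellD(4,2,3)[OF gX]] by simp
  then show "top_vertex \<delta> \<in> maximizers (maximizers (vertices \<gamma>) (inner ?u)) (inner g)"
    using maximizers_vertices[OF cellD(4,2,3)[OF dX]] maximizers_top_vertex[OF dX] single by simp
qed

lemma cup_pairs_iff:
  assumes gX: "\<gamma> \<in> X" and n: "aff_dim \<gamma> = int (n + 1)"
  shows "(\<delta>, \<tau>) \<in> cup_pairs n 1 \<gamma> (inner g) \<longleftrightarrow>
    \<delta> facet_of \<gamma> \<and> \<tau> face_of \<gamma> \<and> aff_dim \<tau> = 1 \<and>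
    (\<exists>t\<ge>0. \<tau> \<subseteq> maximizers \<gamma> (inner (g + t *\<^sub>R facet_normal \<gamma> \<delta>)))"
proof -
  have facet: "\<delta> facet_of \<gamma> \<longleftrightarrow> \<delta> face_of \<gamma> \<and> aff_dim \<delta> = int n"
    using n by (cases "\<delta> = {}") (auto simp: facet_of_def)
  let ?R = "restrict_functional (dirspace \<gamma>) (inner g)" and ?\<Phi> = "functional_on (dirspace \<gamma>)"
  have "(+) ?R ` dual_cone \<gamma> \<delta> \<inter> dual_cone \<gamma> \<tau> \<noteq> {} \<longleftrightarrow>
      (\<exists>t\<ge>0. \<tau> \<subseteq> maximizers \<gamma> (inner (g + t *\<^sub>R facet_normal \<gamma> \<delta>)))"
    if d: "\<delta> facet_of \<gamma>" and t: "\<tau> face_of \<gamma>"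
  proof -
    let ?u = "facet_normal \<gamma> \<delta>"
    have eq: "?R + ?\<Phi> z = ?\<Phi> (g + z)" for z
      by (auto simp: fun_eq_iff functional_on_apply restrict_functional_def inner_add_left)
    have dual: "?\<Phi> z \<in> dual_space (dirspace \<gamma>)" for z
      by (auto simp: dual_space_def functional_on_apply inner_add_right subspace_add subspace_scale)
    have mem: "?\<Phi> z \<in> dual_cone \<gamma> \<tau> \<longleftrightarrow> \<tau> \<subseteq> maximizers \<gamma> (inner z)" for z
      using dual face_of_imp_subset[OF t] diff_in_dirspace[of _ \<gamma>]
      by (auto simp: dual_cone_def maximizers_def functional_on_apply inner_diff_right subset_iff)
    have "(+) ?R ` dual_cone \<gamma> \<delta> = (\<lambda>t. ?\<Phi> (g + t *\<^sub>R ?u)) ` {0..}"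
      unfolding dual_cone_facet[OF d normal_facet[OF gX d]] image_image eq ..
    then show ?thesis using mem by auto
  qed
  then show ?thesis unfolding cup_pairs_def using facet by auto
qed

text \<open>
  A face of dimension one that is contained in the face selected at time \<open>t\<close> is equal to it, since
  the selected face has dimension at most one.
\<close>

lemma bij_betw_cell_ray_edges:
  assumes gX: "\<gamma> \<in> X" and n: "aff_dim \<gamma> = int (n + 1)" and d: "\<delta> facet_of \<gamma>"
  shows "bij_betw (\<lambda>(x, y). closed_segment x y) (cell_ray_edges \<gamma> \<delta>) {\<tau>. (\<delta>, \<tau>) \<in> cup_pairs n 1 \<gamma> (inner g)}"
proof (rule bij_betw_imageI)
  let ?u = "facet_normal \<gamma> \<delta>"
  let ?F = "\<lambda>t. maximizers \<gamma> (inner (g + t *\<^sub>R ?u))"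
  show "inj_on (\<lambda>(x, y). closed_segment x y) (cell_ray_edges \<gamma> \<delta>)"
    by (auto simp: inj_on_def ray_edges_def closed_segment_eq doubleton_eq_iff)
  show "(\<lambda>(x, y). closed_segment x y) ` cell_ray_edges \<gamma> \<delta> = {\<tau>. (\<delta>, \<tau>) \<in> cup_pairs n 1 \<gamma> (inner g)}"
  proof (intro equalityI subsetI)
    fix \<tau> assume "\<tau> \<in> (\<lambda>(x, y). closed_segment x y) ` cell_ray_edges \<gamma> \<delta>"
    then obtain x y t where xy: "\<tau> = closed_segment x y" "inner ?u x < inner ?u y" "t \<ge> 0"
        "maximizers (vertices \<gamma>) (inner (g + t *\<^sub>R ?u)) = {x, y}"
      by (auto simp: ray_edges_def ray_functional)
    obtain a b where ab: "?F t = closed_segment a b" "{x, y} = {a, b}" "aff_dim (closed_segment a b) = 1 \<longleftrightarrow> a \<noteq> b"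
      using ray_maximizers_segment[OF gX n d xy(3)] xy(4) by metis
    have "\<tau> = ?F t" using ab(1,2) xy(1) by (simp add: closed_segment_eq)
    moreover have "a \<noteq> b" using ab(2) xy(2) by (auto simp: doubleton_eq_iff)
    ultimately have "aff_dim \<tau> = 1" "\<tau> face_of \<gamma>" "\<tau> \<subseteq> ?F t"
      using ab maximizers_face(1)[OF cellD(4,2,3)[OF gX], of "g + t *\<^sub>R ?u"] by auto
    then show "\<tau> \<in> {\<tau>. (\<delta>, \<tau>) \<in> cup_pairs n 1 \<gamma> (inner g)}"
      using cup_pairs_iff[OF gX n] d xy(3) by blast
  next
    fix \<tau> assume "\<tau> \<in> {\<tau>. (\<delta>, \<tau>) \<in> cup_pairs n 1 \<gamma> (inner g)}"
    then obtain t where t: "\<tau> face_of \<gamma>" "aff_dim \<tau> = 1" "t \<ge> 0" "\<tau> \<subseteq> ?F t"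
      using cup_pairs_iff[OF gX n] by auto
    obtain a b where ab: "?F t = closed_segment a b" "maximizers (vertices \<gamma>) (inner (g + t *\<^sub>R ?u)) = {a, b}"
        "aff_dim (closed_segment a b) = 1 \<longleftrightarrow> a \<noteq> b" "a = b \<or> inner ?u a \<noteq> inner ?u b"
      using ray_maximizers_segment[OF gX n d t(3)] .
    have "aff_dim (closed_segment a b) \<le> 1"
      unfolding segment_convex_hull by (simp add: aff_dim_convex_hull aff_dim_2)
    then have ad: "aff_dim (?F t) = 1" using aff_dim_subset[OF t(4)] t(2) ab(1) by simp
    have Ff: "?F t face_of \<gamma>" by (rule maximizers_face(1)[OF cellD(4,2,3)[OF gX]])
    have "\<tau> face_of ?F t" by (rule face_of_subset[OF t(1,4) face_of_imp_subset[OF Ff]])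
    then have eq: "\<tau> = closed_segment a b"
      using face_of_same_aff_dim[OF face_of_imp_convex[OF Ff]] ad t(2) ab(1) by simp
    have mem: "a \<in> vertices \<gamma>" "b \<in> vertices \<gamma>" using ab(2) by (auto simp: maximizers_def)
    have "inner ?u a \<noteq> inner ?u b" using ab(1,3,4) ad by auto
    then have "(a, b) \<in> cell_ray_edges \<gamma> \<delta> \<or> (b, a) \<in> cell_ray_edges \<gamma> \<delta>"
      using ab(2) t(3) mem by (auto simp: ray_edges_def ray_functional insert_commute)
    then show "\<tau> \<in> (\<lambda>(x, y). closed_segment x y) ` cell_ray_edges \<gamma> \<delta>"
    proof
      assume "(a, b) \<in> cell_ray_edges \<gamma> \<delta>"
      then show ?thesis by (rule rev_image_eqI) (simp add: eq)
    next
      assume "(b, a) \<in> cell_ray_edges \<gamma> \<delta>"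
      then show ?thesis by (rule rev_image_eqI) (simp only: eq prod.case closed_segment_commute[of a b])
    qed
  qed
qed

text \<open>
  This replaces the connectedness of the graph of a polytope. By induction on the dimension, a
  vertex in a facet \<open>\<delta>\<close> has the same value as the top vertex of \<open>\<delta>\<close>, and the edges crossed by the
  ray of \<open>\<delta>\<close> lead from there to the top vertex of \<open>\<gamma>\<close>.
\<close>

lemma edge_constant_imp_vertex_constant:
  fixes f :: "'a \<Rightarrow> 'c::ab_group_add"
  assumes gX: "\<gamma> \<in> X"
    and f: "\<And>x y. closed_segment x y face_of \<gamma> \<Longrightarrow> f x = f y"
    and x: "x \<in> vertices \<gamma>"
  shows "f x = f (top_vertex \<gamma>)"
  using assms
proof (induction "dim (dirspace \<gamma>)" arbitrary: \<gamma>)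
  case 0
  then have "aff_dim \<gamma> = 0" using aff_dim_eq_dim_dirspace[OF cellD(3)[OF 0(2)]] by simp
  then obtain a where "\<gamma> = {a}" using aff_dim_eq_0 by blast
  moreover have "x \<in> \<gamma>" "top_vertex \<gamma> \<in> \<gamma>"
    using 0(4) top_vertex_in_vertices[OF 0(2)] vertices_subset[of \<gamma>] by auto
  ultimately show ?case by simp
next
  case (Suc n)
  then have n: "aff_dim \<gamma> = int (n + 1)" using aff_dim_eq_dim_dirspace[OF cellD(3)[OF Suc.prems(1)]] Suc.hyps(2) by simp
  note gX = Suc.prems(1)
  have "{x} face_of \<gamma>" "{x} \<noteq> \<gamma>"
    using Suc.prems(3) n by (auto simp: vertices_def face_of_singleton)
  then obtain \<delta> where d: "\<delta> facet_of \<gamma>" "x \<in> \<delta>"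
    using face_of_polyhedron_subset_facet[OF cellD(1)[OF gX], of "{x}"] by auto
  have dX: "\<delta> \<in> X" by (rule facet_cell[OF gX d(1)])
  have df: "\<delta> face_of \<gamma>" and ad: "aff_dim \<delta> = int n" using d n by (auto simp: facet_of_def)
  have "f x = f (top_vertex \<delta>)"
  proof (rule Suc.hyps(1)[OF _ dX])
    show "n = dim (dirspace \<delta>)" using ad aff_dim_eq_dim_dirspace[OF cellD(3)[OF dX]] by simp
    show "f x = f y" if "closed_segment x y face_of \<delta>" for x y
      using Suc.prems(2) face_of_trans[OF that df] by blast
    show "x \<in> vertices \<delta>" using Suc.prems(3) d vertices_face[OF df] by simp
  qed
  also have "f (top_vertex \<delta>) - f (top_vertex \<gamma>) = 0"
  proof -
    have "f y - f x = 0" if "(x, y) \<in> cell_ray_edges \<gamma> \<delta>" for x y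
    proof -
      have "(\<delta>, closed_segment x y) \<in> cup_pairs n 1 \<gamma> (inner g)"
        using bij_betw_imp_surj_on[OF bij_betw_cell_ray_edges[OF gX n d(1)]] that by force
      then have "closed_segment x y face_of \<gamma>" using cup_pairs_iff[OF gX n] by blast
      then show ?thesis using Suc.prems(2)[of x y] by simp
    qed
    then have "(\<Sum>(x, y)\<in>cell_ray_edges \<gamma> \<delta>. f y - f x) = 0" by (intro sum.neutral) auto
    then show ?thesis using sum_cell_ray_edges[OF gX n d(1), of f] by simp
  qed
  then have "f (top_vertex \<delta>) = f (top_vertex \<gamma>)" by simp
  finally show ?case .
qed

end

section \<open>The value of the iterated product on a cell\<close>

subsection \<open>Signs of bases with a varying last vector\<close>

text \<open>
  The determinant of the change from \<open>b @ [u]\<close> to \<open>b @ [e]\<close> is the coefficient \<open>\<langle>u, e\<rangle>\<close> of \<open>u\<close> in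
  \<open>e\<close>.
\<close>

lemma sign_snoc:
  fixes \<gamma> :: "'a::euclidean_space set"
  assumes d: "\<delta> facet_of \<gamma>" and u: "is_facet_normal \<gamma> \<delta> u" and b: "ordered_basis (dirspace \<delta>) b"
    and e: "e \<in> dirspace \<gamma>" "inner u e > 0"
  shows "ordered_basis (dirspace \<gamma>) (b @ [e])"
    and "orientation (dirspace \<gamma>) ori \<Longrightarrow> ori (b @ [e]) = ori (b @ [u])"
proof -
  have sub: "\<delta> \<subseteq> \<gamma>" and ne: "\<delta> \<noteq> {}" "\<gamma> \<noteq> {}" and ad: "aff_dim \<delta> = aff_dim \<gamma> - 1"
    using d facet_of_imp_subset[OF d] unfolding facet_of_def by auto
  have dims: "dim (dirspace \<gamma>) = Suc (dim (dirspace \<delta>))"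
    using ad aff_dim_eq_dim_dirspace[OF ne(1)] aff_dim_eq_dim_dirspace[OF ne(2)] by simp
  have basis: "ordered_basis (dirspace \<gamma>) (b @ [c])" if "c \<in> dirspace \<gamma>" "inner u c \<noteq> 0" for c
    using ordered_basis_snoc[OF b _ dirspace_mono[OF sub] that(1) _ dims]
      facet_normal_orthogonal[OF u sub, of c] that(2) by auto
  show be: "ordered_basis (dirspace \<gamma>) (b @ [e])" using basis e by simp
  have uu: "inner u u = 1" "u \<in> dirspace \<gamma>" using u by (auto simp: is_facet_normal_def dot_square_norm)
  then have bu: "ordered_basis (dirspace \<gamma>) (b @ [u])" using basis by simp
  note B = ordered_basisD[OF bu]
  have "representation (set (b @ [u])) e u = inner u e"
  proof -
    define w where "w = e - inner u e *\<^sub>R u"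
    have w: "w \<in> dirspace \<delta>" unfolding w_def by (rule facet_normal_decomp[OF u d e(1)])
    then have "representation (set (b @ [u])) w = representation (set b) w"
      using B ordered_basisD[OF b] by (intro real_vector.representation_extend) auto
    moreover have "representation (set b) w u = 0"
      using real_vector.representation_ne_zero[of "set b" w u] B(1) by auto
    moreover have "e = w + inner u e *\<^sub>R u" by (simp add: w_def)
    moreover have "representation (set (b @ [u])) (w + inner u e *\<^sub>R u) u =
        representation (set (b @ [u])) w u + inner u e * representation (set (b @ [u])) u u"
    proof -
      have "w \<in> span (set (b @ [u]))" "u \<in> span (set (b @ [u]))"
        using B(3) w uu(2) dirspace_mono[OF sub] by auto
      then show ?thesis
        using real_vector.representation_add[OF B(2)] real_vector.representation_scale[OF B(2)]
        by (simp only: span_scale)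
    qed
    moreover have "representation (set (b @ [u])) u u = 1"
      using B(2) by (simp add: real_vector.representation_basis)
    ultimately show ?thesis by simp
  qed
  then have "basis_change_det (b @ [u]) (b @ [e]) = inner u e"
    using basis_change_det_snoc[OF b b bu, of e] basis_change_det_self[OF b] by simp
  then show "ori (b @ [e]) = ori (b @ [u])" if "orientation (dirspace \<gamma>) ori"
    using that bu be e(2) unfolding orientation_def by (metis mult_1 sgn_pos)
qed

lemma orthonormal_basis_snoc:
  fixes \<gamma> :: "'a::euclidean_space set"
  assumes d: "\<delta> facet_of \<gamma>" and u: "is_facet_normal \<gamma> \<delta> u" and b: "orthonormal_basis (dirspace \<delta>) b"
  shows "orthonormal_basis (dirspace \<gamma>) (b @ [u])"
proof -
  have ob: "ordered_basis (dirspace \<delta>) b" using b by (simp add: orthonormal_basis_def)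
  have uu: "inner u u = 1" "u \<in> dirspace \<gamma>" using u by (auto simp: is_facet_normal_def dot_square_norm)
  have "inner u (b ! i) = 0" if "i < length b" for i
    using facet_normal_orthogonal[OF u facet_of_imp_subset[OF d], of "b ! i"] ordered_basisD(5)[OF ob] that
    by (auto simp: subset_iff)
  then have "\<forall>i<length (b @ [u]). \<forall>j<length (b @ [u]).
      inner ((b @ [u]) ! i) ((b @ [u]) ! j) = (if i = j then 1 else 0)"
    using b uu by (auto simp: orthonormal_basis_def nth_append less_Suc_eq inner_commute)
  then show ?thesis
    using sign_snoc(1)[OF d u ob uu(2)] uu(1) by (simp add: orthonormal_basis_def)
qed

text \<open>
  The component of \<open>w\<close> in \<open>dirspace \<delta>\<close> is a combination of vectors of \<open>b\<close> and dies in the product.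
\<close>

lemma wedge_mult_ext_incl:
  fixes \<gamma> :: "'a::euclidean_space set"
  assumes d: "\<delta> facet_of \<gamma>" and u: "is_facet_normal \<gamma> \<delta> u" and b: "ordered_basis (dirspace \<delta>) b"
    and w: "w \<in> dirspace \<gamma>"
  shows "wedge b * ext_incl w = inner u w *\<^sub>R wedge (b @ [u])"
proof -
  define e where "e = w - inner u w *\<^sub>R u"
  have e: "e \<in> dirspace \<delta>" unfolding e_def by (rule facet_normal_decomp[OF u d w])
  have "dirspace \<delta> \<subseteq> {e. wedge b * ext_incl e = 0}"
  proof -
    have "wedge b * ext_incl x = 0" if x: "x \<in> set b" for x
    proof -
      obtain us vs where "b = us @ x # vs" using split_list[OF x] by blast
      then show ?thesis using wedge_repeated[of us x vs "[]"] by (simp add: mult.assoc)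
    qed
    then have "span (set b) \<subseteq> {e. wedge b * ext_incl e = 0}"
      by (intro span_minimal)
        (auto simp: subspace_def ext_incl_add ext_incl_scaleR distrib_left linear_0[OF linear_ext_incl])
    then show ?thesis using ordered_basisD(3)[OF b] by simp
  qed
  then have "wedge b * ext_incl e = 0" using e by blast
  moreover have "ext_incl w = ext_incl e + inner u w *\<^sub>R ext_incl u"
    unfolding ext_incl_scaleR[symmetric] ext_incl_add[symmetric] by (simp add: e_def)
  ultimately show ?thesis by (simp add: distrib_left)
qed

subsection \<open>One-dimensional cells\<close>

lemma dirspace_closed_segment: "dirspace (closed_segment p q) = span {q - p}"
proof (rule antisym)
  show "dirspace (closed_segment p q) \<subseteq> span {q - p}"
  proof (rule dirspace_subset)
    fix x y assume "x \<in> closed_segment p q" "y \<in> closed_segment p q"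
    then obtain s t where xy: "x = (1 - s) *\<^sub>R p + s *\<^sub>R q" "y = (1 - t) *\<^sub>R p + t *\<^sub>R q"
      by (auto simp: closed_segment_def)
    have "x - y = (s - t) *\<^sub>R (q - p)" unfolding xy by (simp add: algebra_simps)
    then show "x - y \<in> span {q - p}" by (simp add: span_base span_scale)
  qed simp
  show "span {q - p} \<subseteq> dirspace (closed_segment p q)"
    by (rule span_minimal) (auto intro: diff_in_dirspace)
qed

lemma ordered_basis_segment:
  assumes "p \<noteq> q" "k \<noteq> 0"
  shows "ordered_basis (dirspace (closed_segment p q)) [k *\<^sub>R (q - p)]"
proof -
  have "span {k *\<^sub>R (q - p)} = span {q - p}"
    using assms(2) span_image_scale[of "{q - p}" "\<lambda>_. k"] by simp
  then show ?thesis using assms by (simp add: ordered_basis_def dirspace_closed_segment)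
qed

lemma orientation_scale:
  assumes ori: "orientation W ori" and w: "ordered_basis W [w]" and k: "ordered_basis W [k *\<^sub>R w]"
  shows "ori [k *\<^sub>R w] = sgn k * ori [w]"
proof -
  have "basis_change_det [w] [k *\<^sub>R w] = representation {w} (k *\<^sub>R w) w"
    unfolding basis_change_det_def by (subst det_single) auto
  also have "\<dots> = k"
    using ordered_basisD(2)[OF w]
    by (simp add: real_vector.representation_scale real_vector.representation_basis span_base)
  finally show ?thesis using ori w k unfolding orientation_def by metis
qed

lemma orientation_values:
  assumes "orientation W ori" "ordered_basis W b" shows "ori b = 1 \<or> ori b = -1"
  using assms unfolding orientation_def by blast

lemma ordered_basis_zero_iff: "ordered_basis {0} b \<longleftrightarrow> b = []"
proof
  assume b: "ordered_basis {0} b"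
  then have "set b \<subseteq> {0}" "0 \<notin> set b"
    using ordered_basisD[OF b] dependent_zero by auto
  then show "b = []" by (cases b) auto
qed (simp add: ordered_basis_def real_vector.independent_empty)

lemma dirspace_singleton: "dirspace {q} = {0}"
  by (simp add: dirspace_def)

lemma facets_segment:
  fixes p q :: "'a::euclidean_space"
  assumes "p \<noteq> q"
  shows "{\<tau>. \<tau> facet_of closed_segment p q} = {{p}, {q}}"
proof -
  have ad: "aff_dim (closed_segment p q) = 1"
    using assms unfolding segment_convex_hull by (simp add: aff_dim_convex_hull aff_dim_2)
  have sing: "{x} face_of closed_segment p q \<longleftrightarrow> x = p \<or> x = q" for x
    by (simp add: face_of_singleton extreme_point_of_segment)
  have "\<tau> facet_of closed_segment p q \<longleftrightarrow> \<tau> = {p} \<or> \<tau> = {q}" for \<tau>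
  proof
    assume t: "\<tau> facet_of closed_segment p q"
    then have "aff_dim \<tau> = 0" using ad by (simp add: facet_of_def)
    then obtain x where "\<tau> = {x}" using aff_dim_eq_0 by blast
    then show "\<tau> = {p} \<or> \<tau> = {q}" using t sing by (auto simp: facet_of_def)
  next
    assume "\<tau> = {p} \<or> \<tau> = {q}"
    then show "\<tau> facet_of closed_segment p q" using sing ad by (auto simp: facet_of_def)
  qed
  then show ?thesis by auto
qed

lemma facet_normal_segment:
  fixes p q :: "'a::euclidean_space"
  assumes "p \<noteq> q"
  shows "facet_normal (closed_segment p q) {q} = (q - p) /\<^sub>R norm (q - p)"
proof (rule facet_normal_eqI)
  show "{q} facet_of closed_segment p q" using facets_segment[OF assms] by auto
  have pos: "inner (q - p) (q - p) > 0" "norm (q - p) > 0" using assms by auto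
  have "inner (q - p) (y - q) \<le> 0 \<and> (inner (q - p) (y - q) = 0 \<longrightarrow> y = q)"
    if y: "y \<in> closed_segment p q" for y
  proof -
    obtain t where t: "y = (1 - t) *\<^sub>R p + t *\<^sub>R q" "0 \<le> t" "t \<le> 1"
      using y by (auto simp: closed_segment_def)
    then have yq: "y - q = (t - 1) *\<^sub>R (q - p)" by (simp add: algebra_simps)
    have "inner (q - p) (y - q) = (t - 1) * inner (q - p) (q - p)" unfolding yq by (rule inner_scaleR_right)
    moreover have "(t - 1) * inner (q - p) (q - p) \<le> 0" using t pos(1) by (intro mult_nonpos_nonneg) auto
    moreover have "(t - 1) * inner (q - p) (q - p) = 0 \<Longrightarrow> t = 1" using pos(1) by simp
    ultimately show ?thesis using t by auto
  qed
  then show "is_facet_normal (closed_segment p q) {q} ((q - p) /\<^sub>R norm (q - p))"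
    using pos(2) by (auto simp: is_facet_normal_def dirspace_closed_segment span_base span_scale mult_le_0_iff)
qed

text \<open>
  The vector chosen in the definition of the boundary orientation is a positive multiple of \<open>q - p\<close>,
  whatever point of the edge it starts from.
\<close>

lemma outward_segment:
  fixes p q :: "'a::euclidean_space"
  assumes "p \<noteq> q"
  shows "\<exists>k>0. (SOME n. outward (closed_segment p q) {q} n) = k *\<^sub>R (q - p)"
proof -
  have "outward (closed_segment p q) {q} (q - p)" using assms by (auto simp: outward_def)
  then have "outward (closed_segment p q) {q} (SOME n. outward (closed_segment p q) {q} n)" by (rule someI)
  then obtain z where z: "z \<in> closed_segment p q" "z \<noteq> q"
      "(SOME n. outward (closed_segment p q) {q} n) = q - z"
    unfolding outward_def by auto
  then obtain t where t: "z = (1 - t) *\<^sub>R p + t *\<^sub>R q" "t \<le> 1"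
    by (auto simp: closed_segment_def)
  then have "q - z = (1 - t) *\<^sub>R (q - p)" by (simp add: algebra_simps)
  moreover have "t \<noteq> 1" using t z(2) by auto
  ultimately show ?thesis using t(2) z(3) by (intro exI[of _ "1 - t"]) auto
qed

context convenient_complex
begin

lemma vertex_cell: "\<gamma> \<in> X \<Longrightarrow> x \<in> vertices \<gamma> \<Longrightarrow> {x} \<in> X"
  using face_cell by (auto simp: vertices_def face_of_singleton)

lemma vertex_cochain_boundary:
  assumes X: "closed_segment p q \<in> X" and pq: "p \<noteq> q" and ori: "orientation (dirspace (closed_segment p q)) ori"
  shows "vertex_cochain X a {q} (boundary_orientation (closed_segment p q) {q} ori) = ori [q - p] *\<^sub>R ext_incl (a q)"
proof -
  let ?\<gamma> = "closed_segment p q"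
  obtain k where k: "k > 0" "(SOME n. outward ?\<gamma> {q} n) = k *\<^sub>R (q - p)" using outward_segment[OF pq] by blast
  have "ori [k *\<^sub>R (q - p)] = ori [q - p]"
    using orientation_scale[OF ori, of "q - p" k] ordered_basis_segment[OF pq, of 1] ordered_basis_segment[OF pq, of k] k
    by simp
  then have bo: "boundary_orientation ?\<gamma> {q} ori = (\<lambda>b. if b = [] then ori [q - p] else 0)"
    by (auto simp: boundary_orientation_def dirspace_singleton ordered_basis_zero_iff k fun_eq_iff)
  have "ori [q - p] = 1 \<or> ori [q - p] = -1"
    using orientation_values[OF ori] ordered_basis_segment[OF pq, of 1] by simp
  moreover have "basis_change_det [] ([] :: 'a list) = 1"
    using basis_change_det_self[of "{0 :: 'a}" "[]"] by (simp add: ordered_basis_zero_iff)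
  ultimately have "orientation {0} (\<lambda>b :: 'a list. if b = [] then ori [q - p] else 0)"
    by (auto simp: orientation_def ordered_basis_zero_iff)
  moreover have "{q} \<in> X"
    using vertex_cell[OF X] by (simp add: vertices_closed_segment)
  ultimately have "oriented_cell X 0 {q} (boundary_orientation ?\<gamma> {q} ori)"
    by (simp add: oriented_cell_def bo dirspace_singleton)
  then show ?thesis by (simp add: vertex_cochain_def bo)
qed

lemma aff_dim_segment: "p \<noteq> q \<Longrightarrow> aff_dim (closed_segment p q) = 1" for p q :: 'a
  unfolding segment_convex_hull by (simp add: aff_dim_convex_hull aff_dim_2)

lemma coboundary_vertex_cochain:
  assumes X: "closed_segment p q \<in> X" and pq: "p \<noteq> q" and ori: "orientation (dirspace (closed_segment p q)) ori"
  shows "coboundary X 0 (vertex_cochain X a) (closed_segment p q) ori = ori [q - p] *\<^sub>R ext_incl (a q - a p)"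
proof -
  let ?\<gamma> = "closed_segment p q"
  have oc: "oriented_cell X (0 + 1) ?\<gamma> ori"
    using X ori aff_dim_segment[OF pq] by (simp add: oriented_cell_def)
  have "ori [p - q] = - ori [q - p]"
    using orientation_scale[OF ori, of "q - p" "-1"] ordered_basis_segment[OF pq, of 1] ordered_basis_segment[OF pq, of "-1"]
    by simp
  moreover have "vertex_cochain X a {p} (boundary_orientation ?\<gamma> {p} ori) = ori [p - q] *\<^sub>R ext_incl (a p)"
    using vertex_cochain_boundary[of q p ori a] X pq ori by (simp add: closed_segment_commute)
  ultimately show ?thesis
    unfolding coboundary_def if_P[OF oc] facets_segment[OF pq]
    using vertex_cochain_boundary[OF X pq ori, of a] pq
    by (simp add: linear_diff[OF linear_ext_incl] algebra_simps)
qed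

definition edge_parallel :: "('a \<Rightarrow> 'a) \<Rightarrow> bool"
  where "edge_parallel a \<longleftrightarrow> (\<forall>x y. closed_segment x y \<in> X \<longrightarrow> a y - a x \<in> span {y - x})"

text \<open>
  On an edge the value of the coboundary is the difference of the values at its ends, up to sign.
\<close>

lemma edge_parallel_if_R_cocycle:
  assumes "coboundary X 0 (vertex_cochain X a) \<in> R_cocycles X 1"
  shows "edge_parallel a"
  unfolding edge_parallel_def
proof (intro allI impI)
  fix x y assume X: "closed_segment x y \<in> X"
  show "a y - a x \<in> span {y - x}"
  proof (cases "x = y")
    case False
    let ?W = "dirspace (closed_segment x y)"
    have bas: "ordered_basis ?W [y - x]" using ordered_basis_segment[OF False, of 1] by simp
    obtain ori where ori: "orientation ?W ori"
      using orientation_from_basis[OF bas, of 1] by auto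
    have "oriented_cell X 1 (closed_segment x y) ori"
      using X ori aff_dim_segment[OF False] by (simp add: oriented_cell_def)
    then have "coboundary X 0 (vertex_cochain X a) (closed_segment x y) ori \<in> ext_power 1 ?W"
      using assms unfolding R_cocycles_def by blast
    then have "ori [y - x] *\<^sub>R ext_incl (a y - a x) \<in> ext_power 1 ?W"
      unfolding coboundary_vertex_cochain[OF X False ori] .
    then have "ori [y - x] *\<^sub>R ori [y - x] *\<^sub>R ext_incl (a y - a x) \<in> ext_power 1 ?W"
      unfolding ext_power_def by (rule span_scale)
    then have "ext_incl (a y - a x) \<in> ext_power 1 ?W"
      using orientation_values[OF ori bas] by auto
    then have "a y - a x \<in> ?W" by (intro ext_incl_in_ext_power_1) auto
    then show ?thesis by (simp add: dirspace_closed_segment)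
  qed simp
qed

subsection \<open>Sums over vertices and facets\<close>

text \<open>
  This makes \<open>\<langle>u, a(x)\<rangle>\<close>, for the normal \<open>u\<close> of a facet, a number attached to the facet: the value
  of the support function of the virtual polytope given by \<open>a\<close>.
\<close>

lemma inner_edge_parallel_constant:
  assumes gX: "\<gamma> \<in> X" and a: "edge_parallel a" and w: "\<And>e. e \<in> dirspace \<gamma> \<Longrightarrow> inner w e = 0"
    and x: "x \<in> vertices \<gamma>"
  shows "inner w (a x) = inner w (a (top_vertex \<gamma>))"
proof (rule edge_constant_imp_vertex_constant[OF gX _ x])
  fix x y assume f: "closed_segment x y face_of \<gamma>"
  then have "closed_segment x y \<in> X" by (intro face_cell[OF gX]) auto
  then have "a y - a x \<in> span {y - x}" using a by (simp add: edge_parallel_def)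
  moreover have "inner w (y - x) = 0"
    using face_of_imp_subset[OF f] by (intro w diff_in_dirspace) auto
  ultimately have "inner w (a y - a x) = 0" by (auto simp: span_singleton)
  then show "inner w (a x) = inner w (a y)" by (simp add: inner_diff_right)
qed

lemma sum_flag_form_Cons:
  assumes gX: "\<gamma> \<in> X"
  shows "(\<Sum>x\<in>vertices \<gamma>. flag_form \<gamma> x (h x # ws x)) =
    (\<Sum>\<delta> | \<delta> facet_of \<gamma>. \<Sum>x\<in>vertices \<delta>. inner (facet_normal \<gamma> \<delta>) (h x) * flag_form \<delta> x (ws x))"
proof -
  let ?t = "\<lambda>x \<delta>. inner (facet_normal \<gamma> \<delta>) (h x) * flag_form \<delta> x (ws x)"
  have "(\<Sum>x\<in>vertices \<gamma>. flag_form \<gamma> x (h x # ws x)) =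
      (\<Sum>x\<in>vertices \<gamma>. \<Sum>\<delta> | \<delta> \<in> {\<delta>. \<delta> facet_of \<gamma>} \<and> x \<in> \<delta>. ?t x \<delta>)"
    by (simp add: inner_commute)
  also have "\<dots> = (\<Sum>\<delta> | \<delta> facet_of \<gamma>. \<Sum>x | x \<in> vertices \<gamma> \<and> x \<in> \<delta>. ?t x \<delta>)"
    by (rule sum.swap_restrict[OF finite_vertices[OF gX] finite_facets[OF gX]])
  also have "\<dots> = (\<Sum>\<delta> | \<delta> facet_of \<gamma>. \<Sum>x\<in>vertices \<delta>. ?t x \<delta>)"
  proof (rule sum.cong[OF refl])
    fix \<delta> assume "\<delta> \<in> {\<delta>. \<delta> facet_of \<gamma>}"
    then have "vertices \<delta> = {x. x \<in> vertices \<gamma> \<and> x \<in> \<delta>}"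
      using vertices_face[of \<delta> \<gamma>] by (auto simp: facet_of_def)
    then show "(\<Sum>x | x \<in> vertices \<gamma> \<and> x \<in> \<delta>. ?t x \<delta>) = (\<Sum>x\<in>vertices \<delta>. ?t x \<delta>)" by simp
  qed
  finally show ?thesis .
qed

definition flag_sum :: "'a set \<Rightarrow> ('a \<Rightarrow> 'a) list \<Rightarrow> real"
  where "flag_sum \<gamma> as = (\<Sum>x\<in>vertices \<gamma>. flag_form \<gamma> x (map (\<lambda>a. a x) as))"

lemma segment_cell:
  assumes gX: "\<gamma> \<in> X" and "aff_dim \<gamma> = 1"
  obtains p q where "\<gamma> = closed_segment p q" "p \<noteq> q"
proof -
  obtain p q where "\<gamma> = closed_segment p q" "aff_dim \<gamma> = 1 \<longleftrightarrow> p \<noteq> q"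
    by (rule aff_dim_le_1_segment[OF cellD(4,2,3)[OF gX]]) (use assms(2) in auto)
  then show ?thesis using that assms(2) by blast
qed

lemma sum_flag_form_segment:
  fixes p q :: 'a
  assumes X: "closed_segment p q \<in> X" and pq: "p \<noteq> q"
  shows "(\<Sum>x\<in>vertices (closed_segment p q). flag_form (closed_segment p q) x [h x]) =
    inner ((q - p) /\<^sub>R norm (q - p)) (h q - h p)"
proof -
  have "facet_normal (closed_segment p q) {p} = - ((q - p) /\<^sub>R norm (q - p))"
    using facet_normal_segment[of q p] pq
    by (simp add: closed_segment_commute norm_minus_commute scaleR_minus_right[symmetric])
  moreover have "vertices {x} = {x}" for x :: 'a using vertices_closed_segment[of x x] by simp
  ultimately show ?thesis
    unfolding sum_flag_form_Cons[OF X] facets_segment[OF pq]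
    using pq facet_normal_segment[OF pq] by (simp add: inner_diff_right)
qed

text \<open>
  In the last place the constant vector is paired with the two opposite unit vectors of each edge,
  and all other factors agree at the two ends of the edge.
\<close>

lemma sum_flag_form_constant_last:
  assumes "\<gamma> \<in> X" "aff_dim \<gamma> = int (Suc (length as))" "\<And>a. a \<in> set as \<Longrightarrow> edge_parallel a"
  shows "(\<Sum>x\<in>vertices \<gamma>. flag_form \<gamma> x (map (\<lambda>a. a x) as @ [c])) = 0"
  using assms
proof (induction as arbitrary: \<gamma>)
  case Nil
  obtain p q where "\<gamma> = closed_segment p q" "p \<noteq> q"
    using segment_cell[OF Nil(1)] Nil(2) by auto
  then show ?case using sum_flag_form_segment[of p q "\<lambda>_. c"] Nil(1) by simp
next
  case (Cons a as)
  note gX = Cons.prems(1)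
  have "(\<Sum>x\<in>vertices \<delta>. inner (facet_normal \<gamma> \<delta>) (a x) * flag_form \<delta> x (map (\<lambda>a. a x) as @ [c])) = 0"
    if d: "\<delta> facet_of \<gamma>" for \<delta>
  proof -
    have dX: "\<delta> \<in> X" by (rule facet_cell[OF gX d])
    have const: "inner (facet_normal \<gamma> \<delta>) (a x) = inner (facet_normal \<gamma> \<delta>) (a (top_vertex \<delta>))"
      if "x \<in> vertices \<delta>" for x
      using inner_edge_parallel_constant[OF dX _ _ that] Cons.prems(3)[of a]
        facet_normal_orthogonal[OF normal_facet[OF gX d] facet_of_imp_subset[OF d]] by simp
    have "(\<Sum>x\<in>vertices \<delta>. inner (facet_normal \<gamma> \<delta>) (a x) * flag_form \<delta> x (map (\<lambda>a. a x) as @ [c])) =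
        inner (facet_normal \<gamma> \<delta>) (a (top_vertex \<delta>)) * (\<Sum>x\<in>vertices \<delta>. flag_form \<delta> x (map (\<lambda>a. a x) as @ [c]))"
      unfolding sum_distrib_left by (rule sum.cong[OF refl]) (simp only: const)
    also have "\<dots> = 0"
      using Cons.IH[OF dX] Cons.prems(2,3) d by (simp add: facet_of_def)
    finally show ?thesis .
  qed
  then show ?case
    using sum_flag_form_Cons[OF gX, of a "\<lambda>x. map (\<lambda>a. a x) as @ [c]"] by (simp add: sum.neutral)
qed

text \<open>
  By symmetry the constant vector may be moved from the first place of the flag form to the last
  one.
\<close>

lemma minkowski_relation:
  assumes gX: "\<gamma> \<in> X" and n: "aff_dim \<gamma> = int (Suc (length as))" and as: "\<And>a. a \<in> set as \<Longrightarrow> edge_parallel a"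
  shows "(\<Sum>\<delta> | \<delta> facet_of \<gamma>. inner (facet_normal \<gamma> \<delta>) c * flag_sum \<delta> as) = 0"
proof -
  have "(\<Sum>\<delta> | \<delta> facet_of \<gamma>. inner (facet_normal \<gamma> \<delta>) c * flag_sum \<delta> as) =
      (\<Sum>x\<in>vertices \<gamma>. flag_form \<gamma> x (c # map (\<lambda>a. a x) as))"
    unfolding sum_flag_form_Cons[OF gX, of "\<lambda>_. c"] by (simp add: flag_sum_def sum_distrib_left)
  also have "\<dots> = (\<Sum>x\<in>vertices \<gamma>. flag_form \<gamma> x (map (\<lambda>a. a x) as @ [c]))"
    using flag_form_move_to_end[OF cellD(1)[OF gX], of _ "[]" c] by simp
  finally show ?thesis using sum_flag_form_constant_last[OF gX n as] by simp
qed

text \<open>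
  In the facet \<open>\<delta>\<close> the value at the top vertex represents the values at all vertices.
\<close>

lemma flag_sum_Cons:
  assumes gX: "\<gamma> \<in> X" and a: "edge_parallel a"
  shows "flag_sum \<gamma> (a # as) =
    (\<Sum>\<delta> | \<delta> facet_of \<gamma>. inner (facet_normal \<gamma> \<delta>) (a (top_vertex \<delta>)) * flag_sum \<delta> as)"
proof -
  have "flag_sum \<gamma> (a # as) = (\<Sum>\<delta> | \<delta> facet_of \<gamma>. \<Sum>x\<in>vertices \<delta>.
      inner (facet_normal \<gamma> \<delta>) (a x) * flag_form \<delta> x (map (\<lambda>a. a x) as))"
    unfolding flag_sum_def list.map by (rule sum_flag_form_Cons[OF gX])
  also have "\<dots> = (\<Sum>\<delta> | \<delta> facet_of \<gamma>. inner (facet_normal \<gamma> \<delta>) (a (top_vertex \<delta>)) * flag_sum \<delta> as)"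
  proof (rule sum.cong[OF refl])
    fix \<delta> assume "\<delta> \<in> {\<delta>. \<delta> facet_of \<gamma>}"
    then have d: "\<delta> facet_of \<gamma>" by simp
    have "inner (facet_normal \<gamma> \<delta>) (a x) = inner (facet_normal \<gamma> \<delta>) (a (top_vertex \<delta>))"
      if "x \<in> vertices \<delta>" for x
      using inner_edge_parallel_constant[OF facet_cell[OF gX d] a _ that]
        facet_normal_orthogonal[OF normal_facet[OF gX d] facet_of_imp_subset[OF d]] by simp
    then show "(\<Sum>x\<in>vertices \<delta>. inner (facet_normal \<gamma> \<delta>) (a x) * flag_form \<delta> x (map (\<lambda>a. a x) as)) =
        inner (facet_normal \<gamma> \<delta>) (a (top_vertex \<delta>)) * flag_sum \<delta> as"
      unfolding flag_sum_def sum_distrib_left by (intro sum.cong) simp_all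
  qed
  finally show ?thesis .
qed

subsection \<open>The product as a sum over flags\<close>

text \<open>
  The first step of the induction: on an edge with unit vector \<open>w\<close> the difference of \<open>a\<close> at the ends
  is \<open>\<langle>w, a(q) - a(p)\<rangle> w\<close>.
\<close>

lemma coboundary_edge:
  assumes gX: "\<gamma> \<in> X" and n: "aff_dim \<gamma> = 1" and ori: "orientation (dirspace \<gamma>) ori"
    and b: "orthonormal_basis (dirspace \<gamma>) b" and a: "edge_parallel a"
  shows "coboundary X 0 (vertex_cochain X a) \<gamma> ori = flag_sum \<gamma> [a] *\<^sub>R ori b *\<^sub>R wedge b"
proof -
  obtain p q where pq: "\<gamma> = closed_segment p q" "p \<noteq> q" using segment_cell[OF gX n] .
  define w where "w = (q - p) /\<^sub>R norm (q - p)"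
  have bas: "ordered_basis (dirspace \<gamma>) [q - p]" "ordered_basis (dirspace \<gamma>) [w]"
    using ordered_basis_segment[OF pq(2), of 1] ordered_basis_segment[OF pq(2), of "inverse (norm (q - p))"] pq
    by (simp_all add: w_def)
  have w: "norm w = 1" using pq(2) by (simp add: w_def)
  have bw: "orthonormal_basis (dirspace \<gamma>) [w]"
    using bas(2) w by (simp add: orthonormal_basis_def dot_square_norm)
  have "a q - a p \<in> span {q - p}" using a gX by (simp add: edge_parallel_def pq(1))
  then obtain k where k: "a q - a p = k *\<^sub>R w"
  proof -
    obtain c where "a q - a p = c *\<^sub>R (q - p)" using \<open>a q - a p \<in> _\<close> by (auto simp: span_singleton)
    then have "a q - a p = (c * norm (q - p)) *\<^sub>R w" using pq(2) by (simp add: w_def)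
    then show thesis by (rule that)
  qed
  have "flag_sum \<gamma> [a] = inner w (a q - a p)"
    using sum_flag_form_segment[of p q a] gX pq by (simp add: flag_sum_def w_def)
  then have fs: "flag_sum \<gamma> [a] = k" unfolding k using w by (simp add: dot_square_norm)
  have "ori [w] = ori [q - p]"
    using orientation_scale[OF ori bas(1), of "inverse (norm (q - p))"] bas(2) pq(2) by (simp add: w_def)
  then have "coboundary X 0 (vertex_cochain X a) \<gamma> ori = ori [w] *\<^sub>R ext_incl (a q - a p)"
    using coboundary_vertex_cochain[of p q ori a] gX ori pq by simp
  also have "\<dots> = k *\<^sub>R ori [w] *\<^sub>R wedge [w]" unfolding k by (simp add: ext_incl_scaleR)
  also have "ori [w] *\<^sub>R wedge [w] = ori b *\<^sub>R wedge b"
    by (rule oriented_unit_multivector_unique[OF ori b bw])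
  finally show ?thesis by (simp add: fs)
qed

text \<open>
  The signs of the two orientations combine to the sign of the basis \<open>b\<^sub>0 @ [y - x]\<close> of
  \<open>dirspace \<gamma>\<close>, which is also the sign of \<open>b\<^sub>0 @ [u]\<close> as \<open>y - x\<close> points to the outer side of \<open>\<delta>\<close>. So
  all summands are multiples of the same unit multivector, with the coefficient of \<open>a y - a x\<close> along
  \<open>u\<close>.
\<close>

lemma cup_term:
  assumes gX: "\<gamma> \<in> X" and n: "aff_dim \<gamma> = int (m + 1)" and ori: "orientation (dirspace \<gamma>) ori"
    and d: "\<delta> facet_of \<gamma>" and xy: "(x, y) \<in> cell_ray_edges \<gamma> \<delta>"
    and b: "orthonormal_basis (dirspace \<gamma>) b" and a: "edge_parallel a"
    and r: "\<And>ori b. orientation (dirspace \<delta>) ori \<Longrightarrow> orthonormal_basis (dirspace \<delta>) b \<Longrightarrow>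
      r \<delta> ori = c *\<^sub>R ori b *\<^sub>R wedge b"
  shows "(case (SOME (ori\<^sub>1, ori\<^sub>2).
        oriented_direct_sum (dirspace \<gamma>) ori (dirspace \<delta>) ori\<^sub>1 (dirspace (closed_segment x y)) ori\<^sub>2) of
      (ori\<^sub>1, ori\<^sub>2) \<Rightarrow> r \<delta> ori\<^sub>1 * coboundary X 0 (vertex_cochain X a) (closed_segment x y) ori\<^sub>2) =
    (c * inner (facet_normal \<gamma> \<delta>) (a y - a x)) *\<^sub>R ori b *\<^sub>R wedge b"
proof -
  let ?u = "facet_normal \<gamma> \<delta>" and ?\<tau> = "closed_segment x y"
  note u = normal_facet[OF gX d]
  have "(\<delta>, ?\<tau>) \<in> cup_pairs m 1 \<gamma> (inner g)"
    using bij_betw_imp_surj_on[OF bij_betw_cell_ray_edges[OF gX n d]] xy by force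
  then have tf: "?\<tau> face_of \<gamma>" using cup_pairs_iff[OF gX n] by blast
  have tX: "?\<tau> \<in> X" by (rule face_cell[OF gX tf]) simp
  have lt: "inner ?u x < inner ?u y" using xy by (simp add: ray_edges_def)
  then have ne: "x \<noteq> y" by auto
  have e: "y - x \<in> dirspace \<gamma>" "inner ?u (y - x) > 0"
    using face_of_imp_subset[OF tf] lt by (auto intro: diff_in_dirspace simp: inner_diff_right)
  obtain b\<^sub>0 where b0: "orthonormal_basis (dirspace \<delta>) b\<^sub>0" using orthonormal_basis_exists[of "dirspace \<delta>"] by auto
  then have ob0: "ordered_basis (dirspace \<delta>) b\<^sub>0" by (simp add: orthonormal_basis_def)
  have be: "ordered_basis (dirspace ?\<tau>) [y - x]" using ordered_basis_segment[OF ne, of 1] by simp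
  obtain o1 o2 where o: "(SOME (ori\<^sub>1, ori\<^sub>2).
      oriented_direct_sum (dirspace \<gamma>) ori (dirspace \<delta>) ori\<^sub>1 (dirspace ?\<tau>) ori\<^sub>2) = (o1, o2)"
    by fastforce
  have "\<exists>z. case z of (ori\<^sub>1, ori\<^sub>2) \<Rightarrow>
      oriented_direct_sum (dirspace \<gamma>) ori (dirspace \<delta>) ori\<^sub>1 (dirspace ?\<tau>) ori\<^sub>2"
    using oriented_direct_sum_line_exists[OF ori ob0 be sign_snoc(1)[OF d u ob0 e]] by auto
  from someI_ex[OF this] have ds: "oriented_direct_sum (dirspace \<gamma>) ori (dirspace \<delta>) o1 (dirspace ?\<tau>) o2"
    unfolding o by simp
  then have o12: "orientation (dirspace \<delta>) o1" "orientation (dirspace ?\<tau>) o2"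
    and "ori (b\<^sub>0 @ [y - x]) = o1 b\<^sub>0 * o2 [y - x]"
    using ob0 be unfolding oriented_direct_sum_def by blast+
  then have signs: "o1 b\<^sub>0 * o2 [y - x] = ori (b\<^sub>0 @ [?u])"
    using sign_snoc(2)[OF d u ob0 e ori] by simp
  have "a y - a x \<in> dirspace \<gamma>"
  proof -
    have "a y - a x \<in> span {y - x}" using a tX by (simp add: edge_parallel_def)
    then show ?thesis using e(1) by (auto simp: span_singleton subspace_scale)
  qed
  then have w: "wedge b\<^sub>0 * ext_incl (a y - a x) = inner ?u (a y - a x) *\<^sub>R wedge (b\<^sub>0 @ [?u])"
    by (rule wedge_mult_ext_incl[OF d u ob0])
  have "r \<delta> o1 * coboundary X 0 (vertex_cochain X a) ?\<tau> o2 =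
      (c * (o1 b\<^sub>0 * o2 [y - x])) *\<^sub>R (wedge b\<^sub>0 * ext_incl (a y - a x))"
    unfolding r[OF o12(1) b0] coboundary_vertex_cochain[OF tX ne o12(2)] by (simp add: mult_ac)
  also have "\<dots> = (c * inner ?u (a y - a x)) *\<^sub>R ori (b\<^sub>0 @ [?u]) *\<^sub>R wedge (b\<^sub>0 @ [?u])"
    unfolding signs w by (simp add: mult_ac)
  also have "ori (b\<^sub>0 @ [?u]) *\<^sub>R wedge (b\<^sub>0 @ [?u]) = ori b *\<^sub>R wedge b"
    by (rule oriented_unit_multivector_unique[OF ori b orthonormal_basis_snoc[OF d u b0]])
  finally show ?thesis unfolding o by simp
qed

text \<open>
  For each facet the sum over the crossed edges telescopes from the top vertex of \<open>\<gamma>\<close> to the top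
  vertex of the facet; the terms at the top vertex of \<open>\<gamma>\<close> cancel by the relation of Minkowski.
\<close>

lemma cup_coboundary:
  assumes gX: "\<gamma> \<in> X" and m: "m = length as" "aff_dim \<gamma> = int (m + 1)"
    and ori: "orientation (dirspace \<gamma>) ori" and b: "orthonormal_basis (dirspace \<gamma>) b"
    and a: "edge_parallel a" and as: "\<And>a. a \<in> set as \<Longrightarrow> edge_parallel a"
    and r: "\<And>\<delta> ori b. \<delta> \<in> X \<Longrightarrow> aff_dim \<delta> = int m \<Longrightarrow> orientation (dirspace \<delta>) ori \<Longrightarrow>
      orthonormal_basis (dirspace \<delta>) b \<Longrightarrow> r \<delta> ori = flag_sum \<delta> as *\<^sub>R ori b *\<^sub>R wedge b"
  shows "cup X (inner g) m 1 r (coboundary X 0 (vertex_cochain X a)) \<gamma> ori =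
    flag_sum \<gamma> (a # as) *\<^sub>R ori b *\<^sub>R wedge b"
proof -
  let ?\<Omega> = "ori b *\<^sub>R wedge b" and ?u = "facet_normal \<gamma>" and ?D = "{\<delta>. \<delta> facet_of \<gamma>}"
  define T where "T \<delta> \<tau> = (case (SOME (ori\<^sub>1, ori\<^sub>2).
        oriented_direct_sum (dirspace \<gamma>) ori (dirspace \<delta>) ori\<^sub>1 (dirspace \<tau>) ori\<^sub>2) of
      (ori\<^sub>1, ori\<^sub>2) \<Rightarrow> r \<delta> ori\<^sub>1 * coboundary X 0 (vertex_cochain X a) \<tau> ori\<^sub>2)" for \<delta> \<tau>
  let ?E = "\<lambda>\<delta>. {\<tau>. (\<delta>, \<tau>) \<in> cup_pairs m 1 \<gamma> (inner g)}"
  have oc: "oriented_cell X (m + 1) \<gamma> ori" using gX m ori by (simp add: oriented_cell_def)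
  have pairs: "cup_pairs m 1 \<gamma> (inner g) = Sigma ?D ?E" using cup_pairs_iff[OF gX m(2)] by auto
  have finE: "finite (?E \<delta>)" for \<delta>
    by (rule finite_subset[OF _ finite_polyhedron_faces[OF cellD(1)[OF gX]]])
      (use cup_pairs_iff[OF gX m(2)] in auto)
  have inner_sum: "(\<Sum>\<tau>\<in>?E \<delta>. T \<delta> \<tau>) =
      (inner (?u \<delta>) (a (top_vertex \<delta>)) * flag_sum \<delta> as - inner (?u \<delta>) (a (top_vertex \<gamma>)) * flag_sum \<delta> as) *\<^sub>R ?\<Omega>"
    if d: "\<delta> facet_of \<gamma>" for \<delta>
  proof -
    have dX: "\<delta> \<in> X" "aff_dim \<delta> = int m" using facet_cell[OF gX d] d m by (auto simp: facet_of_def)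
    have "(\<Sum>\<tau>\<in>?E \<delta>. T \<delta> \<tau>) = (\<Sum>(x, y)\<in>cell_ray_edges \<gamma> \<delta>. T \<delta> (closed_segment x y))"
      using sum.reindex_bij_betw[OF bij_betw_cell_ray_edges[OF gX m(2) d], of "T \<delta>"]
      by (simp add: split_def)
    also have "\<dots> = (\<Sum>(x, y)\<in>cell_ray_edges \<gamma> \<delta>.
        (flag_sum \<delta> as * (inner (?u \<delta>) (a y) - inner (?u \<delta>) (a x))) *\<^sub>R ?\<Omega>)"
    proof (rule sum.cong[OF refl], clarify)
      fix x y assume xy: "(x, y) \<in> cell_ray_edges \<gamma> \<delta>"
      show "T \<delta> (closed_segment x y) =
          (flag_sum \<delta> as * (inner (?u \<delta>) (a y) - inner (?u \<delta>) (a x))) *\<^sub>R ?\<Omega>"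
        unfolding T_def inner_diff_right[symmetric]
        by (rule cup_term[where c = "flag_sum \<delta> as" and r = r, OF gX m(2) ori d xy b a])
          (rule r[OF dX])
    qed
    also have "\<dots> = (flag_sum \<delta> as *
        (\<Sum>(x, y)\<in>cell_ray_edges \<gamma> \<delta>. inner (?u \<delta>) (a y) - inner (?u \<delta>) (a x))) *\<^sub>R ?\<Omega>"
      by (simp only: split_def scaleR_sum_left[symmetric] sum_distrib_left)
    also have "\<dots> = (inner (?u \<delta>) (a (top_vertex \<delta>)) * flag_sum \<delta> as -
        inner (?u \<delta>) (a (top_vertex \<gamma>)) * flag_sum \<delta> as) *\<^sub>R ?\<Omega>"
      by (simp only: sum_cell_ray_edges[OF gX m(2) d] right_diff_distrib mult.commute)
    finally show ?thesis .
  qed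
  have "cup X (inner g) m 1 r (coboundary X 0 (vertex_cochain X a)) \<gamma> ori =
      (\<Sum>(\<delta>, \<tau>)\<in>cup_pairs m 1 \<gamma> (inner g). T \<delta> \<tau>)"
    unfolding cup_def if_P[OF oc] T_def ..
  also have "\<dots> = (\<Sum>(\<delta>, \<tau>)\<in>Sigma ?D ?E. T \<delta> \<tau>)"
    by (rule arg_cong[OF pairs])
  also have "\<dots> = (\<Sum>\<delta>\<in>?D. \<Sum>\<tau>\<in>?E \<delta>. T \<delta> \<tau>)"
    by (rule sum.Sigma[symmetric]) (use finite_facets[OF gX] finE in auto)
  also have "\<dots> = (\<Sum>\<delta>\<in>?D. (inner (?u \<delta>) (a (top_vertex \<delta>)) * flag_sum \<delta> as -
      inner (?u \<delta>) (a (top_vertex \<gamma>)) * flag_sum \<delta> as) *\<^sub>R ?\<Omega>)"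
    by (intro sum.cong refl inner_sum) simp
  also have "\<dots> = ((\<Sum>\<delta>\<in>?D. inner (?u \<delta>) (a (top_vertex \<delta>)) * flag_sum \<delta> as) -
      (\<Sum>\<delta>\<in>?D. inner (?u \<delta>) (a (top_vertex \<gamma>)) * flag_sum \<delta> as)) *\<^sub>R ?\<Omega>"
    by (simp only: scaleR_sum_left[symmetric] sum_subtractf)
  also have "\<dots> = flag_sum \<gamma> (a # as) *\<^sub>R ?\<Omega>"
    using minkowski_relation[where as = as and c = "a (top_vertex \<gamma>)", OF gX _ as] m
      flag_sum_Cons[OF gX a, of as] by simp
  finally show ?thesis .
qed

lemma iterated_cup_eq_flag_sum:
  assumes "\<And>i. i \<in> {1..Suc n} \<Longrightarrow> edge_parallel (a i)"
    and "\<gamma> \<in> X" "aff_dim \<gamma> = int (Suc n)" "orientation (dirspace \<gamma>) ori"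
    and "orthonormal_basis (dirspace \<gamma>) b"
  shows "iterated_cup X (inner g) (\<lambda>i. coboundary X 0 (vertex_cochain X (a i))) (Suc n) \<gamma> ori =
    flag_sum \<gamma> (map a (rev [1..<Suc (Suc n)])) *\<^sub>R ori b *\<^sub>R wedge b"
  using assms
proof (induction n arbitrary: \<gamma> ori b)
  case 0
  then show ?case using coboundary_edge[of \<gamma> ori b "a 1"] by simp
next
  case (Suc n)
  let ?as = "map a (rev [1..<Suc (Suc n)])"
  have "cup X (inner g) (Suc n) 1 (iterated_cup X (inner g) (\<lambda>i. coboundary X 0 (vertex_cochain X (a i))) (Suc n))
      (coboundary X 0 (vertex_cochain X (a (Suc (Suc n))))) \<gamma> ori =
    flag_sum \<gamma> (a (Suc (Suc n)) # ?as) *\<^sub>R ori b *\<^sub>R wedge b"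
  proof (rule cup_coboundary[OF Suc.prems(2) _ _ Suc.prems(4,5)])
    show "edge_parallel c" if "c \<in> set ?as" for c using that Suc.prems(1) by auto
    show "iterated_cup X (inner g) (\<lambda>i. coboundary X 0 (vertex_cochain X (a i))) (Suc n) \<delta> ori =
        flag_sum \<delta> ?as *\<^sub>R ori b *\<^sub>R wedge b"
      if "\<delta> \<in> X" "aff_dim \<delta> = int (Suc n)" "orientation (dirspace \<delta>) ori" "orthonormal_basis (dirspace \<delta>) b"
      for \<delta> ori b
      using Suc.IH[OF _ that] Suc.prems(1) by simp
  qed (use Suc.prems in auto)
  then show ?case by simp
qed

text \<open>
  The flag form reads its arguments from the last factor to the first one, hence the reversal of
  words.
\<close>

lemma flag_sum_determined:
  assumes gX: "\<gamma> \<in> X"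
    and eq: "\<And>x. {x} \<in> X \<Longrightarrow> (\<Prod>i=1..p. sym_incl (a i x)) = (\<Prod>i=1..p. sym_incl (b i x))"
  shows "flag_sum \<gamma> (map a (rev [1..<Suc p])) = flag_sum \<gamma> (map b (rev [1..<Suc p]))"
  unfolding flag_sum_def
proof (rule sum.cong[OF refl])
  fix x assume "x \<in> vertices \<gamma>"
  then have x: "{x} \<in> X" by (rule vertex_cell[OF gX])
  let ?N = "\<lambda>ws. flag_form \<gamma> x (rev ws)"
  have "?N (map (\<lambda>i. a i x) [1..<Suc p]) = ?N (map (\<lambda>i. b i x) [1..<Suc p])"
  proof (rule symmetric_multilinear_determined[OF _ _ _ eq[OF x]])
    show "?N (us @ (w + w') # ws) = ?N (us @ w # ws) + ?N (us @ w' # ws)" for us w w' ws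
      using flag_form_add[of \<gamma> x "rev ws" w w' "rev us"] by simp
    show "?N (us @ (k *\<^sub>R w) # ws) = k * ?N (us @ w # ws)" for us k w ws
      using flag_form_scaleR[of \<gamma> x "rev ws" k w "rev us"] by simp
    show "?N (us @ w # w' # ws) = ?N (us @ w' # w # ws)" for us w w' ws
      using flag_form_swap[OF cellD(1)[OF gX], of x "rev ws" w' w "rev us"] by simp
  qed
  then show "flag_form \<gamma> x (map (\<lambda>a. a x) (map a (rev [1..<Suc p]))) =
      flag_form \<gamma> x (map (\<lambda>a. a x) (map b (rev [1..<Suc p])))"
    by (simp only: rev_map map_map comp_def)
qed

lemma iterated_cup_unoriented:
  assumes "\<not> oriented_cell X (Suc n) \<gamma> ori"
  shows "iterated_cup X w (\<lambda>i. coboundary X 0 (vertex_cochain X (a i))) (Suc n) \<gamma> ori = 0"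
  using assms by (cases n) (simp_all add: coboundary_def cup_def)

end

theorem proposition4:
  fixes X :: "'a::euclidean_space set set"
    and v :: "'a \<Rightarrow> real"
    and a b :: "nat \<Rightarrow> 'a \<Rightarrow> 'a"
    and p :: nat
  assumes "p_complex X"
    and "\<forall>\<gamma>\<in>X. compact \<gamma>"
    and "p \<ge> 1"
    and "v \<in> convenient X"
    and "\<forall>i\<in>{1..p}. coboundary X 0 (vertex_cochain X (a i)) \<in> R_cocycles X 1"
    and "\<forall>i\<in>{1..p}. coboundary X 0 (vertex_cochain X (b i)) \<in> R_cocycles X 1"
    and "\<forall>x. {x} \<in> X \<longrightarrow> (\<Prod>i=1..p. sym_incl (a i x)) = (\<Prod>i=1..p. sym_incl (b i x))"
  shows "iterated_cup X v (\<lambda>i. coboundary X 0 (vertex_cochain X (a i))) p =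
         iterated_cup X v (\<lambda>i. coboundary X 0 (vertex_cochain X (b i))) p"
proof -
  have "v \<in> dual_space UNIV" using assms(4) by (auto simp: convenient_def pq_convenient_def)
  then have "linear v" by (intro linearI) (auto simp: dual_space_def)
  then obtain g where g: "v = inner g" by (rule linear_functional_inner)
  interpret convenient_complex X g
    by unfold_locales (use assms g in auto)
  obtain n where p: "p = Suc n" using assms(3) by (cases p) auto
  have par: "edge_parallel (a i)" "edge_parallel (b i)" if "i \<in> {1..Suc n}" for i
    using that assms(5,6) edge_parallel_if_R_cocycle unfolding p by blast+
  show ?thesis
  proof (intro ext)
    fix \<gamma> ori
    show "iterated_cup X v (\<lambda>i. coboundary X 0 (vertex_cochain X (a i))) p \<gamma> ori =
        iterated_cup X v (\<lambda>i. coboundary X 0 (vertex_cochain X (b i))) p \<gamma> ori"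
    proof (cases "oriented_cell X (Suc n) \<gamma> ori")
      case False
      then show ?thesis unfolding p by (simp only: iterated_cup_unoriented not_False_eq_True)
    next
      case True
      then have c: "\<gamma> \<in> X" "aff_dim \<gamma> = int (Suc n)" "orientation (dirspace \<gamma>) ori"
        by (auto simp: oriented_cell_def)
      obtain B where B: "orthonormal_basis (dirspace \<gamma>) B"
        using orthonormal_basis_exists[of "dirspace \<gamma>"] by auto
      have "flag_sum \<gamma> (map a (rev [1..<Suc p])) = flag_sum \<gamma> (map b (rev [1..<Suc p]))"
        using assms(7) by (intro flag_sum_determined[OF c(1)]) blast
      then show ?thesis
        using iterated_cup_eq_flag_sum[OF par(1) c B] iterated_cup_eq_flag_sum[OF par(2) c B]
        unfolding p g by simp
    qed
  qed
qed

end
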